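(* Let $K_n$ be the number of distinct unordered rooted trees represented by the fringe subtrees of a random binary search tree of size $n$ (two fringe subtrees being identified if they are isomorphic as rooted unordered trees). There are constants $c_3\approx1.5470025923$ and $c_4\approx1.8191392203$ such that (i) $c_3\frac{n}{\log n}(1+o(1))\le\mathbb{E}(K_n)\le c_4\frac{n}{\log n}(1+o(1))$; (ii) with probability tending to $1$, $c_3\frac{n}{\log n}(1+o(1))\le K_n\le c_4\frac{n}{\log n}(1+o(1))$.
   Context: A random binary search tree of size $n$ is the binary tree obtained by inserting the keys $1,\dots,n$ in the order of a uniformly random permutation (equivalently, a random binary increasing tree). A fringe subtree is a vertex together with all its descendants. *)

theory Defs
  imports
    "HOL-Probability.Probability"
    "HOL-Library.Tree"
    "HOL-Library.Landau_Symbols"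
begin

subsection \<open>Random binary search trees\<close>

fun bst_insert :: "'a::linorder \<Rightarrow> 'a tree \<Rightarrow> 'a tree" where
  "bst_insert x \<langle>\<rangle> = \<langle>\<langle>\<rangle>, x, \<langle>\<rangle>\<rangle>"
| "bst_insert x \<langle>l, a, r\<rangle> =
     (if x < a then \<langle>bst_insert x l, a, r\<rangle>
      else if a < x then \<langle>l, a, bst_insert x r\<rangle>
      else \<langle>l, a, r\<rangle>)"

text \<open>The keys are inserted from the head of the list to its end, starting from the empty tree.\<close>

definition bst_of_list :: "'a::linorder list \<Rightarrow> 'a tree" where
  "bst_of_list xs = fold bst_insert xs \<langle>\<rangle>"

definition random_bst :: "nat \<Rightarrow> nat tree pmf" where
  "random_bst n = map_pmf bst_of_list (pmf_of_set (permutations_of_set {1..n}))"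

subsection \<open>Fringe subtrees as unordered rooted trees\<close>

text \<open>The library's \<^const>\<open>subtrees\<close> also contains the empty tree, which is not rooted at a
  vertex.\<close>

definition fringe_subtrees :: "'a tree \<Rightarrow> 'a tree set" where
  "fringe_subtrees t = subtrees t - {\<langle>\<rangle>}"

text \<open>The keys of a search tree are pairwise distinct, so they serve as its vertices: the vertex set
  of a tree \<open>t\<close> is \<^term>\<open>set_tree t\<close>, and the root of a nonempty tree \<open>t\<close> is
  \<^term>\<open>value t\<close>. The following three notions are only meaningful for trees with pairwise distinct
  keys. A pair \<open>(x, y)\<close> belongs to \<open>child_rel t\<close> if \<open>y\<close> is a child of \<open>x\<close>, on either side.\<close>

definition child_rel :: "'a tree \<Rightarrow> ('a \<times> 'a) set" where
  "child_rel t = {(x, value u) | l x r u. \<langle>l, x, r\<rangle> \<in> subtrees t \<and> u \<in> {l, r} \<and> u \<noteq> \<langle>\<rangle>}"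

definition rooted_iso :: "'a tree \<Rightarrow> 'b tree \<Rightarrow> bool" where
  "rooted_iso s t \<longleftrightarrow>
     (\<exists>f. bij_betw f (set_tree s) (set_tree t) \<and> f (value s) = value t \<and>
          (\<forall>x\<in>set_tree s. \<forall>y\<in>set_tree s. (x, y) \<in> child_rel s \<longleftrightarrow> (f x, f y) \<in> child_rel t))"

definition num_distinct_fringe :: "'a tree \<Rightarrow> nat" where
  "num_distinct_fringe t =
     card (fringe_subtrees t //
       {(s, u). s \<in> fringe_subtrees t \<and> u \<in> fringe_subtrees t \<and> rooted_iso s u})"

end

theory Submission
  imports Defs "HOL-Library.Uprod" "HOL-Real_Asymp.Real_Asymp"
begin

text \<open>
  A shape is the unordered tree underlying a fringe subtree. Given its size, the left subtree of a
  random binary search tree is uniformly split off at the root, so a sum \<open>F\<close> of contributions of all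
  fringe subtrees satisfies the Quicksort recurrence. If the contribution is a constant \<open>\<tau>\<close> for all
  sizes above \<open>K\<close>, then the mean of \<open>F\<close> is exactly \<open>\<alpha> (n + 1) - \<tau>\<close> for \<open>n > K\<close> and the variance is
  \<open>O(n)\<close>. In particular the number \<open>X\<close> of fringe subtrees of size above \<open>k\<close> concentrates around
  \<open>2 n / k\<close>.

  Upper bound: there are at most \<open>X\<close> shapes of size above \<open>k\<close>, and the number of shapes of size at
  most \<open>k\<close> is \<open>O((1 / x) ^ k)\<close> as soon as their generating function \<open>U\<close> converges at \<open>x\<close>. Since
  \<open>U(x) = 1 + x (U(x)^2 + U(x^2)) / 2\<close>, an upper bound for \<open>U(x^2)\<close> yields one for \<open>U(x)\<close>. Take
  \<open>k = \<beta> ln n\<close> with \<open>\<beta>\<close> slightly below \<open>1 / ln (1 / x)\<close>.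

  Lower bound: the logarithm of the probability of the shape of a tree is itself such a sum. After
  replacing the contributions of large subtrees by a smaller constant it concentrates, so most trees of
  size \<open>k\<close> have a shape of probability at most \<open>exp (- \<gamma> k)\<close>. For a shape of probability \<open>p\<close>, the number
  \<open>N\<close> of fringe subtrees of that shape satisfies \<open>E (N (N - 1)) \<le> p^2 n^2\<close>. Hence for \<open>k\<close> slightly
  above \<open>ln n / \<gamma>\<close> almost all of the \<open>X\<close> large fringe subtrees have different shapes.

  The constants may be chosen strictly outside the interval between the optimal ones, which makes both
  error terms vanish.
\<close>

subsection \<open>Unordered shapes\<close>

text \<open>A missing child is recorded as \<open>UEmpty\<close>, so vertices with zero, one and two
  children share one constructor and left and right are forgotten by the unordered pair
  alone.\<close>

datatype utree = UEmpty | UNode "utree uprod"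

fun canon :: "'a tree \<Rightarrow> utree" where
  "canon \<langle>\<rangle> = UEmpty"
| "canon \<langle>l, x, r\<rangle> = UNode (Upair (canon l) (canon r))"

lemma canon_eq_UEmpty_iff [simp]: "canon t = UEmpty \<longleftrightarrow> t = \<langle>\<rangle>"
  by (cases t) auto

lemma UEmpty_eq_canon_iff [simp]: "UEmpty = canon t \<longleftrightarrow> t = \<langle>\<rangle>"
  by (cases t) auto

lemma canon_eq_imp_size_eq: "canon s = canon t \<Longrightarrow> size s = size t"
proof (induction s arbitrary: t)
  case Leaf
  then show ?case by (cases t) auto
next
  case (Node l x r)
  then obtain l' x' r' where t: "t = \<langle>l', x', r'\<rangle>" by (cases t) auto
  with Node.prems have "canon l = canon l' \<and> canon r = canon r' \<or> canon l = canon r' \<and> canon r = canon l'"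
    by simp
  with Node.IH have "size l + size r = size l' + size r'"
    by (metis add.commute)
  then show ?case by (simp add: t)
qed

lemma canon_map_tree [simp]: "canon (map_tree f t) = canon t"
  by (induction t) auto

section \<open>Rooted isomorphism and equality of shapes\<close>

lemma child_rel_Leaf [simp]: "child_rel \<langle>\<rangle> = {}"
  by (auto simp: child_rel_def)

text \<open>A set with at most one element, so that empty and nonempty children of a vertex can be
  treated uniformly.\<close>

definition root_keys :: "'a tree \<Rightarrow> 'a set" where
  "root_keys t = (if t = \<langle>\<rangle> then {} else {value t})"

lemma root_keys_simps [simp]: "root_keys \<langle>\<rangle> = {}" "root_keys \<langle>l, x, r\<rangle> = {x}"
  by (auto simp: root_keys_def)

lemma root_keys_subset: "root_keys t \<subseteq> set_tree t"
  by (cases t) auto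

lemma child_rel_Node:
  "child_rel \<langle>l, x, r\<rangle> = {x} \<times> (root_keys l \<union> root_keys r) \<union> child_rel l \<union> child_rel r"
  unfolding child_rel_def root_keys_def by (auto; blast)

lemma child_rel_subset: "child_rel t \<subseteq> set_tree t \<times> set_tree t"
proof (induction t)
  case (Node l x r)
  then show ?case using root_keys_subset[of l] root_keys_subset[of r]
    by (auto simp: child_rel_Node)
qed auto

text \<open>Every vertex is reachable from the root along child edges. This is what forces a map
  that respects children to stay inside the matching subtree.\<close>

lemma set_tree_child_induct:
  assumes "y \<in> set_tree t" "P (value t)" "\<And>y z. (y, z) \<in> child_rel t \<Longrightarrow> P y \<Longrightarrow> P z"
  shows "P y"
  using assms
proof (induction t)
  case (Node l x r)
  have "P x" using Node.prems by simp
  have *: "P y" if "y \<in> set_tree u" "u = l \<or> u = r" for u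
  proof -
    have "u \<noteq> \<langle>\<rangle>" using that by auto
    then have "value u \<in> root_keys l \<union> root_keys r" using that by (auto simp: root_keys_def)
    then have "P (value u)"
      using Node.prems(3)[of x "value u"] \<open>P x\<close> by (auto simp: child_rel_Node)
    moreover have "\<And>y z. (y, z) \<in> child_rel u \<Longrightarrow> P y \<Longrightarrow> P z"
      using Node.prems(3) that by (auto simp: child_rel_Node)
    ultimately show ?thesis using that Node.IH by blast
  qed
  show ?case using Node.prems(1) \<open>P x\<close> * by auto
qed auto

context
  fixes l r :: "'a tree" and x :: 'a
  assumes dist: "distinct (inorder \<langle>l, x, r\<rangle>)"
begin

lemma distinct_NodeD:
  "distinct (inorder l)" "distinct (inorder r)" "x \<notin> set_tree l" "x \<notin> set_tree r"
  "set_tree l \<inter> set_tree r = {}"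
  using dist by auto

text \<open>Distinct keys keep the root and the two vertex sets apart, so no edge of one subtree
  starts at the root or in the other subtree. The next two facts hold for the same reason.\<close>

lemma children_root: "child_rel \<langle>l, x, r\<rangle> `` {x} = root_keys l \<union> root_keys r"
  using distinct_NodeD child_rel_subset[of l] child_rel_subset[of r] by (auto simp: child_rel_Node)

lemma children_left: "y \<in> set_tree l \<Longrightarrow> child_rel \<langle>l, x, r\<rangle> `` {y} = child_rel l `` {y}"
  using distinct_NodeD child_rel_subset[of l] child_rel_subset[of r] by (auto simp: child_rel_Node)

lemma children_right: "y \<in> set_tree r \<Longrightarrow> child_rel \<langle>l, x, r\<rangle> `` {y} = child_rel r `` {y}"
  using distinct_NodeD child_rel_subset[of l] child_rel_subset[of r] by (auto simp: child_rel_Node)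

end

text \<open>A local form of rooted isomorphism: it speaks only of the root and of child sets, covers
  the empty tree, and can be restricted to subtrees, which makes it suitable for induction.\<close>

definition child_hom :: "('a \<Rightarrow> 'b) \<Rightarrow> 'a tree \<Rightarrow> 'b tree \<Rightarrow> bool" where
  "child_hom f s t \<longleftrightarrow> inj_on f (set_tree s) \<and> f ` root_keys s = root_keys t \<and>
     (\<forall>y\<in>set_tree s. f ` (child_rel s `` {y}) = child_rel t `` {f y})"

text \<open>Starting from the matched roots and following child edges, \<open>f\<close> sends the
  vertices of \<open>u\<close> into \<open>v\<close>; there the child sets agree with those of the
  surrounding trees, so the condition is inherited.\<close>

lemma child_hom_subtree:
  assumes hom: "child_hom f s t"
    and sub: "set_tree u \<subseteq> set_tree s" "\<And>y. y \<in> set_tree u \<Longrightarrow> child_rel s `` {y} = child_rel u `` {y}"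
    and sub': "\<And>y. y \<in> set_tree v \<Longrightarrow> child_rel t `` {y} = child_rel v `` {y}"
    and root: "f ` root_keys u = root_keys v"
  shows "child_hom f u v"
proof (cases "u = \<langle>\<rangle>")
  case False
  then have v: "v \<noteq> \<langle>\<rangle>" and rt: "f (value u) = value v" using root by (auto simp: root_keys_def split: if_splits)
  have mem: "f y \<in> set_tree v \<and> y \<in> set_tree u" if "y \<in> set_tree u" for y
    using that
  proof (rule set_tree_child_induct)
    show "f (value u) \<in> set_tree v \<and> value u \<in> set_tree u"
      using v False rt by (cases u; cases v) auto
    fix y z assume yz: "(y, z) \<in> child_rel u" and IH: "f y \<in> set_tree v \<and> y \<in> set_tree u"
    have "f ` (child_rel u `` {y}) = child_rel v `` {f y}"
      using hom IH sub sub' unfolding child_hom_def by (metis subsetD)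
    then have "(f y, f z) \<in> child_rel v" using yz by auto
    then show "f z \<in> set_tree v \<and> z \<in> set_tree u"
      using yz child_rel_subset[of u] child_rel_subset[of v] by blast
  qed
  show ?thesis unfolding child_hom_def
  proof (intro conjI ballI)
    show "inj_on f (set_tree u)" using hom sub(1) unfolding child_hom_def by (meson inj_on_subset)
    fix y assume "y \<in> set_tree u"
    then show "f ` (child_rel u `` {y}) = child_rel v `` {f y}"
      using hom mem sub sub' unfolding child_hom_def by (metis subsetD)
  qed (fact root)
next
  case True
  then show ?thesis using root by (auto simp: child_hom_def)
qed

text \<open>Applied to the root vertices of the two subtrees on either side: the at most two
  children of the root are matched either straight or crosswise.\<close>

lemma doubleton_cases:
  assumes "inj_on f (A \<union> B)" "f ` (A \<union> B) = C \<union> D"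
    and "A \<inter> B = {}" "C \<inter> D = {}" "A = {} \<or> (\<exists>a. A = {a})" "B = {} \<or> (\<exists>b. B = {b})"
    "C = {} \<or> (\<exists>c. C = {c})" "D = {} \<or> (\<exists>d. D = {d})"
  shows "f ` A = C \<and> f ` B = D \<or> f ` A = D \<and> f ` B = C"
  using assms(5-8) assms(1-4)
  by (elim disjE exE) (auto simp: doubleton_eq_iff)

text \<open>Whether the children of the root are matched straight or crosswise, the unordered pair
  of their shapes is the same, and the induction hypothesis applies to each matched pair.\<close>

lemma child_hom_imp_canon_eq:
  assumes "child_hom f s t" "distinct (inorder s)" "distinct (inorder t)"
  shows "canon s = canon t"
  using assms
proof (induction s arbitrary: t)
  case Leaf
  then show ?case by (auto simp: child_hom_def root_keys_def split: if_splits)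
next
  case (Node l x r)
  from Node.prems(1) have "t \<noteq> \<langle>\<rangle>" by (auto simp: child_hom_def)
  then obtain l' x' r' where t: "t = \<langle>l', x', r'\<rangle>" by (cases t) auto
  note d = Node.prems(2) and d' = Node.prems(3)[unfolded t]
  from Node.prems(1) have fx: "f x = x'" by (simp add: child_hom_def t)
  have inj: "inj_on f (set_tree \<langle>l, x, r\<rangle>)" using Node.prems(1) by (simp add: child_hom_def)
  have img: "f ` (root_keys l \<union> root_keys r) = root_keys l' \<union> root_keys r'"
    using Node.prems(1) children_root[OF d] children_root[OF d'] fx
    unfolding child_hom_def t by (metis tree.set_intros(2))
  have "f ` root_keys l = root_keys l' \<and> f ` root_keys r = root_keys r' \<or>
        f ` root_keys l = root_keys r' \<and> f ` root_keys r = root_keys l'"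
  proof (rule doubleton_cases[OF _ img])
    show "inj_on f (root_keys l \<union> root_keys r)"
      using root_keys_subset[of l] root_keys_subset[of r] by (intro inj_on_subset[OF inj]) auto
    show "root_keys l \<inter> root_keys r = {}"
      using distinct_NodeD[OF d] root_keys_subset[of l] root_keys_subset[of r] by blast
    show "root_keys l' \<inter> root_keys r' = {}"
      using distinct_NodeD[OF d'] root_keys_subset[of l'] root_keys_subset[of r'] by blast
  qed (auto simp: root_keys_def)
  moreover have "canon u = canon v"
    if uv: "u = l \<or> u = r" "v = l' \<or> v = r'" and root: "f ` root_keys u = root_keys v" for u v
  proof -
    have "set_tree u \<subseteq> set_tree \<langle>l, x, r\<rangle>" using uv by auto
    moreover have "child_rel \<langle>l, x, r\<rangle> `` {y} = child_rel u `` {y}" if "y \<in> set_tree u" for y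
      using uv(1) that children_left[OF d] children_right[OF d] by metis
    moreover have "child_rel t `` {y} = child_rel v `` {y}" if "y \<in> set_tree v" for y
      using uv(2) that children_left[OF d'] children_right[OF d'] unfolding t by metis
    ultimately have "child_hom f u v"
      using child_hom_subtree[OF Node.prems(1) _ _ _ root] by blast
    then show ?thesis using uv Node.IH distinct_NodeD[OF d] distinct_NodeD[OF d'] by metis
  qed
  ultimately have "canon l = canon l' \<and> canon r = canon r' \<or> canon l = canon r' \<and> canon r = canon l'"
    by blast
  then show ?case by (simp add: t)
qed

text \<open>Maps for the two subtrees are glued along the disjoint vertex sets. Here
  \<open>u\<close> and \<open>v\<close> are the subtrees of \<open>t\<close> reordered so that
  \<open>u\<close> matches \<open>l\<close> and \<open>v\<close> matches \<open>r\<close>.\<close>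

lemma canon_eq_imp_child_hom:
  assumes "canon s = canon t" "distinct (inorder s)" "distinct (inorder t)"
  shows "\<exists>f. child_hom f s t \<and> f ` set_tree s = set_tree t"
  using assms
proof (induction s arbitrary: t)
  case Leaf
  then have "t = \<langle>\<rangle>" by (cases t) auto
  then show ?case by (auto simp: child_hom_def)
next
  case (Node l x r)
  obtain l' x' r' where t: "t = \<langle>l', x', r'\<rangle>" using Node.prems(1) by (cases t) auto
  note d = Node.prems(2) and d' = Node.prems(3)[unfolded t]
  have "canon l = canon l' \<and> canon r = canon r' \<or> canon l = canon r' \<and> canon r = canon l'"
    using Node.prems(1) by (simp add: t)
  then obtain u v where uv: "canon l = canon u" "canon r = canon v"
    and cs: "u = l' \<and> v = r' \<or> u = r' \<and> v = l'" by blast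
  have dd: "distinct (inorder u)" "distinct (inorder v)" "x' \<notin> set_tree u" "x' \<notin> set_tree v"
    "set_tree u \<inter> set_tree v = {}" "set_tree t = insert x' (set_tree u \<union> set_tree v)"
    using cs distinct_NodeD[OF d'] by (auto simp: t)
  have ch: "child_rel t `` {x'} = root_keys u \<union> root_keys v"
    "\<And>y. y \<in> set_tree u \<Longrightarrow> child_rel t `` {y} = child_rel u `` {y}"
    "\<And>y. y \<in> set_tree v \<Longrightarrow> child_rel t `` {y} = child_rel v `` {y}"
    using cs children_root[OF d'] children_left[OF d'] children_right[OF d'] unfolding t
    by (metis Un_commute)+
  obtain g where g: "child_hom g l u" "g ` set_tree l = set_tree u"
    using Node.IH(1)[OF uv(1)] distinct_NodeD[OF d] dd by blast
  obtain h where h: "child_hom h r v" "h ` set_tree r = set_tree v"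
    using Node.IH(2)[OF uv(2)] distinct_NodeD[OF d] dd by blast
  define f where "f = (\<lambda>z. if z = x then x' else if z \<in> set_tree l then g z else h z)"
  have fx: "f x = x'" by (simp add: f_def)
  have fl: "f z = g z" if "z \<in> set_tree l" for z using that distinct_NodeD[OF d] by (auto simp: f_def)
  have fr: "f z = h z" if "z \<in> set_tree r" for z using that distinct_NodeD[OF d] by (auto simp: f_def)
  have fl': "f ` A = g ` A" if "A \<subseteq> set_tree l" for A using that fl by (intro image_cong) auto
  have fr': "f ` A = h ` A" if "A \<subseteq> set_tree r" for A using that fr by (intro image_cong) auto
  have il: "f ` set_tree l = set_tree u" and ir: "f ` set_tree r = set_tree v"
    using fl'[of "set_tree l"] fr'[of "set_tree r"] g h by auto
  have "inj_on f (set_tree l)" "inj_on f (set_tree r)"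
    using g(1) h(1) fl fr by (auto simp: child_hom_def inj_on_def)
  then have "inj_on f (set_tree l \<union> set_tree r)"
    unfolding inj_on_Un using il ir dd(5) by blast
  then have inj: "inj_on f (set_tree \<langle>l, x, r\<rangle>)"
    using il ir dd(3,4) fx by (auto simp: image_Un)
  have "f ` (child_rel \<langle>l, x, r\<rangle> `` {y}) = child_rel t `` {f y}" if y: "y \<in> set_tree \<langle>l, x, r\<rangle>" for y
  proof -
    consider "y = x" | "y \<in> set_tree l" | "y \<in> set_tree r" using y by auto
    then show ?thesis
    proof cases
      case 1
      then show ?thesis
        using g(1) h(1) fl'[OF root_keys_subset] fr'[OF root_keys_subset]
        by (simp add: children_root[OF d] ch fx image_Un child_hom_def)
    next
      case 2
      then have "f y \<in> set_tree u" using il by auto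
      moreover have "child_rel l `` {y} \<subseteq> set_tree l" using child_rel_subset[of l] by auto
      ultimately show ?thesis using g(1) 2 fl' fl
        by (simp add: children_left[OF d 2] ch child_hom_def)
    next
      case 3
      then have "f y \<in> set_tree v" using ir by auto
      moreover have "child_rel r `` {y} \<subseteq> set_tree r" using child_rel_subset[of r] by auto
      ultimately show ?thesis using h(1) 3 fr' fr
        by (simp add: children_right[OF d 3] ch child_hom_def)
    qed
  qed
  then have "child_hom f \<langle>l, x, r\<rangle> t" using inj fx by (simp add: child_hom_def t)
  moreover have "f ` set_tree \<langle>l, x, r\<rangle> = set_tree t"
    using il ir fx dd(6) by (auto simp: image_Un)
  ultimately show ?case by blast
qed

lemma rooted_iso_iff_canon_eq:
  assumes "s \<noteq> \<langle>\<rangle>" "t \<noteq> \<langle>\<rangle>" "distinct (inorder s)" "distinct (inorder t)"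
  shows "rooted_iso s t \<longleftrightarrow> canon s = canon t"
proof
  assume "rooted_iso s t"
  then obtain f where f: "bij_betw f (set_tree s) (set_tree t)" "f (value s) = value t"
    "\<And>x y. x \<in> set_tree s \<Longrightarrow> y \<in> set_tree s \<Longrightarrow> (x, y) \<in> child_rel s \<longleftrightarrow> (f x, f y) \<in> child_rel t"
    unfolding rooted_iso_def by blast
  have "f ` (child_rel s `` {y}) = child_rel t `` {f y}" if y: "y \<in> set_tree s" for y
  proof (intro equalityI subsetI)
    fix z assume "z \<in> child_rel t `` {f y}"
    then have z: "(f y, z) \<in> child_rel t" by auto
    then have "z \<in> f ` set_tree s"
      using child_rel_subset[of t] bij_betw_imp_surj_on[OF f(1)] by blast
    then show "z \<in> f ` (child_rel s `` {y})" using z f(3) y by blast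
  qed (use f(3) y child_rel_subset[of s] in blast)
  then have "child_hom f s t"
    using f assms(1,2) by (auto simp: child_hom_def root_keys_def bij_betw_def)
  then show "canon s = canon t" using child_hom_imp_canon_eq assms by blast
next
  assume "canon s = canon t"
  then obtain f where f: "child_hom f s t" "f ` set_tree s = set_tree t"
    using canon_eq_imp_child_hom assms by blast
  have "(x, y) \<in> child_rel s \<longleftrightarrow> (f x, f y) \<in> child_rel t" if "x \<in> set_tree s" "y \<in> set_tree s" for x y
  proof
    assume "(f x, f y) \<in> child_rel t"
    then have "f y \<in> f ` (child_rel s `` {x})" using f(1) that by (auto simp: child_hom_def)
    then obtain z where z: "(x, z) \<in> child_rel s" "f y = f z" by auto
    then have "z = y" using f(1) that child_rel_subset[of s] by (auto simp: child_hom_def inj_on_def)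
    then show "(x, y) \<in> child_rel s" using z by simp
  next
    assume "(x, y) \<in> child_rel s"
    then have "f y \<in> f ` (child_rel s `` {x})" by auto
    then show "(f x, f y) \<in> child_rel t" using f(1) that by (auto simp: child_hom_def)
  qed
  moreover have "bij_betw f (set_tree s) (set_tree t)" "f (value s) = value t"
    using f assms(1,2) by (auto simp: child_hom_def bij_betw_def root_keys_def)
  ultimately show "rooted_iso s t" unfolding rooted_iso_def by blast
qed

definition num_shapes :: "'a tree \<Rightarrow> nat" where
  "num_shapes t = card (canon ` fringe_subtrees t)"

text \<open>The classes of the kernel of \<open>f\<close> on \<open>A\<close> are its nonempty
  fibres, one for each value attained.\<close>

lemma card_quotient_kernel:
  "card (A // {(s, u). s \<in> A \<and> u \<in> A \<and> f s = f u}) = card (f ` A)"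
proof -
  have "A // {(s, u). s \<in> A \<and> u \<in> A \<and> f s = f u} = (\<lambda>y. {u \<in> A. f u = y}) ` f ` A"
    unfolding quotient_def by (auto simp: image_iff; force)
  moreover have "inj_on (\<lambda>y. {u \<in> A. f u = y}) (f ` A)"
    by (rule inj_onI) blast
  ultimately show ?thesis by (simp add: card_image)
qed

lemma distinct_inorder_subtrees:
  "s \<in> subtrees t \<Longrightarrow> distinct (inorder t) \<Longrightarrow> distinct (inorder s)"
  by (induction t) auto

lemma num_distinct_fringe_eq:
  assumes "distinct (inorder t)"
  shows "num_distinct_fringe t = num_shapes t"
proof -
  have "{(s, u). s \<in> fringe_subtrees t \<and> u \<in> fringe_subtrees t \<and> rooted_iso s u} =
        {(s, u). s \<in> fringe_subtrees t \<and> u \<in> fringe_subtrees t \<and> canon s = canon u}"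
    using rooted_iso_iff_canon_eq distinct_inorder_subtrees[OF _ assms]
    by (auto simp: fringe_subtrees_def)
  then show ?thesis
    unfolding num_distinct_fringe_def num_shapes_def by (simp only: card_quotient_kernel)
qed

lemma subtrees_map_tree: "subtrees (map_tree f t) = map_tree f ` subtrees t"
  by (induction t) auto

lemma num_shapes_map_tree [simp]: "num_shapes (map_tree f t) = num_shapes t"
proof -
  have "fringe_subtrees (map_tree f t) = map_tree f ` fringe_subtrees t"
    by (auto simp: fringe_subtrees_def subtrees_map_tree)
  then show ?thesis by (simp add: num_shapes_def image_image)
qed

lemma set_tree_bst_insert [simp]: "set_tree (bst_insert x t) = insert x (set_tree t)"
  by (induction t) auto

lemma bst_bst_insert: "bst t \<Longrightarrow> bst (bst_insert x t)"
  by (induction t) auto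

lemma bst_bst_of_list: "bst (bst_of_list xs)"
proof -
  have "bst t \<Longrightarrow> bst (fold bst_insert xs t)" for t
    by (induction xs arbitrary: t) (auto simp: bst_bst_insert)
  then show ?thesis by (simp add: bst_of_list_def)
qed

lemma distinct_inorder_bst_of_list: "distinct (inorder (bst_of_list xs))"
  using bst_bst_of_list[of xs] by (simp add: bst_iff_sorted_wrt_less strict_sorted_iff)

subsection \<open>The root split of a random binary search tree\<close>

abbreviation tree_shape :: "'a tree \<Rightarrow> unit tree" where
  "tree_shape \<equiv> map_tree (\<lambda>_. ())"

text \<open>The keys are erased once isomorphism has been reduced to \<open>canon\<close>. Without
  keys, the law of a subtree depends on its size only.\<close>

definition rbst :: "nat \<Rightarrow> unit tree pmf" where
  "rbst n = map_pmf tree_shape (random_bst n)"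

lemma fold_bst_insert_Node:
  "x \<notin> set xs \<Longrightarrow> fold bst_insert xs \<langle>l, x, r\<rangle> =
     \<langle>fold bst_insert (filter (\<lambda>y. y < x) xs) l, x, fold bst_insert (filter (\<lambda>y. \<not> y < x) xs) r\<rangle>"
  by (induction xs arbitrary: l r) auto

lemma bst_of_list_Cons:
  "x \<notin> set xs \<Longrightarrow> bst_of_list (x # xs) =
     \<langle>bst_of_list (filter (\<lambda>y. y < x) xs), x, bst_of_list (filter (\<lambda>y. \<not> y < x) xs)\<rangle>"
  by (simp add: bst_of_list_def fold_bst_insert_Node)

lemma bst_of_list_map_strict_mono:
  assumes "strict_mono f"
  shows "bst_of_list (map f xs) = map_tree f (bst_of_list xs)"
proof -
  have ins: "bst_insert (f x) (map_tree f t) = map_tree f (bst_insert x t)" for x t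
    by (induction t) (auto simp: strict_mono_less[OF assms])
  have "fold bst_insert (map f xs) (map_tree f t) = map_tree f (fold bst_insert xs t)" for t
    by (induction xs arbitrary: t) (auto simp: ins)
  from this[of Leaf] show ?thesis by (simp add: bst_of_list_def)
qed

text \<open>Arbitrary key sets are allowed here because the subtrees of the root are built from the
  keys on either side of the root key.\<close>

definition shape_pmf :: "nat set \<Rightarrow> unit tree pmf" where
  "shape_pmf A = map_pmf (\<lambda>xs. tree_shape (bst_of_list xs)) (pmf_of_set (permutations_of_set A))"

text \<open>Insertion only compares keys, so an order-preserving relabelling commutes with it and
  leaves the shape unchanged.\<close>

lemma shape_pmf_shift:
  assumes "finite A"
  shows "shape_pmf ((\<lambda>x. x + c) ` A) = shape_pmf A"
proof -
  have inj: "inj_on (\<lambda>x. x + c) A" by (auto simp: inj_on_def)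
  have "inj_on (map (\<lambda>x. x + c)) (permutations_of_set A)"
    by (rule inj_on_subset[of _ UNIV]) (auto intro!: inj_onI)
  then have "pmf_of_set (permutations_of_set ((\<lambda>x. x + c) ` A)) =
      map_pmf (map (\<lambda>x. x + c)) (pmf_of_set (permutations_of_set A))"
    using assms by (subst map_pmf_of_set_inj) (auto simp: permutations_of_set_image_inj[OF inj])
  then show ?thesis
    by (simp add: shape_pmf_def pmf.map_comp o_def strict_mono_def bst_of_list_map_strict_mono
        tree.map_comp)
qed

lemma shape_pmf_interval: "shape_pmf {a..<a + n} = rbst n"
proof -
  have "{a..<a + n} = (\<lambda>x. x + a) ` {0..<n}" by (simp add: add.commute)
  moreover have "{1..n} = (\<lambda>x. x + 1) ` {0..<n}" by (simp add: image_Suc_atLeastLessThan atLeastLessThanSuc_atLeastAtMost)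
  ultimately have "shape_pmf {a..<a + n} = shape_pmf {1..n}"
    by (metis finite_atLeastLessThan shape_pmf_shift)
  then show ?thesis by (simp add: shape_pmf_def rbst_def random_bst_def pmf.map_comp o_def)
qed

text \<open>The first key of a uniform permutation is uniform, and splitting the rest at that key
  gives two independent uniform permutations of the smaller and the larger keys.\<close>

lemma shape_pmf_rec:
  assumes "finite A" "A \<noteq> {}"
  shows "shape_pmf A = do {
    x \<leftarrow> pmf_of_set A;
    map_pmf (\<lambda>(l, r). \<langle>l, (), r\<rangle>)
      (pair_pmf (shape_pmf {y \<in> A. y < x}) (shape_pmf {y \<in> A. x < y}))}"
proof -
  have "map_pmf (\<lambda>xs. tree_shape (bst_of_list (x # xs))) (pmf_of_set (permutations_of_set (A - {x}))) =
        map_pmf (\<lambda>(l, r). \<langle>l, (), r\<rangle>)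
          (pair_pmf (shape_pmf {y \<in> A. y < x}) (shape_pmf {y \<in> A. x < y}))" if "x \<in> A" for x
  proof -
    have "map_pmf (\<lambda>xs. tree_shape (bst_of_list (x # xs))) (pmf_of_set (permutations_of_set (A - {x}))) =
      map_pmf (\<lambda>xs. (\<lambda>(l, r). \<langle>l, (), r\<rangle>) (map_prod (tree_shape \<circ> bst_of_list) (tree_shape \<circ> bst_of_list)
        (partition (\<lambda>y. y < x) xs))) (pmf_of_set (permutations_of_set (A - {x})))"
    proof (intro map_pmf_cong refl)
      fix xs assume "xs \<in> set_pmf (pmf_of_set (permutations_of_set (A - {x})))"
      moreover have "set_pmf (pmf_of_set (permutations_of_set (A - {x}))) = permutations_of_set (A - {x})"
        using assms by (intro set_pmf_of_set) auto
      ultimately have "x \<notin> set xs" by (auto simp: permutations_of_set_def)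
      then show "tree_shape (bst_of_list (x # xs)) = (\<lambda>(l, r). \<langle>l, (), r\<rangle>)
          (map_prod (tree_shape \<circ> bst_of_list) (tree_shape \<circ> bst_of_list) (partition (\<lambda>y. y < x) xs))"
        by (simp add: bst_of_list_Cons o_def)
    qed
    also have "\<dots> = map_pmf (\<lambda>(l, r). \<langle>l, (), r\<rangle>) (map_pmf (map_prod (tree_shape \<circ> bst_of_list) (tree_shape \<circ> bst_of_list))
         (map_pmf (partition (\<lambda>y. y < x)) (pmf_of_set (permutations_of_set (A - {x})))))"
      by (simp add: pmf.map_comp o_def)
    also have "\<dots> = map_pmf (\<lambda>(l, r). \<langle>l, (), r\<rangle>) (map_pmf (map_prod (tree_shape \<circ> bst_of_list) (tree_shape \<circ> bst_of_list))
         (pair_pmf (pmf_of_set (permutations_of_set {y \<in> A - {x}. y < x}))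
            (pmf_of_set (permutations_of_set {y \<in> A - {x}. \<not> y < x}))))"
      using assms by (subst partition_random_permutations) auto
    also have "{y \<in> A - {x}. y < x} = {y \<in> A. y < x}" by auto
    also have "{y \<in> A - {x}. \<not> y < x} = {y \<in> A. x < y}" by auto
    finally show ?thesis
      by (simp add: map_prod_def map_pair shape_pmf_def o_def)
  qed
  then have "pmf_of_set A \<bind> (\<lambda>x. map_pmf (\<lambda>xs. tree_shape (bst_of_list (x # xs)))
      (pmf_of_set (permutations_of_set (A - {x})))) = pmf_of_set A \<bind> (\<lambda>x. map_pmf (\<lambda>(l, r). \<langle>l, (), r\<rangle>)
      (pair_pmf (shape_pmf {y \<in> A. y < x}) (shape_pmf {y \<in> A. x < y})))"
    using assms by (intro bind_pmf_cong refl) auto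
  then show ?thesis
    using assms by (simp add: shape_pmf_def random_permutation_of_set map_bind_pmf map_pmf_def
        bind_assoc_pmf bind_return_pmf)
qed

lemma rbst_0: "rbst 0 = return_pmf \<langle>\<rangle>"
  by (simp add: rbst_def random_bst_def bst_of_list_def pmf_of_set_singleton)

lemma rbst_Suc:
  "rbst (Suc n) = do {
     i \<leftarrow> pmf_of_set {..n};
     map_pmf (\<lambda>(l, r). \<langle>l, (), r\<rangle>) (pair_pmf (rbst i) (rbst (n - i)))}"
proof -
  have "rbst (Suc n) = shape_pmf {0..<0 + Suc n}" by (simp only: shape_pmf_interval)
  also have "{0..<0 + Suc n} = {..n}" by auto
  also have "shape_pmf {..n} = do {
     i \<leftarrow> pmf_of_set {..n};
     map_pmf (\<lambda>(l, r). \<langle>l, (), r\<rangle>)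
       (pair_pmf (shape_pmf {y \<in> {..n}. y < i}) (shape_pmf {y \<in> {..n}. i < y}))}"
    by (rule shape_pmf_rec) auto
  also have "\<dots> = do {
     i \<leftarrow> pmf_of_set {..n};
     map_pmf (\<lambda>(l, r). \<langle>l, (), r\<rangle>) (pair_pmf (rbst i) (rbst (n - i)))}"
  proof (intro bind_pmf_cong refl)
    fix i assume "i \<in> set_pmf (pmf_of_set {..n})"
    then have "i \<le> n" by simp
    then have "{y \<in> {..n}. y < i} = {0..<0 + i}" "{y \<in> {..n}. i < y} = {Suc i..<Suc i + (n - i)}" by auto
    then have "shape_pmf {y \<in> {..n}. y < i} = rbst i" "shape_pmf {y \<in> {..n}. i < y} = rbst (n - i)"
      by (simp_all only: shape_pmf_interval)
    then show "map_pmf (\<lambda>(l, r). \<langle>l, (), r\<rangle>)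
       (pair_pmf (shape_pmf {y \<in> {..n}. y < i}) (shape_pmf {y \<in> {..n}. i < y})) =
       map_pmf (\<lambda>(l, r). \<langle>l, (), r\<rangle>) (pair_pmf (rbst i) (rbst (n - i)))" by simp
  qed
  finally show ?thesis .
qed

lemma set_pmf_rbst: "t \<in> set_pmf (rbst n) \<Longrightarrow> size t = n"
proof (induction n arbitrary: t rule: less_induct)
  case (less n)
  show ?case
  proof (cases n)
    case (Suc m)
    with less.prems obtain i l r where i: "i \<le> m" "l \<in> set_pmf (rbst i)" "r \<in> set_pmf (rbst (m - i))"
      and t: "t = \<langle>l, (), r\<rangle>" by (auto simp: rbst_Suc)
    then show ?thesis using less.IH[of i l] less.IH[of "m - i" r] Suc by auto
  qed (use less.prems in \<open>simp add: rbst_0\<close>)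
qed

lemma finite_set_pmf_rbst: "finite (set_pmf (rbst n))"
proof -
  have "set_pmf (pmf_of_set (permutations_of_set {1..n})) = permutations_of_set {1..n}"
    by (intro set_pmf_of_set) auto
  then show ?thesis by (simp add: rbst_def random_bst_def)
qed

abbreviation rexp :: "nat \<Rightarrow> (unit tree \<Rightarrow> real) \<Rightarrow> real" where
  "rexp n \<equiv> measure_pmf.expectation (rbst n)"

lemma integrable_rbst [simp, intro]: "integrable (measure_pmf (rbst n)) (f :: unit tree \<Rightarrow> real)"
  by (intro integrable_measure_pmf_finite finite_set_pmf_rbst)

lemma rexp_mono: "(\<And>t. size t = n \<Longrightarrow> f t \<le> g t) \<Longrightarrow> rexp n f \<le> rexp n g"
  by (intro integral_mono_AE AE_pmfI) (auto dest: set_pmf_rbst)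

lemma rexp_cong: "(\<And>t. size t = n \<Longrightarrow> f t = g t) \<Longrightarrow> rexp n f = rexp n g"
  by (intro integral_cong_AE AE_pmfI) (auto dest: set_pmf_rbst)

lemma rexp_0 [simp]: "rexp 0 f = f \<langle>\<rangle>"
  by (simp add: rbst_0)

text \<open>Independence of the two subtrees in the form of an iterated expectation; all supports
  are finite.\<close>

lemma rexp_pair:
  "measure_pmf.expectation (pair_pmf (rbst i) (rbst j)) (\<lambda>(l, r). f l r) = rexp i (\<lambda>l. rexp j (f l))"
proof -
  have "measure_pmf.expectation (pair_pmf (rbst i) (rbst j)) (\<lambda>(l, r). f l r) =
     (\<Sum>a\<in>set_pmf (rbst i). pmf (rbst i) a *\<^sub>R
        measure_pmf.expectation (rbst j \<bind> (\<lambda>b. return_pmf (a, b))) (\<lambda>(l, r). f l r))"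
    unfolding pair_pmf_def by (intro pmf_expectation_bind) (auto simp: finite_set_pmf_rbst)
  also have "\<dots> = (\<Sum>a\<in>set_pmf (rbst i). pmf (rbst i) a *\<^sub>R rexp j (f a))"
    by (simp add: map_pmf_def[symmetric])
  also have "\<dots> = rexp i (\<lambda>l. rexp j (f l))"
    by (intro integral_measure_pmf[symmetric]) (auto simp: finite_set_pmf_rbst)
  finally show ?thesis .
qed

lemma rexp_Suc:
  "rexp (Suc n) f = (\<Sum>i\<le>n. rexp i (\<lambda>l. rexp (n - i) (\<lambda>r. f \<langle>l, (), r\<rangle>))) / real (Suc n)"
proof -
  have "rexp (Suc n) f = (\<Sum>i\<le>n. measure_pmf.expectation
       (map_pmf (\<lambda>(l, r). \<langle>l, (), r\<rangle>) (pair_pmf (rbst i) (rbst (n - i)))) f /\<^sub>R real (card {..n}))"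
    unfolding rbst_Suc by (intro pmf_expectation_bind_pmf_of_set) (auto simp: finite_set_pmf_rbst)
  also have "\<dots> = (\<Sum>i\<le>n. measure_pmf.expectation
       (pair_pmf (rbst i) (rbst (n - i))) (\<lambda>(l, r). f \<langle>l, (), r\<rangle>) / real (Suc n))"
    by (intro sum.cong) (simp_all add: case_prod_unfold divide_inverse mult.commute)
  also have "\<dots> = (\<Sum>i\<le>n. rexp i (\<lambda>l. rexp (n - i) (\<lambda>r. f \<langle>l, (), r\<rangle>)) / real (Suc n))"
    by (simp only: rexp_pair)
  finally show ?thesis by (simp add: sum_divide_distrib)
qed

lemma expectation_random_bst:
  "measure_pmf.expectation (random_bst n) (\<lambda>t. real (num_distinct_fringe t)) =
   rexp n (\<lambda>t. real (num_shapes t))"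
proof -
  have "measure_pmf.expectation (random_bst n) (\<lambda>t. real (num_distinct_fringe t)) =
        measure_pmf.expectation (random_bst n) (\<lambda>t. real (num_shapes t))"
    by (intro integral_cong_AE AE_pmfI)
      (auto simp: random_bst_def num_distinct_fringe_eq distinct_inorder_bst_of_list)
  then show ?thesis by (simp add: rbst_def)
qed

lemma prob_random_bst:
  "measure_pmf.prob (random_bst n) {t. P (num_distinct_fringe t)} =
   measure_pmf.prob (rbst n) {t. P (num_shapes t)}"
proof -
  have "measure_pmf.prob (random_bst n) {t. P (num_distinct_fringe t)} =
        measure_pmf.prob (random_bst n) {t. P (num_shapes t)}"
    by (intro measure_pmf.finite_measure_eq_AE AE_pmfI)
      (auto simp: random_bst_def num_distinct_fringe_eq distinct_inorder_bst_of_list)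
  then show ?thesis by (simp add: rbst_def vimage_def)
qed

subsection \<open>Additive functionals of fringe subtrees\<close>

text \<open>The partial sums \<open>S n\<close> of \<open>a\<close> satisfy
  \<open>S (n + 1) = b (n + 1) + (n + 3) / (n + 1) * S n\<close>. Dividing by
  \<open>(n + 2) * (n + 3)\<close> makes this a plain summation.\<close>

lemma quicksort_recurrence:
  fixes a b :: "nat \<Rightarrow> real"
  assumes "a 0 = 0" "\<And>n. a (Suc n) = b (Suc n) + 2 / real (Suc n) * (\<Sum>i\<le>n. a i)"
  shows "(\<Sum>i\<le>n. a i) = real (n + 1) * real (n + 2) * (\<Sum>k=1..n. b k / (real (k + 1) * real (k + 2)))"
proof (induction n)
  case (Suc n)
  define S where "S = (\<Sum>k=1..n. b k / (real (k + 1) * real (k + 2)))"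
  have "(\<Sum>i\<le>Suc n. a i) = real (n + 1) * real (n + 2) * S + (b (Suc n) + 2 / real (Suc n) * (real (n + 1) * real (n + 2) * S))"
    using Suc.IH by (simp add: assms(2) S_def)
  also have "2 / real (Suc n) * (real (n + 1) * real (n + 2) * S) = 2 * real (n + 2) * S"
    by simp
  also have "real (n + 1) * real (n + 2) * S + (b (Suc n) + 2 * real (n + 2) * S) =
     real (n + 2) * real (n + 3) * (S + b (Suc n) / (real (n + 2) * real (n + 3)))"
  proof -
    have "real (n + 2) * real (n + 3) * (S + b (Suc n) / (real (n + 2) * real (n + 3))) =
        real (n + 2) * real (n + 3) * S + b (Suc n)"
    proof -
      have "p * (S + c / p) = p * S + c" if "p \<noteq> 0" for p c using that by (simp add: distrib_left)
      then show ?thesis by simp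
    qed
    then show ?thesis by (simp add: algebra_simps)
  qed
  also have "S + b (Suc n) / (real (n + 2) * real (n + 3)) = (\<Sum>k=1..Suc n. b k / (real (k + 1) * real (k + 2)))"
    by (simp add: S_def add.commute)
  finally show ?case by (simp add: add.commute)
qed (use assms(1) in simp)

text \<open>Beyond \<open>K\<close> the summands are \<open>\<tau> / ((k + 1) * (k + 2))\<close> and
  telescope, so the solution is exactly affine in \<open>n\<close>, without an error term.\<close>

lemma quicksort_recurrence_const_toll:
  fixes a b :: "nat \<Rightarrow> real"
  assumes "a 0 = 0" "\<And>n. a (Suc n) = b (Suc n) + 2 / real (Suc n) * (\<Sum>i\<le>n. a i)"
    and const: "\<And>k. k > K \<Longrightarrow> b k = \<tau>" and "n > K"
  shows "a n = (2 * (\<Sum>k=1..K. b k / (real (k + 1) * real (k + 2))) + 2 * \<tau> / real (K + 2)) * real (n + 1) - \<tau>"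
proof -
  obtain m where m: "n = Suc m" "m \<ge> K" using \<open>n > K\<close> by (cases n) auto
  define S where "S = (\<lambda>m. \<Sum>k=1..m. b k / (real (k + 1) * real (k + 2)))"
  have S: "S m = S K + \<tau> / real (K + 2) - \<tau> / real (m + 2)"
    using m(2)
  proof (induction m rule: dec_induct)
    case (step m)
    have "S (Suc m) = S m + \<tau> / (real (m + 2) * real (m + 3))"
      using step.hyps const[of "Suc m"] by (simp add: S_def add.commute)
    also have "\<tau> / (real (m + 2) * real (m + 3)) = \<tau> / real (m + 2) - \<tau> / real (m + 3)"
      by (simp add: field_simps)
    finally show ?case using step.IH by (simp add: add.commute)
  qed simp
  have "a n = \<tau> + 2 / real (Suc m) * (\<Sum>i\<le>m. a i)"
    using m assms(2)[of m] const[of n] by simp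
  also have "(\<Sum>i\<le>m. a i) = real (m + 1) * real (m + 2) * S m"
    using quicksort_recurrence[of a b m] assms(1,2) by (simp add: S_def)
  also have "\<tau> + 2 / real (Suc m) * (real (m + 1) * real (m + 2) * S m) = \<tau> + 2 * real (m + 2) * S m"
    by simp
  also have "\<dots> = (2 * S K + 2 * \<tau> / real (K + 2)) * real (n + 1) - \<tau>"
  proof -
    define Q where "Q = \<tau> / real (K + 2)"
    have "real (m + 2) * (\<tau> / real (m + 2)) = \<tau>" by simp
    then have "\<tau> + 2 * real (m + 2) * (S K + Q - \<tau> / real (m + 2)) = (2 * S K + 2 * Q) * real (m + 2) - \<tau>"
      by (simp only: ring_distribs mult.assoc) simp
    then show ?thesis unfolding S by (simp add: m Q_def)
  qed
  finally show ?thesis by (simp add: S_def)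
qed

fun fringe_sum :: "('a tree \<Rightarrow> real) \<Rightarrow> 'a tree \<Rightarrow> real" where
  "fringe_sum g \<langle>\<rangle> = 0"
| "fringe_sum g \<langle>l, x, r\<rangle> = fringe_sum g l + fringe_sum g r + g \<langle>l, x, r\<rangle>"

lemma fringe_sum_mono:
  "(\<And>s. size s \<le> size t \<Longrightarrow> s \<noteq> \<langle>\<rangle> \<Longrightarrow> g s \<le> h s) \<Longrightarrow> fringe_sum g t \<le> fringe_sum h t"
  by (induction t) (auto intro!: add_mono)

lemma fringe_sum_cong:
  "(\<And>s. size s \<le> size t \<Longrightarrow> s \<noteq> \<langle>\<rangle> \<Longrightarrow> g s = h s) \<Longrightarrow> fringe_sum g t = fringe_sum h t"
  by (intro antisym fringe_sum_mono) auto

lemma fringe_sum_zero [simp]: "fringe_sum (\<lambda>_. 0) t = 0"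
  by (induction t) auto

lemma fringe_sum_nonneg: "(\<And>s. g s \<ge> 0) \<Longrightarrow> fringe_sum g t \<ge> 0"
  by (induction t) auto

lemma fringe_sum_add: "fringe_sum (\<lambda>s. g s + h s) t = fringe_sum g t + fringe_sum h t"
  by (induction t) auto

lemma fringe_sum_cmult: "fringe_sum (\<lambda>s. c * g s) t = c * fringe_sum g t"
  by (induction t) (auto simp: algebra_simps)

lemma fringe_sum_sum: "finite A \<Longrightarrow> fringe_sum (\<lambda>s. \<Sum>i\<in>A. g i s) t = (\<Sum>i\<in>A. fringe_sum (g i) t)"
  by (induction A rule: finite_induct) (auto simp: fringe_sum_add)

lemma fringe_sum_of_bool_Nats: "fringe_sum (\<lambda>s. of_bool (P s)) t \<in> \<nat>"
  by (induction t) auto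

lemma sum_flip_atMost: "(\<Sum>i\<le>n. f (n - i)) = (\<Sum>i\<le>(n::nat). f i :: real)"
  using sum.nat_diff_reindex[of f "Suc n"] by (simp add: lessThan_Suc_atMost)

text \<open>Linearity at the root split; reversing the order of summation identifies the
  contribution of the right subtree with that of the left one.\<close>

lemma rexp_fringe_sum:
  "rexp (Suc n) (fringe_sum g) = rexp (Suc n) g + 2 / real (Suc n) * (\<Sum>i\<le>n. rexp i (fringe_sum g))"
proof -
  have "rexp (Suc n) (fringe_sum g) = 
    (\<Sum>i\<le>n. rexp i (\<lambda>l. rexp (n - i) (\<lambda>r. g \<langle>l, (), r\<rangle>)) + rexp i (fringe_sum g) + rexp (n - i) (fringe_sum g)) / real (Suc n)"
    unfolding rexp_Suc by (intro arg_cong2[where f = "(/)"] sum.cong refl) simp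
  also have "\<dots> = rexp (Suc n) g + ((\<Sum>i\<le>n. rexp i (fringe_sum g)) + (\<Sum>i\<le>n. rexp (n - i) (fringe_sum g))) / real (Suc n)"
    unfolding rexp_Suc by (simp add: sum.distrib add_divide_distrib)
  also have "(\<Sum>i\<le>n. rexp (n - i) (fringe_sum g)) = (\<Sum>i\<le>n. rexp i (fringe_sum g))"
    by (rule sum_flip_atMost)
  finally show ?thesis by simp
qed

text \<open>Only the expected tolls enter the recurrence, so comparing them size by size suffices;
  no pointwise comparison of \<open>g\<close> and \<open>h\<close> is required.\<close>

lemma rexp_fringe_sum_mono:
  assumes "\<And>k. rexp k g \<le> rexp k h"
  shows "rexp n (fringe_sum g) \<le> rexp n (fringe_sum h)"
proof (induction n rule: less_induct)
  case (less n)
  show ?case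
  proof (cases n)
    case (Suc m)
    then have "(\<Sum>i\<le>m. rexp i (fringe_sum g)) \<le> (\<Sum>i\<le>m. rexp i (fringe_sum h))"
      by (intro sum_mono less.IH) auto
    then show ?thesis unfolding Suc rexp_fringe_sum
      by (intro add_mono assms mult_left_mono) auto
  qed simp
qed

text \<open>The decomposition of variance given the sizes of the subtrees of the root. These
  subtrees are independent, and the toll at the root is constant, so all cross terms have mean
  zero.\<close>

lemma rexp_square_fringe_sum:
  fixes g :: "unit tree \<Rightarrow> real"
  assumes const: "\<And>t. size t = Suc n \<Longrightarrow> g t = \<tau>"
  defines "a \<equiv> \<lambda>n. rexp n (fringe_sum g)" and "V \<equiv> \<lambda>n. rexp n (\<lambda>t. (fringe_sum g t - rexp n (fringe_sum g))\<^sup>2)"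
  shows "V (Suc n) = 2 / real (Suc n) * (\<Sum>i\<le>n. V i) + (\<Sum>i\<le>n. (a i + a (n - i) + \<tau> - a (Suc n))\<^sup>2) / real (Suc n)"
proof -
  have *: "rexp i (\<lambda>l. rexp (n - i) (\<lambda>r. (fringe_sum g \<langle>l, (), r\<rangle> - a (Suc n))\<^sup>2)) =
     V i + V (n - i) + (a i + a (n - i) + \<tau> - a (Suc n))\<^sup>2" if "i \<le> n" for i
  proof -
    define d where "d = a i + a (n - i) + \<tau> - a (Suc n)"
    have z: "rexp j (\<lambda>t. fringe_sum g t - a j) = 0" for j by (simp add: a_def)
    have "rexp i (\<lambda>l. rexp (n - i) (\<lambda>r. (fringe_sum g \<langle>l, (), r\<rangle> - a (Suc n))\<^sup>2)) =
      rexp i (\<lambda>l. rexp (n - i) (\<lambda>r. (fringe_sum g l - a i)\<^sup>2 + (fringe_sum g r - a (n - i))\<^sup>2 + d\<^sup>2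
         + 2 * (fringe_sum g l - a i) * (fringe_sum g r - a (n - i))
         + 2 * d * (fringe_sum g l - a i) + 2 * d * (fringe_sum g r - a (n - i))))"
    proof (intro rexp_cong)
      fix l r :: "unit tree" assume lr: "size l = i" "size r = n - i"
      then have "g \<langle>l, (), r\<rangle> = \<tau>" using that by (intro const) simp
      then have "fringe_sum g \<langle>l, (), r\<rangle> - a (Suc n) = (fringe_sum g l - a i) + (fringe_sum g r - a (n - i)) + d"
        by (simp add: d_def)
      then show "(fringe_sum g \<langle>l, (), r\<rangle> - a (Suc n))\<^sup>2 = (fringe_sum g l - a i)\<^sup>2 + (fringe_sum g r - a (n - i))\<^sup>2 + d\<^sup>2
         + 2 * (fringe_sum g l - a i) * (fringe_sum g r - a (n - i))
         + 2 * d * (fringe_sum g l - a i) + 2 * d * (fringe_sum g r - a (n - i))"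
        by (simp only: power2_eq_square) (simp add: algebra_simps)
    qed
    also have "\<dots> = rexp i (\<lambda>l. (fringe_sum g l - a i)\<^sup>2 + V (n - i) + d\<^sup>2 + 2 * d * (fringe_sum g l - a i))"
      using z by (simp add: V_def a_def)
    also have "\<dots> = V i + V (n - i) + d\<^sup>2"
      using z by (simp add: V_def a_def)
    finally show ?thesis by (simp add: d_def)
  qed
  have "V (Suc n) = (\<Sum>i\<le>n. rexp i (\<lambda>l. rexp (n - i) (\<lambda>r. (fringe_sum g \<langle>l, (), r\<rangle> - a (Suc n))\<^sup>2))) / real (Suc n)"
    by (simp only: V_def a_def rexp_Suc[of n "\<lambda>t. (fringe_sum g t - rexp (Suc n) (fringe_sum g))\<^sup>2"])
  also have "\<dots> = (\<Sum>i\<le>n. V i + V (n - i) + (a i + a (n - i) + \<tau> - a (Suc n))\<^sup>2) / real (Suc n)"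
    using * by simp
  also have "\<dots> = ((\<Sum>i\<le>n. V i) + (\<Sum>i\<le>n. V (n - i)) + (\<Sum>i\<le>n. (a i + a (n - i) + \<tau> - a (Suc n))\<^sup>2)) / real (Suc n)"
    by (simp add: sum.distrib)
  also have "(\<Sum>i\<le>n. V (n - i)) = (\<Sum>i\<le>n. V i)" by (rule sum_flip_atMost)
  finally show ?thesis by (simp add: add_divide_distrib)
qed

text \<open>The mean is exactly \<open>\<alpha> (n + 1) - \<tau>\<close> beyond \<open>K\<close>, so the conditional mean given the sizes of
  the two subtrees of the root differs from the mean by at most \<open>2 M\<close>.\<close>

lemma rexp_variance_bound:
  fixes g :: "unit tree \<Rightarrow> real"
  assumes const: "\<And>t. size t > K \<Longrightarrow> g t = \<tau>"
    and mean: "\<And>n. n > K \<Longrightarrow> rexp n (fringe_sum g) = \<alpha> * real (n + 1) - \<tau>"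
    and M: "\<And>n. n \<le> K \<Longrightarrow> \<bar>rexp n (fringe_sum g) - (\<alpha> * real (n + 1) - \<tau>)\<bar> \<le> M"
    and C: "\<And>n. n \<le> K \<Longrightarrow> rexp n (\<lambda>t. (fringe_sum g t - rexp n (fringe_sum g))\<^sup>2) \<le> C"
  shows "rexp n (\<lambda>t. (fringe_sum g t - rexp n (fringe_sum g))\<^sup>2) \<le> (C + 4 * M\<^sup>2) * real (n + 1)"
proof -
  define a where "a = (\<lambda>n. rexp n (fringe_sum g))"
  define V where "V = (\<lambda>n. rexp n (\<lambda>t. (fringe_sum g t - rexp n (fringe_sum g))\<^sup>2))"
  have "M \<ge> 0" using M[of 0] by linarith
  have "C \<ge> 0" using C[of 0] by simp
  have M': "\<bar>a n - (\<alpha> * real (n + 1) - \<tau>)\<bar> \<le> M" for n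
    using M[of n] mean[of n] \<open>M \<ge> 0\<close> by (cases "n \<le> K") (auto simp: a_def)
  define D where "D = C + 4 * M\<^sup>2"
  \<comment> \<open>The subtracted \<open>4 * M^2\<close> strengthens the induction hypothesis:
    averaging doubles it to \<open>8 * M^2\<close>, and the variance of the conditional mean uses up
    one half of that.\<close>
  have "V n \<le> D * real (n + 1) - 4 * M\<^sup>2"
  proof (induction n rule: less_induct)
    case (less n)
    show ?case
    proof (cases "n \<le> K")
      case True
      have "V n \<le> C" using C[OF True] by (simp add: V_def)
      also have "C = D * 1 - 4 * M\<^sup>2" by (simp add: D_def)
      also have "\<dots> \<le> D * real (n + 1) - 4 * M\<^sup>2"
        using \<open>C \<ge> 0\<close> by (intro diff_right_mono mult_left_mono) (auto simp: D_def)
      finally show ?thesis .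
    next
      case False
      then obtain m where m: "n = Suc m" "m \<ge> K" by (cases n) auto
      have sq: "(a i + a (m - i) + \<tau> - a (Suc m))\<^sup>2 \<le> 4 * M\<^sup>2" if "i \<le> m" for i
      proof -
        have "real (i + 1) + real (m - i + 1) = real (Suc m + 1)" using that by simp
        then have e: "\<alpha> * real (i + 1) + \<alpha> * real (m - i + 1) = \<alpha> * real (Suc m + 1)"
          by (metis distrib_left)
        have "a (Suc m) = \<alpha> * real (Suc m + 1) - \<tau>" using mean[of "Suc m"] m by (simp add: a_def)
        then have "\<bar>a i + a (m - i) + \<tau> - a (Suc m)\<bar> \<le> 2 * M"
          using M'[of i] M'[of "m - i"] e by linarith
        then have "(a i + a (m - i) + \<tau> - a (Suc m))\<^sup>2 \<le> (2 * M)\<^sup>2"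
          using abs_le_square_iff[of "a i + a (m - i) + \<tau> - a (Suc m)" "2 * M"] \<open>M \<ge> 0\<close> by simp
        then show ?thesis by (simp add: power_mult_distrib)
      qed
      have "V n = 2 / real (Suc m) * (\<Sum>i\<le>m. V i) + (\<Sum>i\<le>m. (a i + a (m - i) + \<tau> - a (Suc m))\<^sup>2) / real (Suc m)"
        unfolding V_def a_def m using m(2) by (intro rexp_square_fringe_sum const) auto
      also have "\<dots> \<le> 2 / real (Suc m) * (\<Sum>i\<le>m. D * real (i + 1) - 4 * M\<^sup>2) + (\<Sum>i\<le>m. 4 * M\<^sup>2) / real (Suc m)"
        using m sq by (intro add_mono mult_left_mono divide_right_mono sum_mono less.IH) auto
      also have "(\<Sum>i\<le>m. D * real (i + 1) - 4 * M\<^sup>2) = D * (real (Suc m) * real (m + 2) / 2) - real (Suc m) * 4 * M\<^sup>2"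
      proof -
        have "(\<Sum>i\<le>m. real (i + 1)) = real (Suc m) * real (m + 2) / 2"
          by (induction m) (auto simp: field_simps)
        moreover have "(\<Sum>i\<le>m. D * real (i + 1) - 4 * M\<^sup>2) = D * (\<Sum>i\<le>m. real (i + 1)) - (\<Sum>i\<le>m. 4 * M\<^sup>2)"
          by (simp only: sum_subtractf sum_distrib_left)
        moreover have "(\<Sum>i\<le>m. 4 * M\<^sup>2) = real (Suc m) * 4 * M\<^sup>2" by simp
        ultimately show ?thesis by (simp only:)
      qed
      also have "2 / real (Suc m) * (D * (real (Suc m) * real (m + 2) / 2) - real (Suc m) * 4 * M\<^sup>2) + (\<Sum>i\<le>m. 4 * M\<^sup>2) / real (Suc m)
         = D * real (n + 1) - 4 * M\<^sup>2"
      proof -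
        have "2 / s * (D * (s * P / 2) - s * 4 * X) + s * (4 * X) / s = D * P - 4 * X"
          if "s \<noteq> 0" for s P X using that by (simp add: field_simps)
        from this[of "real (Suc m)" "real (m + 2)" "M\<^sup>2"] show ?thesis by (simp add: m)
      qed
      finally show ?thesis .
    qed
  qed
  also have "\<dots> \<le> D * real (n + 1)" by simp
  finally show ?thesis by (simp add: V_def D_def)
qed

section \<open>The number of large fringe subtrees\<close>

definition large_count :: "nat \<Rightarrow> 'a tree \<Rightarrow> real" where
  "large_count k = fringe_sum (\<lambda>s. of_bool (size s > k))"

text \<open>The toll vanishes up to \<open>k\<close> and is 1 afterwards, so the sum in the affine
  solution is zero.\<close>

lemma rexp_large_count:
  "rexp n (large_count k) = (if n > k then 2 * real (n + 1) / real (k + 2) - 1 else 0)"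
proof (cases "n > k")
  case True
  define b :: "nat \<Rightarrow> real" where "b = (\<lambda>n. of_bool (n > k))"
  have b: "rexp n (\<lambda>s. of_bool (size s > k)) = b n" for n
    using rexp_cong[of n "\<lambda>s. of_bool (size s > k)" "\<lambda>_. b n"] by (simp add: b_def)
  have "rexp n (large_count k) = (2 * (\<Sum>i=1..k. b i / (real (i + 1) * real (i + 2))) + 2 * 1 / real (k + 2)) * real (n + 1) - 1"
    unfolding large_count_def
    by (rule quicksort_recurrence_const_toll[where a = "\<lambda>n. rexp n (fringe_sum (\<lambda>s. of_bool (size s > k)))", OF _ _ _ True])
      (simp_all only: rexp_fringe_sum b, auto simp: b_def)
  also have "(\<Sum>i=1..k. b i / (real (i + 1) * real (i + 2))) = 0"
    by (intro sum.neutral) (auto simp: b_def)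
  finally show ?thesis using True by (simp add: field_simps)
next
  case False
  have "rexp n (large_count k) = rexp n (\<lambda>_. 0)"
  proof (rule rexp_cong)
    fix t :: "unit tree" assume "size t = n"
    then show "large_count k t = 0"
      unfolding large_count_def using False fringe_sum_cong[of t "\<lambda>s. of_bool (size s > k)" "\<lambda>_. 0"] by simp
  qed
  then show ?thesis using False by simp
qed

text \<open>The bound is uniform in \<open>k\<close>, which matters because \<open>k\<close> will
  grow with \<open>n\<close>. For \<open>n \<le> k\<close> the count is zero and the affine formula
  lies between -1 and 1, so \<open>C = 0\<close> and \<open>M = 1\<close> are admissible.\<close>

lemma rexp_large_count_variance:
  "rexp n (\<lambda>t. (large_count k t - rexp n (large_count k))\<^sup>2) \<le> 4 * real (n + 1)"
proof -
  have "rexp n (\<lambda>t. (large_count k t - rexp n (large_count k))\<^sup>2) \<le> (0 + 4 * 1\<^sup>2) * real (n + 1)"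
    unfolding large_count_def
  proof (rule rexp_variance_bound[where K = k and \<alpha> = "2 / real (k + 2)" and \<tau> = 1])
    fix n assume n: "n \<le> k"
    have z: "fringe_sum (\<lambda>s. of_bool (k < size s)) t = 0" if "size t = n" for t :: "unit tree"
      using that n fringe_sum_cong[of t "\<lambda>s. of_bool (size s > k)" "\<lambda>_. 0"] by simp
    show "rexp n (\<lambda>t. (fringe_sum (\<lambda>s. of_bool (k < size s)) t - rexp n (fringe_sum (\<lambda>s. of_bool (k < size s))))\<^sup>2) \<le> 0"
      using rexp_cong[of n "fringe_sum (\<lambda>s. of_bool (k < size s))" "\<lambda>_. 0"]
        rexp_cong[of n "\<lambda>t. (fringe_sum (\<lambda>s. of_bool (k < size s)) t - rexp n (fringe_sum (\<lambda>s. of_bool (k < size s))))\<^sup>2" "\<lambda>_. 0"] z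
      by simp
    show "\<bar>rexp n (fringe_sum (\<lambda>s. of_bool (k < size s))) - (2 / real (k + 2) * real (n + 1) - 1)\<bar> \<le> 1"
      using n rexp_large_count[of n k] by (simp add: large_count_def field_simps)
  qed (use rexp_large_count[of _ k] in \<open>auto simp: large_count_def\<close>)
  then show ?thesis by simp
qed

section \<open>Probability and number of occurrences of a shape\<close>

text \<open>The probability that a random tree of the same size has the same shape, as
  \<open>rexp_canon_eq\<close> shows. The denominator counts the possible root splits; the factor 2
  accounts for the two orders in which different shapes can be attached.\<close>

fun shape_prob :: "'a tree \<Rightarrow> real" where
  "shape_prob \<langle>\<rangle> = 1"
| "shape_prob \<langle>l, x, r\<rangle> =
     (if canon l = canon r then 1 else 2) / real (size l + size r + 1) * shape_prob l * shape_prob r"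

lemma shape_prob_pos: "shape_prob t > 0"
  by (induction t) auto

lemma rexp_canon_eq_size: "rexp n (\<lambda>s. of_bool (canon s = canon t)) = 
    (if n = size t then rexp (size t) (\<lambda>s. of_bool (canon s = canon t)) else 0)"
proof (cases "n = size t")
  case False
  then have "rexp n (\<lambda>s. of_bool (canon s = canon t)) = rexp n (\<lambda>_. 0)"
    by (intro rexp_cong) (auto dest: canon_eq_imp_size_eq)
  then show ?thesis using False by simp
qed simp

text \<open>If the shapes of the two subtrees differ, the straight and the crossed matching are
  disjoint events of equal probability; otherwise they coincide. Each forces the size of the left
  subtree.\<close>

lemma rexp_canon_eq: "rexp (size t) (\<lambda>s. of_bool (canon s = canon t)) = shape_prob t"
proof (induction t)
  case (Node l x r)
  define n where "n = size l + size r"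
  have size: "size \<langle>l, x, r\<rangle> = Suc n" by (simp add: n_def)
  have pair: "(\<Sum>i\<le>n. rexp i (\<lambda>l'. rexp (n - i) (\<lambda>r'. of_bool (canon l' = canon u \<and> canon r' = canon v)))) =
      shape_prob u * shape_prob v"
    if "(u = l \<and> v = r) \<or> (u = r \<and> v = l)" for u v
  proof -
    have uv: "rexp (size u) (\<lambda>s. of_bool (canon s = canon u)) = shape_prob u"
      "rexp (size v) (\<lambda>s. of_bool (canon s = canon v)) = shape_prob v" "size u \<le> n" "n - size u = size v"
      using that Node.IH by (auto simp: n_def)
    have "(\<Sum>i\<le>n. rexp i (\<lambda>l'. rexp (n - i) (\<lambda>r'. of_bool (canon l' = canon u \<and> canon r' = canon v)))) =
       (\<Sum>i\<le>n. rexp i (\<lambda>l'. of_bool (canon l' = canon u)) * rexp (n - i) (\<lambda>r'. of_bool (canon r' = canon v)))"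
      by (simp add: of_bool_conj)
    also have "\<dots> = (\<Sum>i\<le>n. if i = size u then shape_prob u * shape_prob v else 0)"
      using uv by (intro sum.cong refl, subst (1) rexp_canon_eq_size) auto
    finally show ?thesis using uv(3) by simp
  qed
  have "rexp (size \<langle>l, x, r\<rangle>) (\<lambda>s. of_bool (canon s = canon \<langle>l, x, r\<rangle>)) =
     (\<Sum>i\<le>n. rexp i (\<lambda>l'. rexp (n - i) (\<lambda>r'. of_bool (canon \<langle>l', (), r'\<rangle> = canon \<langle>l, x, r\<rangle>)))) / real (Suc n)"
    unfolding size by (rule rexp_Suc)
  also have "(\<Sum>i\<le>n. rexp i (\<lambda>l'. rexp (n - i) (\<lambda>r'. of_bool (canon \<langle>l', (), r'\<rangle> = canon \<langle>l, x, r\<rangle>)))) =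
     (if canon l = canon r then 1 else 2) * (shape_prob l * shape_prob r)"
  proof (cases "canon l = canon r")
    case True
    then show ?thesis using pair[of l r] by simp
  next
    case False
    have "of_bool (canon \<langle>l', (), r'\<rangle> = canon \<langle>l, x, r\<rangle>) =
       (of_bool (canon l' = canon l \<and> canon r' = canon r) + of_bool (canon l' = canon r \<and> canon r' = canon l) :: real)" for l' r' :: "unit tree"
      using False by auto
    then have "(\<Sum>i\<le>n. rexp i (\<lambda>l'. rexp (n - i) (\<lambda>r'. of_bool (canon \<langle>l', (), r'\<rangle> = canon \<langle>l, x, r\<rangle>)))) =
       (\<Sum>i\<le>n. rexp i (\<lambda>l'. rexp (n - i) (\<lambda>r'. of_bool (canon l' = canon l \<and> canon r' = canon r)))) +
       (\<Sum>i\<le>n. rexp i (\<lambda>l'. rexp (n - i) (\<lambda>r'. of_bool (canon l' = canon r \<and> canon r' = canon l))))"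
      by (simp add: sum.distrib del: canon.simps)
    then show ?thesis using pair[of l r] pair[of r l] False by simp
  qed
  finally show ?case by (simp add: n_def)
qed simp

definition shape_count :: "utree \<Rightarrow> 'a tree \<Rightarrow> real" where
  "shape_count \<tau> = fringe_sum (\<lambda>s. of_bool (canon s = \<tau>))"

lemma shape_count_small: "size s < size t \<Longrightarrow> shape_count (canon t) s = 0"
  unfolding shape_count_def
  using fringe_sum_cong[of s "\<lambda>s. of_bool (canon s = canon t)" "\<lambda>_. 0"]
  by (force dest: canon_eq_imp_size_eq)

text \<open>Only trees of the size of \<open>t\<close> can contribute at the root. For all other
  sizes the recurrence has no toll and maps the linear bound \<open>p * i\<close> to
  \<open>p * (n - 1)\<close>.\<close>

lemma rexp_shape_count_le:
  fixes t :: "'b tree"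
  shows "rexp n (shape_count (canon t)) \<le> shape_prob t * real n"
proof (induction n rule: less_induct)
  case (less n)
  show ?case
  proof (cases n)
    case (Suc m)
    have eq: "rexp n (shape_count (canon t)) = rexp n (\<lambda>s. of_bool (canon s = canon t)) + 
        2 / real (Suc m) * (\<Sum>i\<le>m. rexp i (shape_count (canon t)))"
      unfolding shape_count_def Suc by (rule rexp_fringe_sum)
    show ?thesis
    proof (cases "n = size t")
      case True
      have "rexp i (shape_count (canon t)) = rexp i (\<lambda>_. 0)" if "i \<le> m" for i
        using that Suc True by (intro rexp_cong shape_count_small) auto
      then have "rexp n (shape_count (canon t)) = shape_prob t"
        using eq rexp_canon_eq[of t] True by simp
      also have "\<dots> \<le> shape_prob t * real n" using shape_prob_pos[of t] Suc by simp
      finally show ?thesis .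
    next
      case False
      then have "rexp n (shape_count (canon t)) = 2 / real (Suc m) * (\<Sum>i\<le>m. rexp i (shape_count (canon t)))"
        using eq rexp_canon_eq_size[of n t] by simp
      also have "\<dots> \<le> 2 / real (Suc m) * (\<Sum>i\<le>m. shape_prob t * real i)"
        using Suc by (intro mult_left_mono sum_mono less.IH) auto
      also have "(\<Sum>i\<le>m. shape_prob t * real i) = shape_prob t * (real m * real (Suc m) / 2)"
      proof -
        have "(\<Sum>i\<le>m. real i) = real m * real (Suc m) / 2" by (induction m) (auto simp: field_simps)
        then show ?thesis by (simp add: sum_distrib_left[symmetric])
      qed
      also have "2 / real (Suc m) * (shape_prob t * (real m * real (Suc m) / 2)) = shape_prob t * real m" by simp
      also have "\<dots> \<le> shape_prob t * real n" using shape_prob_pos[of t] Suc by simp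
      finally show ?thesis .
    qed
  qed (simp add: shape_count_def)
qed

lemma rexp_shape_count_nonneg: "rexp n (shape_count \<tau>) \<ge> 0"
  unfolding shape_count_def by (intro integral_nonneg_AE AE_pmfI fringe_sum_nonneg) auto

text \<open>The expression counts ordered pairs of different occurrences. Below the root such a pair
  lies in one subtree or is spread over both, where independence gives a product of means; the three
  bounds add up to the square of \<open>i + (m - i)\<close>.\<close>

lemma rexp_shape_count_pairs_le:
  fixes t :: "'b tree"
  shows "rexp n (\<lambda>s. (shape_count (canon t) s)\<^sup>2 - shape_count (canon t) s) \<le> (shape_prob t)\<^sup>2 * (real n)\<^sup>2"
    (is "rexp n ?Z \<le> _")
proof (induction n rule: less_induct)
  case (less n)
  let ?N = "shape_count (canon t)"
  let ?p = "shape_prob t"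
  have Nodeeq: "?N \<langle>l, x, r\<rangle> = ?N l + ?N r + of_bool (canon \<langle>l, x, r\<rangle> = canon t)" for l r and x :: unit
    unfolding shape_count_def by (simp del: canon.simps)
  show ?case
  proof (cases n)
    case (Suc m)
    show ?thesis
    proof (cases "n = size t")
      case True
      have "?Z s = 0" if s: "size s = n" for s :: "unit tree"
      proof -
        obtain l x r where lxr: "s = \<langle>l, x, r\<rangle>" using s Suc by (cases s) auto
        then have "?N l = 0" "?N r = 0" using shape_count_small[of l t] shape_count_small[of r t] True s by auto
        then show ?thesis using lxr Nodeeq by simp
      qed
      then have "rexp n ?Z = 0" using rexp_cong[of n ?Z "\<lambda>_. 0"] by simp
      then show ?thesis by simp
    next
      case False
      have Z: "?Z \<langle>l, (), r\<rangle> = ?Z l + ?Z r + 2 * ?N l * ?N r" if "size l + size r = m" for l r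
      proof -
        have "canon \<langle>l, (), r\<rangle> \<noteq> canon t" using canon_eq_imp_size_eq[of "\<langle>l, (), r\<rangle>" t] that False Suc by auto
        then have "?N \<langle>l, (), r\<rangle> = ?N l + ?N r" using Nodeeq by simp
        then show ?thesis by (simp add: power2_eq_square algebra_simps)
      qed
      have "rexp n ?Z = (\<Sum>i\<le>m. rexp i (\<lambda>l. rexp (m - i) (\<lambda>r. ?Z \<langle>l, (), r\<rangle>))) / real (Suc m)"
        unfolding Suc by (rule rexp_Suc)
      also have "\<dots> = (\<Sum>i\<le>m. rexp i (\<lambda>l. rexp (m - i) (\<lambda>r. ?Z l + ?Z r + 2 * ?N l * ?N r))) / real (Suc m)"
        using Z by (intro arg_cong2[where f = "(/)"] sum.cong rexp_cong refl) auto
      also have "\<dots> = (\<Sum>i\<le>m. rexp i ?Z + rexp (m - i) ?Z + 2 * rexp i ?N * rexp (m - i) ?N) / real (Suc m)"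
        by simp
      also have "\<dots> \<le> (\<Sum>i\<le>m. ?p\<^sup>2 * (real m)\<^sup>2) / real (Suc m)"
      proof (intro divide_right_mono sum_mono)
        fix i assume "i \<in> {..m}"
        then have i: "i \<le> m" by simp
        have "rexp i ?N * rexp (m - i) ?N \<le> (?p * real i) * (?p * real (m - i))"
          using shape_prob_pos[of t] rexp_shape_count_le[of _ t]
          by (intro mult_mono rexp_shape_count_nonneg rexp_shape_count_le) auto
        moreover have "rexp i ?Z \<le> ?p\<^sup>2 * (real i)\<^sup>2" "rexp (m - i) ?Z \<le> ?p\<^sup>2 * (real (m - i))\<^sup>2"
          using less.IH[of i] less.IH[of "m - i"] i Suc by simp_all
        ultimately have "rexp i ?Z + rexp (m - i) ?Z + 2 * rexp i ?N * rexp (m - i) ?N \<le>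
          ?p\<^sup>2 * (real i)\<^sup>2 + ?p\<^sup>2 * (real (m - i))\<^sup>2 + 2 * ((?p * real i) * (?p * real (m - i)))"
          by linarith
        also have "\<dots> = ?p\<^sup>2 * (real i + real (m - i))\<^sup>2" by (simp add: power2_eq_square algebra_simps)
        also have "real i + real (m - i) = real m" using i by simp
        finally show "rexp i ?Z + rexp (m - i) ?Z + 2 * rexp i ?N * rexp (m - i) ?N \<le> ?p\<^sup>2 * (real m)\<^sup>2" .
      qed simp
      also have "\<dots> = ?p\<^sup>2 * (real m)\<^sup>2" by simp
      also have "\<dots> \<le> ?p\<^sup>2 * (real n)\<^sup>2" using Suc by (intro mult_left_mono power_mono) auto
      finally show ?thesis .
    qed
  qed (simp add: shape_count_def)
qed

subsection \<open>Entropy of the shape\<close>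

fun symmetric_root :: "'a tree \<Rightarrow> bool" where
  "symmetric_root \<langle>\<rangle> = False"
| "symmetric_root \<langle>l, x, r\<rangle> \<longleftrightarrow> canon l = canon r"

definition sym_prob :: "nat \<Rightarrow> real" where
  "sym_prob n = rexp n (\<lambda>t. of_bool (symmetric_root t))"

text \<open>For small trees this is the contribution of the root to
  \<open>- ln (shape_prob t)\<close>. For sizes above \<open>K\<close> it is replaced by a lower
  bound that no longer depends on the tree, as the variance estimate requires.\<close>

definition entropy_toll :: "nat \<Rightarrow> 'a tree \<Rightarrow> real" where
  "entropy_toll K t =
     (if size t \<le> K then ln (real (size t)) - ln 2 * (1 - of_bool (symmetric_root t))
      else ln (real (K + 1)) - ln 2)"

text \<open>The slope of the mean of the truncated entropy, after summation by parts has turned the weighted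
  sum of the \<open>ln k\<close> into a series in \<open>ln (1 + 1 / m)\<close>. It increases to \<open>0.77350129613...\<close>, half the
  optimal lower constant.\<close>

definition entropy_rate :: "nat \<Rightarrow> real" where
  "entropy_rate K = 2 * (\<Sum>m=1..K. ln (1 + 1 / real m) / real (m + 2)) -
     ln 2 * (1 - (\<Sum>k=1..K. 2 * sym_prob k / (real (k + 1) * real (k + 2))))"

text \<open>The logarithm turns the product over the vertices into a sum over the fringe subtrees,
  and the toll is at most the true contribution of each.\<close>

lemma fringe_sum_entropy_toll_le: "fringe_sum (entropy_toll K) t \<le> - ln (shape_prob t)"
proof (induction t)
  case (Node l x r)
  define s where "s = real (size l + size r + 1)"
  have s: "s > 0" by (simp add: s_def)
  have "ln (shape_prob \<langle>l, x, r\<rangle>) = ln ((if canon l = canon r then 1 else 2) / s) + ln (shape_prob l) + ln (shape_prob r)"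
  proof -
    have "ln (c / s * p * q) = ln (c / s) + ln p + ln q" if "c > 0" "p > 0" "q > 0" for c p q :: real
      using that s by (simp add: ln_mult ln_div)
    then show ?thesis using shape_prob_pos[of l] shape_prob_pos[of r] unfolding s_def shape_prob.simps by auto
  qed
  also have "ln ((if canon l = canon r then 1 else 2) / s) = (if canon l = canon r then 0 else ln 2) - ln s"
    using s by (simp add: ln_div)
  finally have eq: "- ln (shape_prob \<langle>l, x, r\<rangle>) =
      ln s - (if canon l = canon r then 0 else ln 2) + - ln (shape_prob l) + - ln (shape_prob r)" by simp
  have sz: "real (size \<langle>l, x, r\<rangle>) = s" by (simp add: s_def)
  have "entropy_toll K \<langle>l, x, r\<rangle> \<le> ln s - (if canon l = canon r then 0 else ln 2)"
  proof (cases "size \<langle>l, x, r\<rangle> \<le> K")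
    case True
    then show ?thesis unfolding entropy_toll_def sz by simp
  next
    case False
    then have "ln (real (K + 1)) \<le> ln s" unfolding sz[symmetric] by (subst ln_le_cancel_iff) auto
    moreover have "ln (2::real) \<ge> 0" by simp
    moreover have "entropy_toll K \<langle>l, x, r\<rangle> = ln (real (K + 1)) - ln 2"
      using False by (simp add: entropy_toll_def)
    ultimately show ?thesis by (simp only: split: if_splits) linarith
  qed
  then show ?case using Node.IH unfolding eq fringe_sum.simps by linarith
qed simp

lemma entropy_rate_eq:
  "2 * (\<Sum>k=1..K. (ln (real k) - ln 2 * (1 - sym_prob k)) / (real (k + 1) * real (k + 2)))
     + 2 * (ln (real (K + 1)) - ln 2) / real (K + 2) = entropy_rate K"
proof (induction K)
  case 0
  then show ?case by (simp add: entropy_rate_def)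
next
  case (Suc K)
  define P where "P = real (K + 2)"
  define T where "T = ln (real (K + 1))"
  define T' where "T' = ln (real (K + 2))"
  define s where "s = sym_prob (Suc K)"
  have P: "P > 0" "real (K + 3) = P + 1" by (auto simp: P_def)
  have "ln (1 + 1 / real (Suc K)) = ln (real (K + 2) / real (K + 1))"
    by (intro arg_cong[where f = ln]) (simp add: field_simps)
  also have "\<dots> = T' - T" unfolding T_def T'_def by (subst ln_div) auto
  finally have ln: "ln (1 + 1 / real (Suc K)) = T' - T" .
  have R: "entropy_rate (Suc K) = entropy_rate K + 2 * (T' - T) / (P + 1) + ln 2 * (2 * s / (P * (P + 1)))"
    unfolding entropy_rate_def using ln P
    by (simp add: P_def s_def add.commute) (simp add: algebra_simps)
  have "2 * (\<Sum>k=1..Suc K. (ln (real k) - ln 2 * (1 - sym_prob k)) / (real (k + 1) * real (k + 2)))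
     + 2 * (ln (real (Suc K + 1)) - ln 2) / real (Suc K + 2) =
     (entropy_rate K - 2 * (T - ln 2) / P) + 2 * ((T - ln 2 * (1 - s)) / (P * (P + 1))) + 2 * (T' - ln 2) / (P + 1)"
  proof -
    have "(\<Sum>k=1..Suc K. (ln (real k) - ln 2 * (1 - sym_prob k)) / (real (k + 1) * real (k + 2))) =
      (\<Sum>k=1..K. (ln (real k) - ln 2 * (1 - sym_prob k)) / (real (k + 1) * real (k + 2))) +
      (T - ln 2 * (1 - s)) / (P * (P + 1))"
      by (simp add: P_def T_def s_def add.commute)
    moreover have "ln (real (Suc K + 1)) = T'" "real (Suc K + 2) = P + 1" by (simp_all add: T'_def P_def)
    ultimately show ?thesis unfolding Suc.IH[symmetric] by (simp only: T_def P_def distrib_left)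
  qed
  also have "\<dots> = entropy_rate (Suc K)"
  proof -
    \<comment> \<open>In these terms \<open>1 / (P * (P + 1))\<close> is \<open>u - v\<close>, so
      the identity no longer contains products of denominators.\<close>
    define u v where "u = 1 / P" and "v = 1 / (P + 1)"
    have uv: "x / P = x * u" "x / (P + 1) = x * v" "x / (P * (P + 1)) = x * (u - v)" for x
      using P(1) by (simp_all add: u_def v_def field_simps)
    show ?thesis unfolding R uv by (simp add: algebra_simps)
  qed
  finally show ?case .
qed

lemma rexp_entropy_fringe_sum:
  assumes "n > K"
  shows "rexp n (fringe_sum (entropy_toll K)) = entropy_rate K * real (n + 1) - (ln (real (K + 1)) - ln 2)"
proof -
  define b where "b = (\<lambda>n. rexp n (entropy_toll K))"
  have b1: "b k = ln (real k) - ln 2 * (1 - sym_prob k)" if "k \<le> K" for k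
  proof -
    have "b k = rexp k (\<lambda>t. ln (real k) - ln 2 * (1 - of_bool (symmetric_root t)))"
      unfolding b_def using that by (intro rexp_cong) (auto simp: entropy_toll_def)
    then show ?thesis by (simp add: sym_prob_def)
  qed
  have b2: "b k = ln (real (K + 1)) - ln 2" if "k > K" for k
  proof -
    have "b k = rexp k (\<lambda>t. ln (real (K + 1)) - ln 2)"
      unfolding b_def using that by (intro rexp_cong) (auto simp: entropy_toll_def)
    then show ?thesis by simp
  qed
  have "rexp n (fringe_sum (entropy_toll K)) =
    (2 * (\<Sum>k=1..K. b k / (real (k + 1) * real (k + 2))) + 2 * (ln (real (K + 1)) - ln 2) / real (K + 2)) * real (n + 1)
      - (ln (real (K + 1)) - ln 2)"
    by (rule quicksort_recurrence_const_toll[where a = "\<lambda>n. rexp n (fringe_sum (entropy_toll K))", OF _ _ b2 assms])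
      (auto simp: b_def rexp_fringe_sum)
  also have "(\<Sum>k=1..K. b k / (real (k + 1) * real (k + 2))) =
     (\<Sum>k=1..K. (ln (real k) - ln 2 * (1 - sym_prob k)) / (real (k + 1) * real (k + 2)))"
    by (intro sum.cong) (auto simp: b1)
  finally show ?thesis unfolding entropy_rate_eq .
qed

text \<open>The constant may depend on \<open>K\<close>, which stays fixed; sums over the finitely
  many sizes up to \<open>K\<close> therefore serve as the bounds \<open>C\<close> and
  \<open>M\<close>.\<close>

lemma rexp_entropy_variance:
  obtains D where "D \<ge> 0" "\<And>n. rexp n (\<lambda>t. (fringe_sum (entropy_toll K) t - rexp n (fringe_sum (entropy_toll K)))\<^sup>2) \<le> D * real (n + 1)"
proof -
  define a where "a = (\<lambda>n. rexp n (fringe_sum (entropy_toll K)))"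
  define V where "V = (\<lambda>n. rexp n (\<lambda>t. (fringe_sum (entropy_toll K) t - rexp n (fringe_sum (entropy_toll K)))\<^sup>2))"
  define \<tau> where "\<tau> = ln (real (K + 1)) - ln 2"
  define C where "C = (\<Sum>n\<le>K. V n)"
  define M where "M = (\<Sum>n\<le>K. \<bar>a n - (entropy_rate K * real (n + 1) - \<tau>)\<bar>)"
  have V0: "V n \<ge> 0" for n unfolding V_def by (intro integral_nonneg_AE AE_pmfI) auto
  have "V n \<le> (C + 4 * M\<^sup>2) * real (n + 1)" for n
    unfolding V_def
  proof (rule rexp_variance_bound[where K = K and \<tau> = \<tau> and \<alpha> = "entropy_rate K"])
    show "rexp n (fringe_sum (entropy_toll K)) = entropy_rate K * real (n + 1) - \<tau>" if "n > K" for n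
      using rexp_entropy_fringe_sum[OF that] by (simp add: \<tau>_def)
    show "\<bar>rexp n (fringe_sum (entropy_toll K)) - (entropy_rate K * real (n + 1) - \<tau>)\<bar> \<le> M" if "n \<le> K" for n
      unfolding M_def a_def using that by (intro member_le_sum[of n]) auto
    show "rexp n (\<lambda>t. (fringe_sum (entropy_toll K) t - rexp n (fringe_sum (entropy_toll K)))\<^sup>2) \<le> C" if "n \<le> K" for n
      using that V0 member_le_sum[of n "{..K}" V] by (simp add: C_def V_def)
  qed (auto simp: entropy_toll_def \<tau>_def)
  moreover have "C + 4 * M\<^sup>2 \<ge> 0" unfolding C_def using V0 by (intro add_nonneg_nonneg sum_nonneg) auto
  ultimately show ?thesis using that[of "C + 4 * M\<^sup>2"] by (simp add: V_def)
qed

text \<open>Chebyshev's inequality for the lower tail, from the pointwise bound of the indicator by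
  the scaled square.\<close>

lemma rexp_of_bool_Chebyshev:
  assumes "c < a"
  shows "rexp n (\<lambda>t. of_bool (F t < c)) \<le> rexp n (\<lambda>t. (F t - a)\<^sup>2) / (a - c)\<^sup>2"
proof -
  have "rexp n (\<lambda>t. of_bool (F t < c)) \<le> rexp n (\<lambda>t. (F t - a)\<^sup>2 / (a - c)\<^sup>2)"
  proof (rule rexp_mono)
    fix t :: "unit tree"
    have "(F t - a)\<^sup>2 \<ge> (a - c)\<^sup>2" if "F t < c"
    proof -
      have "(a - F t)\<^sup>2 \<ge> (a - c)\<^sup>2" using that assms by (intro power_mono) auto
      then show ?thesis by (simp add: power2_commute)
    qed
    then show "of_bool (F t < c) \<le> (F t - a)\<^sup>2 / (a - c)\<^sup>2"
      using assms by (auto simp: field_simps)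
  qed
  then show ?thesis by simp
qed

text \<open>The truncated entropy has mean close to \<open>entropy_rate K * n\<close> and standard
  deviation of order at most \<open>sqrt n\<close>. Falling below \<open>\<gamma> * n\<close> is a
  linear deviation, so Chebyshev's inequality gives a probability of order at most
  \<open>1 / n\<close>.\<close>

lemma likely_shapes_rare:
  assumes "0 < \<gamma>" "\<gamma> < entropy_rate K"
  shows "(\<lambda>n. rexp n (\<lambda>t. of_bool (shape_prob t > exp (- \<gamma> * real (size t))))) \<longlonglongrightarrow> 0"
proof -
  define F :: "unit tree \<Rightarrow> real" where "F = fringe_sum (entropy_toll K)"
  define \<tau> where "\<tau> = ln (real (K + 1)) - ln 2"
  define \<alpha> where "\<alpha> = entropy_rate K"
  obtain D where D: "D \<ge> 0" "\<And>n. rexp n (\<lambda>t. (F t - rexp n F)\<^sup>2) \<le> D * real (n + 1)"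
    using rexp_entropy_variance[of K] unfolding F_def by blast
  define g where "g = (\<lambda>n. \<alpha> * real (n + 1) - \<tau> - \<gamma> * real n)"
  define d where "d = \<alpha> - \<gamma>"
  have d: "d > 0" using assms by (simp add: d_def \<alpha>_def)
  have g_eq: "g = (\<lambda>n. d * real n + (\<alpha> - \<tau>))" by (auto simp: g_def d_def algebra_simps)
  have g_large: "eventually (\<lambda>n. d * real n + e > 0) sequentially" for e
    using d by real_asymp
  have "eventually (\<lambda>n. rexp n (\<lambda>t. of_bool (shape_prob t > exp (- \<gamma> * real (size t)))) \<le> D * real (n + 1) / (g n)\<^sup>2) sequentially"
    using g_large[of "\<alpha> - \<tau>"] eventually_gt_at_top[of K]
  proof eventually_elim
    case (elim n)
    have a: "rexp n F = \<alpha> * real (n + 1) - \<tau>"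
      using rexp_entropy_fringe_sum[OF elim(2)] by (simp add: F_def \<alpha>_def \<tau>_def)
    have "rexp n (\<lambda>t. of_bool (shape_prob t > exp (- \<gamma> * real (size t)))) \<le> rexp n (\<lambda>t. of_bool (F t < \<gamma> * real n))"
    proof (rule rexp_mono)
      fix t :: "unit tree" assume t: "size t = n"
      have "F t < \<gamma> * real n" if "shape_prob t > exp (- \<gamma> * real (size t))"
      proof -
        have "- \<gamma> * real n < ln (shape_prob t)"
          using that t shape_prob_pos[of t] by (metis exp_less_mono exp_ln not_less_iff_gr_or_eq)
        then show ?thesis using fringe_sum_entropy_toll_le[of K t] by (simp add: F_def)
      qed
      then show "of_bool (shape_prob t > exp (- \<gamma> * real (size t))) \<le> (of_bool (F t < \<gamma> * real n) :: real)"
        by auto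
    qed
    also have "\<dots> \<le> rexp n (\<lambda>t. (F t - rexp n F)\<^sup>2) / (rexp n F - \<gamma> * real n)\<^sup>2"
      using elim(1) a by (intro rexp_of_bool_Chebyshev) (simp add: d_def algebra_simps)
    also have "\<dots> \<le> D * real (n + 1) / (rexp n F - \<gamma> * real n)\<^sup>2"
      by (intro divide_right_mono D) auto
    finally show ?case using a by (simp add: g_def)
  qed
  moreover have "(\<lambda>n. D * real (n + 1) / (g n)\<^sup>2) \<longlonglongrightarrow> 0"
  proof -
    have "(\<lambda>n. real (n + 1) / (d * real n + e)\<^sup>2) \<longlonglongrightarrow> 0" for e
      using d by real_asymp
    from tendsto_mult_right_zero[OF this] show ?thesis unfolding g_eq by simp
  qed
  moreover have nn: "eventually (\<lambda>n. 0 \<le> rexp n (\<lambda>t. of_bool (shape_prob t > exp (- \<gamma> * real (size t))))) sequentially"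
    by (intro always_eventually allI integral_nonneg_AE AE_pmfI) simp
  ultimately show ?thesis
    by (intro tendsto_sandwich[OF nn _ tendsto_const])
qed

section \<open>Bounding the number of shapes from below by occurrences and collisions\<close>

lemma fringe_subtrees_simps [simp]:
  "fringe_subtrees \<langle>\<rangle> = {}"
  "fringe_subtrees \<langle>l, x, r\<rangle> = insert \<langle>l, x, r\<rangle> (fringe_subtrees l \<union> fringe_subtrees r)"
  by (simp_all add: fringe_subtrees_def Un_Diff insert_Diff_if)

lemma finite_fringe_subtrees [simp]: "finite (fringe_subtrees t)"
  by (induction t) auto

lemma finite_trees_size_le: "finite {t :: unit tree. size t \<le> n}"
proof (induction n)
  case (Suc n)
  have "{t :: unit tree. size t \<le> Suc n} \<subseteq>
      insert \<langle>\<rangle> ((\<lambda>(l, r). \<langle>l, (), r\<rangle>) ` ({t. size t \<le> n} \<times> {t. size t \<le> n}))"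
  proof
    fix t :: "unit tree" assume "t \<in> {t. size t \<le> Suc n}"
    then show "t \<in> insert \<langle>\<rangle> ((\<lambda>(l, r). \<langle>l, (), r\<rangle>) ` ({t. size t \<le> n} \<times> {t. size t \<le> n}))"
      by (cases t) auto
  qed
  then show ?case using Suc by (meson finite_SigmaI finite_imageI finite_insert finite_subset)
qed auto

lemma shape_count_pos_imp: "shape_count \<tau> t \<noteq> 0 \<Longrightarrow> \<tau> \<in> canon ` fringe_subtrees t"
proof (induction t)
  case (Node l x r)
  then show ?case
    by (cases "canon \<langle>l, x, r\<rangle> = \<tau>") (force simp: shape_count_def simp del: canon.simps)+
qed (simp add: shape_count_def)

text \<open>A shape with \<open>m\<close> occurrences contributes
  \<open>m - (m^2 - m) = m * (2 - m)\<close> to the right-hand side, which is 0 for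
  \<open>m = 0\<close>, 1 for \<open>m = 1\<close> and at most 0 otherwise.\<close>

lemma num_shapes_ge_sum:
  assumes "finite G"
  shows "real (num_shapes t) \<ge> (\<Sum>\<tau>\<in>G. shape_count \<tau> t) - (\<Sum>\<tau>\<in>G. (shape_count \<tau> t)\<^sup>2 - shape_count \<tau> t)"
proof -
  have "(\<Sum>\<tau>\<in>G. shape_count \<tau> t) - (\<Sum>\<tau>\<in>G. (shape_count \<tau> t)\<^sup>2 - shape_count \<tau> t) =
     (\<Sum>\<tau>\<in>G. shape_count \<tau> t - ((shape_count \<tau> t)\<^sup>2 - shape_count \<tau> t))"
    by (rule sum_subtractf[symmetric])
  also have "\<dots> \<le> (\<Sum>\<tau>\<in>G. of_bool (\<tau> \<in> canon ` fringe_subtrees t))"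
  proof (rule sum_mono)
    fix \<tau>
    have "shape_count \<tau> t \<in> \<nat>" unfolding shape_count_def by (rule fringe_sum_of_bool_Nats)
    then obtain m where m: "shape_count \<tau> t = real m" by (auto elim: Nats_cases)
    consider "m = 0" | "m = 1" | "m \<ge> 2" by linarith
    then show "shape_count \<tau> t - ((shape_count \<tau> t)\<^sup>2 - shape_count \<tau> t) \<le> of_bool (\<tau> \<in> canon ` fringe_subtrees t)"
    proof cases
      case 2
      then show ?thesis using m shape_count_pos_imp[of \<tau> t] by simp
    next
      case 3
      then have "real m * (2 - real m) \<le> 0" by (intro mult_nonneg_nonpos) auto
      then have "shape_count \<tau> t - ((shape_count \<tau> t)\<^sup>2 - shape_count \<tau> t) \<le> 0"
        by (simp add: m power2_eq_square algebra_simps)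
      then show ?thesis by (smt (verit) of_bool_def zero_le_one)
    qed (use m in simp)
  qed
  also have "\<dots> = real (card (G \<inter> canon ` fringe_subtrees t))"
    using assms by (simp add: of_bool_def sum.If_cases Int_def)
  also have "\<dots> \<le> real (num_shapes t)"
    unfolding num_shapes_def by (intro of_nat_mono card_mono) auto
  finally show ?thesis .
qed

definition likely :: "real \<Rightarrow> 'a tree \<Rightarrow> bool" where
  "likely \<gamma> t \<longleftrightarrow> shape_prob t > exp (- \<gamma> * real (size t))"

text \<open>The upper bound \<open>n\<close> on the size keeps the set finite; no fringe subtree of
  a tree of size \<open>n\<close> is larger.\<close>

definition unlikely_shapes :: "real \<Rightarrow> nat \<Rightarrow> nat \<Rightarrow> utree set" where
  "unlikely_shapes \<gamma> k n = canon ` {t :: unit tree. k < size t \<and> size t \<le> n \<and> \<not> likely \<gamma> t}"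

lemma finite_unlikely_shapes: "finite (unlikely_shapes \<gamma> k n)"
  unfolding unlikely_shapes_def
  by (intro finite_imageI finite_subset[OF _ finite_trees_size_le[of n]]) auto

text \<open>Both sides are the probability of the same event, which avoids an induction over two
  trees.\<close>

lemma canon_eq_imp_shape_prob_eq: "canon s = canon t \<Longrightarrow> shape_prob s = shape_prob t"
proof -
  assume eq: "canon s = canon t"
  have "shape_prob s = rexp (size s) (\<lambda>u. of_bool (canon u = canon s))" by (simp only: rexp_canon_eq)
  also have "\<dots> = rexp (size t) (\<lambda>u. of_bool (canon u = canon t))"
    unfolding eq canon_eq_imp_size_eq[OF eq] ..
  finally show ?thesis by (simp only: rexp_canon_eq)
qed

lemma canon_mem_unlikely_shapes_iff:
  "canon (t :: unit tree) \<in> unlikely_shapes \<gamma> k n \<longleftrightarrow> k < size t \<and> size t \<le> n \<and> \<not> likely \<gamma> t"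
proof
  assume "canon t \<in> unlikely_shapes \<gamma> k n"
  then obtain s :: "unit tree" where s: "canon t = canon s" "k < size s" "size s \<le> n" "\<not> likely \<gamma> s"
    unfolding unlikely_shapes_def by auto
  have "size t = size s" using s(1) by (rule canon_eq_imp_size_eq)
  moreover have "shape_prob t = shape_prob s" using s(1) by (rule canon_eq_imp_shape_prob_eq)
  ultimately show "k < size t \<and> size t \<le> n \<and> \<not> likely \<gamma> t" using s by (simp add: likely_def)
qed (auto simp: unlikely_shapes_def)

text \<open>Summing the occurrences of all unlikely shapes counts the fringe subtrees of size above
  \<open>k\<close> that are not likely; the repetitions among them are then subtracted.\<close>

lemma num_shapes_lower:
  fixes t :: "unit tree"
  shows "real (num_shapes t) \<ge> large_count k t - fringe_sum (\<lambda>s. of_bool (k < size s \<and> likely \<gamma> s)) t -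
     (\<Sum>\<tau>\<in>unlikely_shapes \<gamma> k (size t). (shape_count \<tau> t)\<^sup>2 - shape_count \<tau> t)"
proof -
  let ?G = "unlikely_shapes \<gamma> k (size t)"
  have "(\<Sum>\<tau>\<in>?G. shape_count \<tau> t) = fringe_sum (\<lambda>s. \<Sum>\<tau>\<in>?G. of_bool (canon s = \<tau>)) t"
    unfolding shape_count_def by (rule fringe_sum_sum[symmetric]) (rule finite_unlikely_shapes)
  also have "\<dots> = fringe_sum (\<lambda>s. of_bool (size s > k) + (-1) * of_bool (k < size s \<and> likely \<gamma> s)) t"
  proof (rule fringe_sum_cong)
    fix s :: "unit tree" assume s: "size s \<le> size t"
    have "(\<Sum>\<tau>\<in>?G. of_bool (canon s = \<tau>)) = (of_bool (canon s \<in> ?G) :: real)"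
      using finite_unlikely_shapes[of \<gamma> k "size t"] by (simp add: of_bool_def sum.delta)
    then show "(\<Sum>\<tau>\<in>?G. of_bool (canon s = \<tau>)) = of_bool (size s > k) + (-1) * (of_bool (k < size s \<and> likely \<gamma> s) :: real)"
      using s by (simp add: canon_mem_unlikely_shapes_iff)
  qed
  also have "\<dots> = large_count k t - fringe_sum (\<lambda>s. of_bool (k < size s \<and> likely \<gamma> s)) t"
    unfolding fringe_sum_add fringe_sum_cmult large_count_def by simp
  finally show ?thesis using num_shapes_ge_sum[OF finite_unlikely_shapes[of \<gamma> k "size t"], of t] by simp
qed

text \<open>One of the two factors \<open>p\<close> in \<open>p^2 * n^2\<close> is bounded by
  \<open>exp (- \<gamma> * j)\<close>; the other sums to at most 1 over all shapes of size
  \<open>j\<close>. What remains is a geometric series over \<open>j > k\<close>.\<close>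

lemma rexp_collisions_le:
  assumes "\<gamma> > 0"
  shows "rexp n (\<lambda>t. \<Sum>\<tau>\<in>unlikely_shapes \<gamma> k n. (shape_count \<tau> t)\<^sup>2 - shape_count \<tau> t)
     \<le> (real n)\<^sup>2 * exp (- \<gamma> * real k) / (1 - exp (- \<gamma>))"
proof -
  define q where "q = exp (- \<gamma>)"
  have q: "0 < q" "q < 1" using assms by (auto simp: q_def)
  have qj: "exp (- \<gamma> * real j) = q ^ j" for j unfolding q_def by (simp add: exp_of_nat_mult[symmetric] mult.commute)
  define G where "G = (\<lambda>j. canon ` {t :: unit tree. size t = j \<and> \<not> likely \<gamma> t})"
  have finG: "finite (G j)" for j
    unfolding G_def by (intro finite_imageI finite_subset[OF _ finite_trees_size_le[of j]]) auto
  have "unlikely_shapes \<gamma> k n = (\<Union>j\<in>{k<..n}. G j)"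
    unfolding unlikely_shapes_def G_def by auto
  moreover have "disjoint_family_on G {k<..n}"
    unfolding disjoint_family_on_def G_def by (auto dest: canon_eq_imp_size_eq)
  ultimately have "rexp n (\<lambda>t. \<Sum>\<tau>\<in>unlikely_shapes \<gamma> k n. (shape_count \<tau> t)\<^sup>2 - shape_count \<tau> t) =
      (\<Sum>j\<in>{k<..n}. \<Sum>\<tau>\<in>G j. rexp n (\<lambda>t. (shape_count \<tau> t)\<^sup>2 - shape_count \<tau> t))"
    by (simp add: sum.UNION_disjoint_family finG)
  also have "\<dots> \<le> (\<Sum>j\<in>{k<..n}. q ^ j * (real n)\<^sup>2)"
  proof (rule sum_mono)
    fix j assume "j \<in> {k<..n}"
    have "(\<Sum>\<tau>\<in>G j. rexp n (\<lambda>t. (shape_count \<tau> t)\<^sup>2 - shape_count \<tau> t)) \<le>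
      (\<Sum>\<tau>\<in>G j. q ^ j * (real n)\<^sup>2 * rexp j (\<lambda>s. of_bool (canon s = \<tau>)))"
    proof (rule sum_mono)
      fix \<tau> assume "\<tau> \<in> G j"
      then obtain t :: "unit tree" where t: "\<tau> = canon t" "size t = j" "shape_prob t \<le> q ^ j"
        unfolding G_def likely_def by (force simp: not_less simp flip: qj)
      have "rexp n (\<lambda>t. (shape_count \<tau> t)\<^sup>2 - shape_count \<tau> t) \<le> (shape_prob t)\<^sup>2 * (real n)\<^sup>2"
        unfolding t(1) by (rule rexp_shape_count_pairs_le)
      also have "\<dots> = shape_prob t * (real n)\<^sup>2 * shape_prob t" by (simp add: power2_eq_square)
      also have "\<dots> \<le> q ^ j * (real n)\<^sup>2 * shape_prob t"
        using t(3) shape_prob_pos[of t] by (intro mult_right_mono) auto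
      also have "shape_prob t = rexp j (\<lambda>s. of_bool (canon s = \<tau>))"
        using rexp_canon_eq[of t] t by simp
      finally show "rexp n (\<lambda>t. (shape_count \<tau> t)\<^sup>2 - shape_count \<tau> t) \<le> q ^ j * (real n)\<^sup>2 * rexp j (\<lambda>s. of_bool (canon s = \<tau>))" .
    qed
    also have "\<dots> = q ^ j * (real n)\<^sup>2 * rexp j (\<lambda>s. \<Sum>\<tau>\<in>G j. of_bool (canon s = \<tau>))"
      by (simp add: sum_distrib_left)
    also have "\<dots> \<le> q ^ j * (real n)\<^sup>2 * rexp j (\<lambda>s. 1)"
      using q finG[of j] by (intro mult_left_mono rexp_mono) (auto simp: of_bool_def sum.delta)
    finally show "(\<Sum>\<tau>\<in>G j. rexp n (\<lambda>t. (shape_count \<tau> t)\<^sup>2 - shape_count \<tau> t)) \<le> q ^ j * (real n)\<^sup>2" by simp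
  qed
  also have "\<dots> = (\<Sum>j\<in>{k<..n}. q ^ j) * (real n)\<^sup>2" by (simp add: sum_distrib_right)
  also have "\<dots> \<le> (q ^ k / (1 - q)) * (real n)\<^sup>2"
  proof (rule mult_right_mono)
    have "(\<Sum>j\<in>{k<..n}. q ^ j) \<le> (\<Sum>j\<in>{k..n}. q ^ j)" using q by (intro sum_mono2) auto
    also have "\<dots> \<le> q ^ k / (1 - q)"
      using q sum_gp[of q k n] by (auto simp: divide_right_mono)
    finally show "(\<Sum>j\<in>{k<..n}. q ^ j) \<le> q ^ k / (1 - q)" .
  qed simp
  finally show ?thesis unfolding qj by (simp add: q_def mult.commute)
qed

subsection \<open>The lower bound\<close>

lemma rexp_nonneg: "(\<And>t. f t \<ge> 0) \<Longrightarrow> rexp n f \<ge> 0"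
  by (intro integral_nonneg_AE AE_pmfI) auto

lemma rexp_fringe_sum_likely_le:
  assumes "\<And>j. j > k \<Longrightarrow> rexp j (\<lambda>s. of_bool (likely \<gamma> s)) \<le> \<eta>"
  shows "rexp n (fringe_sum (\<lambda>s. of_bool (k < size s \<and> likely \<gamma> s))) \<le> \<eta> * rexp n (large_count k)"
proof -
  have "rexp n (fringe_sum (\<lambda>s. of_bool (k < size s \<and> likely \<gamma> s))) \<le>
      rexp n (fringe_sum (\<lambda>s. \<eta> * of_bool (k < size s)))"
  proof (rule rexp_fringe_sum_mono)
    fix j
    show "rexp j (\<lambda>s. of_bool (k < size s \<and> likely \<gamma> s)) \<le> rexp j (\<lambda>s. \<eta> * of_bool (k < size s))"
    proof (cases "k < j")
      case True
      have "rexp j (\<lambda>s. of_bool (k < size s \<and> likely \<gamma> s)) = rexp j (\<lambda>s. of_bool (likely \<gamma> s))"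
        using True by (intro rexp_cong) simp
      also have "\<dots> \<le> rexp j (\<lambda>_. \<eta>)" using assms True by simp
      also have "\<dots> = rexp j (\<lambda>s. \<eta> * of_bool (k < size s))" using True by (intro rexp_cong) simp
      finally show ?thesis .
    qed (intro rexp_mono, simp)
  qed
  also have "\<dots> = \<eta> * rexp n (large_count k)"
    by (simp add: fringe_sum_cmult[abs_def] large_count_def)
  finally show ?thesis .
qed

text \<open>The number of shapes can only be small if the count of large fringe subtrees is far below its
  mean, or if many of these subtrees have an overly likely shape or repeat an unlikely one.\<close>

lemma prob_num_shapes_less:
  assumes "\<gamma> > 0" and \<eta>: "\<And>j. j > k \<Longrightarrow> rexp j (\<lambda>s. of_bool (likely \<gamma> s)) \<le> \<eta>"
    and "d > 0" and d: "rexp n (large_count k) - y \<ge> d"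
  shows "rexp n (\<lambda>t. of_bool (real (num_shapes t) < y)) \<le>
    16 * real (n + 1) / d\<^sup>2 +
    2 * (\<eta> * rexp n (large_count k) + (real n)\<^sup>2 * exp (- \<gamma> * real k) / (1 - exp (- \<gamma>))) / d"
proof -
  let ?L = "large_count k :: unit tree \<Rightarrow> real"
  let ?B = "fringe_sum (\<lambda>s. of_bool (k < size s \<and> likely \<gamma> s)) :: unit tree \<Rightarrow> real"
  let ?C = "\<lambda>t :: unit tree. \<Sum>\<tau>\<in>unlikely_shapes \<gamma> k n. (shape_count \<tau> t)\<^sup>2 - shape_count \<tau> t"
  define x where "x = rexp n ?L"
  have B: "?B t \<ge> 0" for t by (intro fringe_sum_nonneg) simp
  have C: "?C t \<ge> 0" for t
  proof (rule sum_nonneg)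
    fix \<tau>
    have "shape_count \<tau> t \<in> \<nat>" unfolding shape_count_def by (rule fringe_sum_of_bool_Nats)
    then obtain m where m: "shape_count \<tau> t = real m" by (auto elim: Nats_cases)
    have "m \<le> m * m" by (cases m) auto
    then show "(shape_count \<tau> t)\<^sup>2 - shape_count \<tau> t \<ge> 0"
      unfolding m power2_eq_square by (metis diff_ge_0_iff_ge of_nat_le_iff of_nat_mult)
  qed
  \<comment> \<open>Half of the gap \<open>d\<close> is granted to the fluctuation of
    \<open>?L\<close> (second moment) and half to \<open>?B + ?C\<close> (first moment); both tail
    bounds are merged into one pointwise inequality.\<close>
  have "rexp n (\<lambda>t. of_bool (real (num_shapes t) < y)) \<le>
     rexp n (\<lambda>t. 4 / d\<^sup>2 * (?L t - x)\<^sup>2 + 2 / d * (?B t + ?C t))"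
  proof (rule rexp_mono)
    fix t :: "unit tree" assume t: "size t = n"
    have nn: "0 \<le> 4 / d\<^sup>2 * (?L t - x)\<^sup>2" "0 \<le> 2 / d * (?B t + ?C t)"
      using \<open>d > 0\<close> B[of t] C[of t] by auto
    show "of_bool (real (num_shapes t) < y) \<le> 4 / d\<^sup>2 * (?L t - x)\<^sup>2 + 2 / d * (?B t + ?C t)"
    proof (cases "real (num_shapes t) < y")
      case True
      then have "?L t - ?B t - ?C t < y" using num_shapes_lower[where t = t and \<gamma> = \<gamma> and k = k] t by simp
      then consider "x - ?L t \<ge> d / 2" | "?B t + ?C t \<ge> d / 2"
        using d unfolding x_def by linarith
      then show ?thesis
      proof cases
        case 1
        then have "(x - ?L t)\<^sup>2 \<ge> (d / 2)\<^sup>2" using \<open>d > 0\<close> by (intro power_mono) auto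
        then have "4 / d\<^sup>2 * (?L t - x)\<^sup>2 \<ge> 1"
          using \<open>d > 0\<close> by (simp add: power2_commute[of x] field_simps power2_eq_square)
        then show ?thesis using nn True by simp
      next
        case 2
        then have "2 / d * (?B t + ?C t) \<ge> 2 / d * (d / 2)" using \<open>d > 0\<close> by (intro mult_left_mono) auto
        also have "2 / d * (d / 2) = 1" using \<open>d > 0\<close> by simp
        finally show ?thesis using nn(1) unfolding of_bool_def if_P[OF True] by linarith
      qed
    qed (use nn in simp)
  qed
  also have "\<dots> = 4 / d\<^sup>2 * rexp n (\<lambda>t. (?L t - x)\<^sup>2) + 2 / d * (rexp n ?B + rexp n ?C)"
  proof -
    have "rexp n (\<lambda>t. a * f t + b * (g t + h t)) = a * rexp n f + b * (rexp n g + rexp n h)" for a b f g h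
      by simp
    then show ?thesis .
  qed
  also have "\<dots> \<le> 4 / d\<^sup>2 * (4 * real (n + 1)) + 2 / d * (\<eta> * x + (real n)\<^sup>2 * exp (- \<gamma> * real k) / (1 - exp (- \<gamma>)))"
    unfolding x_def using \<open>d > 0\<close>
    by (intro add_mono mult_left_mono rexp_large_count_variance rexp_fringe_sum_likely_le \<eta>
        rexp_collisions_le[OF \<open>\<gamma> > 0\<close>]) auto
  finally show ?thesis by (simp add: x_def)
qed

text \<open>With \<open>k\<close> close to \<open>ln n / \<beta>\<close> and
  \<open>c / 2 < \<beta> < \<gamma>\<close>, about \<open>2 * \<beta> * n / ln n\<close> fringe
  subtrees are large, which exceeds \<open>c * n / ln n\<close> by a positive fraction. The
  collisions are of order at most \<open>n powr (2 - \<gamma> / \<beta>)\<close>, negligible because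
  the exponent is below 1.\<close>

lemma prob_num_shapes_less_tendsto:
  assumes "0 < c" "c / 2 < entropy_rate K"
  shows "(\<lambda>n. rexp n (\<lambda>t. of_bool (real (num_shapes t) < c * (real n / ln (real n))))) \<longlonglongrightarrow> 0"
proof -
  obtain \<gamma> where \<gamma>: "c / 2 < \<gamma>" "\<gamma> < entropy_rate K" using dense[OF assms(2)] by blast
  obtain \<beta> where \<beta>: "c / 2 < \<beta>" "\<beta> < \<gamma>" using dense[OF \<gamma>(1)] by blast
  have pos: "\<gamma> > 0" "\<beta> > 0" using \<gamma> \<beta> assms(1) by linarith+
  define \<delta> where "\<delta> = (2 * \<beta> - c) / 2"
  have \<delta>: "\<delta> > 0" using \<beta> by (simp add: \<delta>_def)
  define k where "k = (\<lambda>n. nat \<lfloor>ln (real n) / \<beta>\<rfloor>)"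
  have rare: "(\<lambda>n. rexp n (\<lambda>t. of_bool (likely \<gamma> t))) \<longlonglongrightarrow> 0"
    unfolding likely_def using pos \<gamma> by (intro likely_shapes_rare[of _ K])
  define f where "f = (\<lambda>n. rexp n (\<lambda>t. of_bool (real (num_shapes t) < c * (real n / ln (real n)))))"
  have "eventually (\<lambda>n. f n < e) sequentially" if e: "e > 0" for e
  proof -
    \<comment> \<open>Chosen so that the term with the likely shapes contributes at most
      \<open>e / 2\<close>, using \<open>x \<le> 4 * \<beta> * L\<close>.\<close>
    define \<eta> where "\<eta> = e * \<delta> / (16 * \<beta>)"
    have "\<eta> > 0" using e \<delta> pos by (simp add: \<eta>_def)
    then have "eventually (\<lambda>n. rexp n (\<lambda>t. of_bool (likely \<gamma> t)) < \<eta>) sequentially"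
      using rare by (rule order_tendstoD(2)[rotated])
    then obtain J where J: "\<And>j. j \<ge> J \<Longrightarrow> rexp j (\<lambda>t. of_bool (likely \<gamma> t)) < \<eta>"
      unfolding eventually_sequentially by blast
    \<comment> \<open>The terms without \<open>\<eta>\<close>; the factor
      \<open>exp \<gamma>\<close> pays for rounding \<open>k\<close> down by less than one.\<close>
    define h where "h = (\<lambda>n. 16 * real (n + 1) / (\<delta> * (real n / ln (real n)))\<^sup>2 +
      2 * ((real n)\<^sup>2 * (exp \<gamma> * real n powr (- (\<gamma> / \<beta>))) / (1 - exp (- \<gamma>))) / (\<delta> * (real n / ln (real n))))"
    have "h \<longlonglongrightarrow> 0 + 0"
      unfolding h_def
    proof (rule tendsto_add)
      show "(\<lambda>n. 16 * real (n + 1) / (\<delta> * (real n / ln (real n)))\<^sup>2) \<longlonglongrightarrow> 0"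
        using \<delta> by real_asymp
      define \<rho> where "\<rho> = \<gamma> / \<beta>"
      have \<rho>: "\<rho> > 1" using \<beta> pos by (simp add: \<rho>_def)
      have "(\<lambda>n. (real n)\<^sup>2 * real n powr (- \<rho>) / (real n / ln (real n))) \<longlonglongrightarrow> 0"
        using \<rho> by real_asymp
      from tendsto_mult_right_zero[OF this, of "2 * exp \<gamma> / (1 - exp (- \<gamma>)) / \<delta>"]
      show "(\<lambda>n. 2 * ((real n)\<^sup>2 * (exp \<gamma> * real n powr (- (\<gamma> / \<beta>))) / (1 - exp (- \<gamma>))) / (\<delta> * (real n / ln (real n)))) \<longlonglongrightarrow> 0"
        by (simp add: \<rho>_def mult_ac)
    qed
    then have "eventually (\<lambda>n. h n < e / 4) sequentially"
      using e by (intro order_tendstoD(2)[of h 0]) auto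
    moreover have "eventually (\<lambda>n. ln (real n) / \<beta> \<ge> real J + 1) sequentially"
      using pos by real_asymp
    moreover have "eventually (\<lambda>n. 2 * real n / (ln (real n) / \<beta> + 2) - 1 - c * (real n / ln (real n)) \<ge> \<delta> * (real n / ln (real n))) sequentially"
    proof -
      have "2 * \<beta> - (c + \<delta>) > 0" using \<delta> by (simp add: \<delta>_def field_simps)
      moreover have "(\<lambda>n. (2 * real n / (ln (real n) / \<beta> + 2) - 1) / (real n / ln (real n))) \<longlonglongrightarrow> 2 * \<beta>"
        using pos by real_asymp
      ultimately have "eventually (\<lambda>n. (2 * real n / (ln (real n) / \<beta> + 2) - 1) / (real n / ln (real n)) > c + \<delta>) sequentially"
        by (intro order_tendstoD(1)) auto
      then show ?thesis using eventually_gt_at_top[of 2]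
      proof eventually_elim
        case (elim n)
        then have L: "real n / ln (real n) > 0" by simp
        have "(c + \<delta>) * (real n / ln (real n)) < 2 * real n / (ln (real n) / \<beta> + 2) - 1"
          using elim(1) unfolding pos_less_divide_eq[OF L] .
        then show ?case unfolding distrib_right by linarith
      qed
    qed
    moreover have "eventually (\<lambda>n. ln (real n) / \<beta> < real n) sequentially"
      using pos by real_asymp
    moreover note eventually_gt_at_top[of 2]
    ultimately show "eventually (\<lambda>n. f n < e) sequentially"
    proof eventually_elim
      case (elim n)
      define L where "L = real n / ln (real n)"
      have n: "n > 2" "ln (real n) > 0" using elim by auto
      then have "L > 0" by (simp add: L_def)
      have kle: "real (k n) \<le> ln (real n) / \<beta>" and kge: "real (k n) > ln (real n) / \<beta> - 1"
        unfolding k_def using n pos by (auto simp: of_nat_floor)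
      have kn: "k n < n" using kle elim by linarith
      have kJ: "k n \<ge> J" using kge elim by linarith
      define x where "x = rexp n (large_count (k n))"
      have x: "x = 2 * real (n + 1) / real (k n + 2) - 1"
        using kn by (simp add: x_def rexp_large_count)
      have "2 * real n / (ln (real n) / \<beta> + 2) \<le> 2 * real (n + 1) / real (k n + 2)"
        using kle n by (intro frac_le) auto
      then have xlow: "x - c * L \<ge> \<delta> * L" using elim x by (simp add: L_def)
      have "x \<le> 2 * real (n + 1) / real (k n + 2)" by (simp add: x)
      also have "\<dots> \<le> (4 * real n) / (ln (real n) / \<beta>)"
        using kge n pos by (intro frac_le) (auto intro!: divide_pos_pos)
      also have "\<dots> = 4 * \<beta> * L" by (simp add: L_def)
      finally have xup: "x \<le> 4 * \<beta> * L" .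
      have "f n \<le> 16 * real (n + 1) / (\<delta> * L)\<^sup>2 +
          2 * (\<eta> * x + (real n)\<^sup>2 * exp (- \<gamma> * real (k n)) / (1 - exp (- \<gamma>))) / (\<delta> * L)"
        unfolding f_def x_def L_def[symmetric]
        using pos J kJ \<delta> \<open>L > 0\<close> xlow by (intro prob_num_shapes_less) (auto simp: x_def intro: less_imp_le)
      also have "\<dots> = 16 * real (n + 1) / (\<delta> * L)\<^sup>2 + 2 * ((real n)\<^sup>2 * exp (- \<gamma> * real (k n)) / (1 - exp (- \<gamma>))) / (\<delta> * L)
          + 2 * \<eta> * x / (\<delta> * L)"
        by (simp add: add_divide_distrib distrib_left)
      also have "2 * \<eta> * x / (\<delta> * L) \<le> 2 * \<eta> * (4 * \<beta> * L) / (\<delta> * L)"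
        using xup \<open>\<eta> > 0\<close> \<delta> \<open>L > 0\<close> by (intro divide_right_mono mult_left_mono) auto
      also have "\<dots> = e / 2" using \<delta> \<open>L > 0\<close> pos by (simp add: \<eta>_def)
      also have "16 * real (n + 1) / (\<delta> * L)\<^sup>2 + 2 * ((real n)\<^sup>2 * exp (- \<gamma> * real (k n)) / (1 - exp (- \<gamma>))) / (\<delta> * L) \<le> h n"
      proof -
        have "- \<gamma> * real (k n) \<le> - \<gamma> * (ln (real n) / \<beta> - 1)"
          using kge pos by (intro mult_left_mono_neg) auto
        also have "\<dots> = \<gamma> + (- (\<gamma> / \<beta>)) * ln (real n)" by (simp add: algebra_simps)
        finally have "exp (- \<gamma> * real (k n)) \<le> exp (\<gamma> + (- (\<gamma> / \<beta>)) * ln (real n))" by simp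
        also have "\<dots> = exp \<gamma> * real n powr (- (\<gamma> / \<beta>))" using n by (subst exp_add) (simp add: powr_def)
        finally show ?thesis unfolding h_def L_def[symmetric] using pos \<delta> \<open>L > 0\<close>
          by (intro add_left_mono divide_right_mono mult_left_mono) auto
      qed
      finally show ?case using elim e by linarith
    qed
  qed
  then have "f \<longlonglongrightarrow> 0"
    by (intro order_tendstoI) (auto simp: f_def intro!: always_eventually less_le_trans[OF _ rexp_nonneg])
  then show ?thesis by (simp add: f_def)
qed

text \<open>Markov's inequality from below: the mean is at least \<open>y\<close> times the
  probability of reaching \<open>y\<close>. The slack between \<open>c\<close> and
  \<open>2 * c'\<close> absorbs that this probability is only close to 1.\<close>

lemma expectation_num_shapes_ge:
  assumes "0 < c" "c / 2 < entropy_rate K"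
  shows "eventually (\<lambda>n. c * (real n / ln (real n)) \<le> rexp n (\<lambda>t. real (num_shapes t))) sequentially"
proof -
  obtain c' where c': "c / 2 < c'" "c' < entropy_rate K" using dense[OF assms(2)] by blast
  define p where "p = (\<lambda>n. rexp n (\<lambda>t. of_bool (real (num_shapes t) < 2 * c' * (real n / ln (real n)))))"
  have "p \<longlonglongrightarrow> 0" unfolding p_def using c' assms by (intro prob_num_shapes_less_tendsto[of _ K]) auto
  moreover have "1 - c / (2 * c') > 0" using c' assms by simp
  ultimately have "eventually (\<lambda>n. p n < 1 - c / (2 * c')) sequentially" by (intro order_tendstoD(2))
  then show ?thesis using eventually_gt_at_top[of 2]
  proof eventually_elim
    case (elim n)
    define y where "y = 2 * c' * (real n / ln (real n))"
    have y: "y > 0" using c' assms elim by (simp add: y_def)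
    have "c * (real n / ln (real n)) = y * (c / (2 * c'))" using c' assms by (simp add: y_def)
    also have "\<dots> \<le> y * (1 - p n)" using elim y by (intro mult_left_mono) auto
    also have "\<dots> = rexp n (\<lambda>t. y * (1 - of_bool (real (num_shapes t) < y)))"
      by (simp add: p_def y_def)
    also have "\<dots> \<le> rexp n (\<lambda>t. real (num_shapes t))"
      using y by (intro rexp_mono) auto
    finally show ?case .
  qed
qed

subsection \<open>The upper bound\<close>

definition shapes_upto :: "nat \<Rightarrow> utree set" where
  "shapes_upto k = canon ` {t :: unit tree. size t \<le> k}"

lemma finite_shapes_upto: "finite (shapes_upto k)"
  unfolding shapes_upto_def by (intro finite_imageI finite_trees_size_le)

lemma card_canon_fringe_le:
  "real (card (canon ` {s \<in> fringe_subtrees t. P s})) \<le> fringe_sum (\<lambda>s. of_bool (P s)) t"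
proof (induction t)
  case (Node l x r)
  let ?S = "\<lambda>t. canon ` {s \<in> fringe_subtrees t. P s}"
  have "?S \<langle>l, x, r\<rangle> \<subseteq> (if P \<langle>l, x, r\<rangle> then {canon \<langle>l, x, r\<rangle>} else {}) \<union> (?S l \<union> ?S r)"
    by auto
  then have "card (?S \<langle>l, x, r\<rangle>) \<le> card ((if P \<langle>l, x, r\<rangle> then {canon \<langle>l, x, r\<rangle>} else {}) \<union> (?S l \<union> ?S r))"
    by (intro card_mono) auto
  also have "\<dots> \<le> card (if P \<langle>l, x, r\<rangle> then {canon \<langle>l, x, r\<rangle>} else {}) + (card (?S l) + card (?S r))"
    by (intro order_trans[OF card_Un_le] add_mono card_Un_le order_refl)
  finally have "card (?S \<langle>l, x, r\<rangle>) \<le> of_bool (P \<langle>l, x, r\<rangle>) + (card (?S l) + card (?S r))"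
    by (simp split: if_splits)
  then have "real (card (?S \<langle>l, x, r\<rangle>)) \<le> real (of_bool (P \<langle>l, x, r\<rangle>) + (card (?S l) + card (?S r)))"
    by (rule of_nat_mono)
  then show ?case using Node.IH by (simp only: of_nat_add of_nat_of_bool fringe_sum.simps)
qed simp

text \<open>Small fringe subtrees cannot show more shapes than exist, and large ones cannot show
  more shapes than there are large ones.\<close>

lemma num_shapes_upper:
  fixes t :: "unit tree"
  shows "real (num_shapes t) \<le> real (card (shapes_upto k)) + large_count k t"
proof -
  have "fringe_subtrees t \<subseteq> {s. size s \<le> k} \<union> {s \<in> fringe_subtrees t. size s > k}"
    by auto
  then have "canon ` fringe_subtrees t \<subseteq> shapes_upto k \<union> canon ` {s \<in> fringe_subtrees t. size s > k}"
    unfolding shapes_upto_def image_Un[symmetric] by (rule image_mono)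
  then have "num_shapes t \<le> card (shapes_upto k \<union> canon ` {s \<in> fringe_subtrees t. size s > k})"
    unfolding num_shapes_def by (intro card_mono) (auto simp: finite_shapes_upto)
  also have "\<dots> \<le> card (shapes_upto k) + card (canon ` {s \<in> fringe_subtrees t. size s > k})"
    by (rule card_Un_le)
  finally have "real (num_shapes t) \<le> real (card (shapes_upto k)) + real (card (canon ` {s \<in> fringe_subtrees t. size s > k}))"
    by linarith
  also have "real (card (canon ` {s \<in> fringe_subtrees t. size s > k})) \<le> large_count k t"
    unfolding large_count_def by (rule card_canon_fringe_le)
  finally show ?thesis by simp
qed

section \<open>The generating function of the shapes\<close>

text \<open>The choice of the representative is immaterial, since trees with equal shape have equal
  size.\<close>

definition shape_size :: "utree \<Rightarrow> nat" where
  "shape_size \<tau> = size (SOME t :: unit tree. canon t = \<tau>)"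

lemma shape_size_canon [simp]: "shape_size (canon (t :: unit tree)) = size t"
  unfolding shape_size_def by (rule canon_eq_imp_size_eq) (rule someI, rule refl)

text \<open>Truncation by height keeps all sums finite and turns the functional equation into a
  recursion from \<open>h\<close> to \<open>h + 1\<close>, so no convergence question
  arises.\<close>

definition shapes_height :: "nat \<Rightarrow> utree set" where
  "shapes_height h = canon ` {t :: unit tree. height t \<le> h}"

lemma shapes_height_0: "shapes_height 0 = {UEmpty}"
  unfolding shapes_height_def by auto

lemma shapes_height_Suc:
  "shapes_height (Suc h) = insert UEmpty ((\<lambda>(a, b). UNode (Upair a b)) ` (shapes_height h \<times> shapes_height h))"
proof (intro equalityI subsetI)
  fix \<tau> assume "\<tau> \<in> shapes_height (Suc h)"
  then obtain t :: "unit tree" where "\<tau> = canon t" "height t \<le> Suc h" by (auto simp: shapes_height_def)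
  then show "\<tau> \<in> insert UEmpty ((\<lambda>(a, b). UNode (Upair a b)) ` (shapes_height h \<times> shapes_height h))"
    by (cases t) (auto simp: shapes_height_def image_iff)
next
  fix \<tau> assume "\<tau> \<in> insert UEmpty ((\<lambda>(a, b). UNode (Upair a b)) ` (shapes_height h \<times> shapes_height h))"
  then consider "\<tau> = UEmpty" | l r :: "unit tree" where "\<tau> = UNode (Upair (canon l) (canon r))" "height l \<le> h" "height r \<le> h"
    by (auto simp: shapes_height_def)
  then show "\<tau> \<in> shapes_height (Suc h)"
  proof cases
    case 1
    then show ?thesis unfolding shapes_height_def by (intro image_eqI[of _ _ "\<langle>\<rangle>"]) auto
  next
    case (2 l r)
    then show ?thesis unfolding shapes_height_def by (intro image_eqI[of _ _ "\<langle>l, (), r\<rangle>"]) auto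
  qed
qed

lemma finite_shapes_height: "finite (shapes_height h)"
  by (induction h) (simp_all add: shapes_height_0 shapes_height_Suc)

lemma shape_size_UNode:
  assumes "a \<in> shapes_height h" "b \<in> shapes_height h"
  shows "shape_size (UNode (Upair a b)) = Suc (shape_size a + shape_size b)"
proof -
  obtain l r :: "unit tree" where "a = canon l" "b = canon r" using assms by (auto simp: shapes_height_def)
  then show ?thesis using shape_size_canon[of "\<langle>l, (), r\<rangle>"] by simp
qed

text \<open>In the double sum every pair of different elements occurs twice and every diagonal pair
  once; the extra diagonal sum makes up for the latter.\<close>

lemma sum_unordered_pairs_le:
  fixes g :: "'a uprod \<Rightarrow> real"
  assumes "finite A" "\<And>p. g p \<ge> 0"
  shows "2 * (\<Sum>p\<in>(\<lambda>(a, b). Upair a b) ` (A \<times> A). g p) \<le> (\<Sum>a\<in>A. \<Sum>b\<in>A. g (Upair a b)) + (\<Sum>a\<in>A. g (Upair a a))"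
  using assms(1)
proof (induction A rule: finite_induct)
  case (insert z A)
  let ?U = "\<lambda>A. (\<lambda>(a, b). Upair a b) ` (A \<times> A)"
  have sym: "g (Upair a z) = g (Upair z a)" for a by (rule arg_cong[where f = g]) auto
  have "?U (insert z A) \<subseteq> ?U A \<union> ((\<lambda>a. Upair z a) ` A \<union> {Upair z z})" by auto
  then have "sum g (?U (insert z A)) \<le> sum g (?U A \<union> ((\<lambda>a. Upair z a) ` A \<union> {Upair z z}))"
    using insert.hyps assms(2) by (intro sum_mono2) auto
  also have "\<dots> \<le> sum g (?U A) + sum g ((\<lambda>a. Upair z a) ` A \<union> {Upair z z})"
    using insert.hyps assms(2) by (subst sum.union_inter[symmetric]) (auto intro!: sum_nonneg)
  also have "sum g ((\<lambda>a. Upair z a) ` A \<union> {Upair z z}) = (\<Sum>a\<in>A. g (Upair z a)) + g (Upair z z)"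
    using insert.hyps by (subst sum.union_disjoint) (auto simp: sum.reindex inj_on_def)
  finally have "2 * sum g (?U (insert z A)) \<le> 2 * sum g (?U A) + 2 * (\<Sum>a\<in>A. g (Upair z a)) + 2 * g (Upair z z)"
    by simp
  moreover have "(\<Sum>a\<in>insert z A. \<Sum>b\<in>insert z A. g (Upair a b)) + (\<Sum>a\<in>insert z A. g (Upair a a)) =
      (\<Sum>a\<in>A. \<Sum>b\<in>A. g (Upair a b)) + (\<Sum>a\<in>A. g (Upair a a)) + 2 * (\<Sum>a\<in>A. g (Upair z a)) + 2 * g (Upair z z)"
  proof -
    have "(\<Sum>a\<in>A. g (Upair a z)) = (\<Sum>a\<in>A. g (Upair z a))" by (intro sum.cong refl sym)
    then show ?thesis using insert.hyps by (simp add: sum.distrib)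
  qed
  ultimately show ?case using insert.IH by linarith
qed simp

definition shape_gf :: "nat \<Rightarrow> real \<Rightarrow> real" where
  "shape_gf h x = (\<Sum>\<tau>\<in>shapes_height h. x ^ shape_size \<tau>)"

lemma shape_gf_Suc_le:
  assumes "x \<ge> 0"
  shows "shape_gf (Suc h) x \<le> 1 + x / 2 * ((shape_gf h x)\<^sup>2 + shape_gf h (x\<^sup>2))"
proof -
  let ?A = "shapes_height h" and ?U = "(\<lambda>(a, b). Upair a b) ` (shapes_height h \<times> shapes_height h)"
  have "(\<lambda>(a, b). UNode (Upair a b)) ` (?A \<times> ?A) = UNode ` ?U" by force
  then have "shape_gf (Suc h) x = (\<Sum>\<tau>\<in>insert UEmpty (UNode ` ?U). x ^ shape_size \<tau>)"
    by (simp add: shape_gf_def shapes_height_Suc)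
  also have "\<dots> = 1 + (\<Sum>p\<in>?U. x ^ shape_size (UNode p))"
    using finite_shapes_height[of h] shape_size_canon[of "\<langle>\<rangle>"]
    by (subst sum.insert) (auto simp: sum.reindex inj_on_def)
  also have "(\<Sum>p\<in>?U. x ^ shape_size (UNode p)) \<le>
      ((\<Sum>a\<in>?A. \<Sum>b\<in>?A. x ^ shape_size (UNode (Upair a b))) + (\<Sum>a\<in>?A. x ^ shape_size (UNode (Upair a a)))) / 2"
    using sum_unordered_pairs_le[OF finite_shapes_height, of "\<lambda>p. x ^ shape_size (UNode p)" h] assms by simp
  also have "(\<Sum>a\<in>?A. \<Sum>b\<in>?A. x ^ shape_size (UNode (Upair a b))) = (\<Sum>a\<in>?A. \<Sum>b\<in>?A. x * (x ^ shape_size a * x ^ shape_size b))"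
    by (intro sum.cong refl) (simp add: shape_size_UNode power_add)
  also have "\<dots> = x * (shape_gf h x)\<^sup>2"
    unfolding shape_gf_def power2_eq_square sum_product by (simp only: sum_distrib_left)
  also have "(\<Sum>a\<in>?A. x ^ shape_size (UNode (Upair a a))) = (\<Sum>a\<in>?A. x * (x\<^sup>2) ^ shape_size a)"
    by (intro sum.cong refl) (simp add: shape_size_UNode power_add power2_eq_square power_mult_distrib)
  also have "\<dots> = x * shape_gf h (x\<^sup>2)" by (simp add: shape_gf_def sum_distrib_left)
  finally show ?thesis by (simp add: algebra_simps add_divide_distrib)
qed

lemma shape_gf_nonneg: "x \<ge> 0 \<Longrightarrow> shape_gf h x \<ge> 0"
  unfolding shape_gf_def by (intro sum_nonneg) auto

text \<open>A supersolution \<open>y\<close> of the quadratic equation dominates all truncations: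
  the right-hand side is monotone, and the iteration starts at 1, which is at most
  \<open>y\<close>.\<close>

lemma shape_gf_bound:
  assumes "x \<ge> 0" "\<And>h. shape_gf h (x\<^sup>2) \<le> u" "1 + x / 2 * (y\<^sup>2 + u) \<le> y"
  shows "shape_gf h x \<le> y"
proof (induction h)
  case 0
  have "u \<ge> 0" using assms(1) assms(2)[of 0] shape_gf_nonneg[of "x\<^sup>2" 0] by simp
  then have "1 \<le> y" using assms(1,3) by (smt (verit) zero_le_power2 mult_nonneg_nonneg divide_nonneg_nonneg)
  then show ?case using shape_size_canon[of "\<langle>\<rangle>"] by (simp add: shape_gf_def shapes_height_0)
next
  case (Suc h)
  have "shape_gf (Suc h) x \<le> 1 + x / 2 * ((shape_gf h x)\<^sup>2 + shape_gf h (x\<^sup>2))"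
    by (rule shape_gf_Suc_le) (rule assms)
  also have "\<dots> \<le> 1 + x / 2 * (y\<^sup>2 + u)"
    using assms Suc shape_gf_nonneg[OF assms(1)] by (intro add_left_mono mult_left_mono add_mono power_mono) auto
  also have "\<dots> \<le> y" by fact
  finally show ?case .
qed

lemma shape_gf_mono:
  assumes "0 \<le> x" "x \<le> y"
  shows "shape_gf h x \<le> shape_gf h y"
  unfolding shape_gf_def using assms by (intro sum_mono power_mono) auto

text \<open>A crude bound that ends the descent to higher powers of the argument: below 1/4 both
  values stay under 3/2, and \<open>(9/4 + 3/2) / 2 = 15/8\<close> is less than 2.\<close>

lemma shape_gf_bound_base:
  assumes "0 \<le> x" "x \<le> 1 / 4"
  shows "shape_gf h x \<le> 1 + 2 * x"
proof (induction h)
  case 0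
  then show ?case using shape_size_canon[of "\<langle>\<rangle>"] assms by (simp add: shape_gf_def shapes_height_0)
next
  case (Suc h)
  have "x\<^sup>2 \<le> x" using assms by (simp add: power2_eq_square mult_left_le)
  then have "shape_gf h (x\<^sup>2) \<le> 1 + 2 * x"
    using shape_gf_mono[of "x\<^sup>2" x h] Suc assms by simp
  have "shape_gf (Suc h) x \<le> 1 + x / 2 * ((shape_gf h x)\<^sup>2 + shape_gf h (x\<^sup>2))"
    by (rule shape_gf_Suc_le) (rule assms)
  also have "\<dots> \<le> 1 + x / 2 * ((3/2)\<^sup>2 + 3/2)"
    using assms Suc shape_gf_nonneg[OF assms(1), of h] \<open>shape_gf h (x\<^sup>2) \<le> 1 + 2 * x\<close>
    by (intro add_left_mono mult_left_mono add_mono power_mono) auto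
  also have "\<dots> \<le> 1 + 2 * x" using assms by (simp add: power2_eq_square)
  finally show ?case .
qed

text \<open>Each shape of size at most \<open>k\<close> has weight at least \<open>x ^ k\<close>
  because \<open>x \<le> 1\<close>, and all of them occur in the truncation at height
  \<open>k\<close>.\<close>

lemma card_shapes_upto_le:
  assumes "0 < x" "x \<le> 1" "\<And>h. shape_gf h x \<le> y"
  shows "real (card (shapes_upto k)) \<le> y * (1 / x) ^ k"
proof -
  have hs: "height t \<le> size t" for t :: "unit tree" by (induction t) auto
  have "real (card (shapes_upto k)) * x ^ k = (\<Sum>\<tau>\<in>shapes_upto k. x ^ k)" by simp
  also have "\<dots> \<le> (\<Sum>\<tau>\<in>shapes_upto k. x ^ shape_size \<tau>)"
    using assms by (intro sum_mono power_decreasing) (auto simp: shapes_upto_def)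
  also have "\<dots> \<le> shape_gf k x"
    unfolding shape_gf_def using assms hs order_trans finite_shapes_height[of k]
    by (intro sum_mono2) (fastforce simp: shapes_upto_def shapes_height_def)+
  also have "\<dots> \<le> y" by (rule assms)
  finally show ?thesis using assms by (simp add: field_simps)
qed

text \<open>For \<open>k\<close> close to \<open>\<beta> * ln n\<close>, the small shapes number at
  most a constant times \<open>n powr (\<beta> * b)\<close> with exponent below 1, hence
  \<open>o(n / ln n)\<close>. The slack \<open>d\<close> is kept for the concentration
  argument.\<close>

lemma ex_size_threshold:
  assumes "0 < x" "x < 1" "\<And>h. shape_gf h x \<le> y" "c > 2 * ln (1 / x)"
  obtains k :: "nat \<Rightarrow> nat" and d where "d > 0" "eventually (\<lambda>n. real (card (shapes_upto (k n))) + rexp n (large_count (k n)) \<le> (c - d) * (real n / ln (real n))) sequentially"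
proof -
  define b where "b = ln (1 / x)"
  have b: "b > 0" using assms by (simp add: b_def)
  obtain e where e: "2 * b < e" "e < c" using dense[OF assms(4)] unfolding b_def by blast
  \<comment> \<open>Then \<open>2 / \<beta> = e\<close>, so the mean number of large subtrees is
    about \<open>e * n / ln n\<close>, while \<open>e > 2 * b\<close> means
    \<open>\<beta> * b < 1\<close>.\<close>
  define \<beta> where "\<beta> = 2 / e"
  have \<beta>: "\<beta> > 0" "\<beta> * b < 1" using e b by (simp_all add: \<beta>_def field_simps)
  define k where "k = (\<lambda>n. nat \<lfloor>\<beta> * ln (real n)\<rfloor>)"
  define d where "d = (c - e) / 2"
  have y: "y \<ge> 0" using assms(1) assms(3)[of 0] shape_gf_nonneg[of x 0] by simp
  define \<theta> where "\<theta> = \<beta> * b"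
  have "(\<lambda>n. real n powr \<theta> / (real n / ln (real n))) \<longlonglongrightarrow> 0"
    using \<beta> unfolding \<theta>_def[symmetric] by real_asymp
  from tendsto_mult_right_zero[OF this, of y]
  have 1: "(\<lambda>n. y * real n powr \<theta> / (real n / ln (real n))) \<longlonglongrightarrow> 0" by (simp add: mult_ac)
  have 2: "(\<lambda>n. (2 * real (n + 1) / (\<beta> * ln (real n))) / (real n / ln (real n))) \<longlonglongrightarrow> 2 / \<beta>"
    unfolding divide_inverse[of 2 \<beta>] using \<beta> by real_asymp
  have "(\<lambda>n. (y * real n powr \<theta> + 2 * real (n + 1) / (\<beta> * ln (real n))) / (real n / ln (real n))) \<longlonglongrightarrow> 0 + 2 / \<beta>"
    using tendsto_add[OF 1 2] by (simp only: add_divide_distrib)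
  moreover have "0 + 2 / \<beta> < c - d" using e b by (simp add: \<beta>_def d_def field_simps)
  ultimately have "eventually (\<lambda>n. (y * real n powr \<theta> + 2 * real (n + 1) / (\<beta> * ln (real n))) / (real n / ln (real n)) < c - d) sequentially"
    by (rule order_tendstoD(2))
  then have "eventually (\<lambda>n. real (card (shapes_upto (k n))) + rexp n (large_count (k n)) \<le> (c - d) * (real n / ln (real n))) sequentially"
    using eventually_gt_at_top[of 2]
  proof eventually_elim
    case (elim n)
    have n: "n > 2" "ln (real n) > 0" using elim by auto
    then have L: "real n / ln (real n) > 0" by simp
    have kle: "real (k n) \<le> \<beta> * ln (real n)" and kge: "real (k n) > \<beta> * ln (real n) - 1"
      unfolding k_def using n \<beta> by (auto simp: of_nat_floor)
    have "real (card (shapes_upto (k n))) \<le> y * (1 / x) ^ k n"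
      by (rule card_shapes_upto_le) (use assms in auto)
    also have "(1 / x) ^ k n = exp (b * real (k n))"
      using assms by (simp add: b_def exp_of_nat_mult mult.commute)
    also have "\<dots> \<le> exp (\<theta> * ln (real n))" using kle b unfolding \<theta>_def by (simp add: mult_ac)
    also have "\<dots> = real n powr \<theta>" using n by (simp add: powr_def)
    finally have A: "real (card (shapes_upto (k n))) \<le> y * real n powr \<theta>" using y by (simp add: mult_left_mono)
    have "rexp n (large_count (k n)) \<le> 2 * real (n + 1) / real (k n + 2)"
      unfolding rexp_large_count by auto
    also have "\<dots> \<le> 2 * real (n + 1) / (\<beta> * ln (real n))"
      using kge n \<beta> by (intro divide_left_mono) auto
    finally have "real (card (shapes_upto (k n))) + rexp n (large_count (k n)) \<le> y * real n powr \<theta> + 2 * real (n + 1) / (\<beta> * ln (real n))"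
      using A by linarith
    also have "\<dots> \<le> (c - d) * (real n / ln (real n))"
      using elim(1) unfolding pos_divide_less_eq[OF L] by simp
    finally show ?case .
  qed
  moreover have "d > 0" using e by (simp add: d_def)
  ultimately show ?thesis using that by blast
qed

lemma num_shapes_upper_bounds:
  assumes "0 < x" "x < 1" "\<And>h. shape_gf h x \<le> y" "c > 2 * ln (1 / x)"
  shows expectation_num_shapes_le:
      "eventually (\<lambda>n. rexp n (\<lambda>t. real (num_shapes t)) \<le> c * (real n / ln (real n))) sequentially"
    and prob_num_shapes_greater_tendsto:
      "(\<lambda>n. rexp n (\<lambda>t. of_bool (real (num_shapes t) > c * (real n / ln (real n))))) \<longlonglongrightarrow> 0"
proof -
  obtain k d where d: "d > 0" and ev: "eventually (\<lambda>n. real (card (shapes_upto (k n))) + rexp n (large_count (k n)) \<le> (c - d) * (real n / ln (real n))) sequentially"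
    using ex_size_threshold[OF assms] by blast
  show "eventually (\<lambda>n. rexp n (\<lambda>t. real (num_shapes t)) \<le> c * (real n / ln (real n))) sequentially"
    using ev eventually_gt_at_top[of 2]
  proof eventually_elim
    case (elim n)
    have "rexp n (\<lambda>t. real (num_shapes t)) \<le> rexp n (\<lambda>t. real (card (shapes_upto (k n))) + large_count (k n) t)"
      by (intro rexp_mono num_shapes_upper)
    also have "\<dots> = real (card (shapes_upto (k n))) + rexp n (large_count (k n))" by simp
    also have "\<dots> \<le> (c - d) * (real n / ln (real n))" by (rule elim)
    also have "\<dots> \<le> c * (real n / ln (real n))" using d elim(2) by (intro mult_right_mono) auto
    finally show ?case .
  qed
  define f where "f = (\<lambda>n. rexp n (\<lambda>t. of_bool (real (num_shapes t) > c * (real n / ln (real n)))))"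
  have "eventually (\<lambda>n. f n \<le> 4 * real (n + 1) / (d * (real n / ln (real n)))\<^sup>2) sequentially"
    using ev eventually_gt_at_top[of 2]
  proof eventually_elim
    case (elim n)
    define L where "L = real n / ln (real n)"
    have "L > 0" using elim(2) by (simp add: L_def)
    \<comment> \<open>The sign is changed so that the lower-tail inequality covers the upper tail of
      the count.\<close>
    let ?F = "\<lambda>t :: unit tree. - large_count (k n) t"
    define x where "x = rexp n (large_count (k n))"
    have "f n \<le> rexp n (\<lambda>t. of_bool (?F t < - x - d * L))"
      unfolding f_def
    proof (rule rexp_mono)
      fix t :: "unit tree"
      have "c * L < real (num_shapes t) \<Longrightarrow> ?F t < - x - d * L"
        using num_shapes_upper[of t "k n"] elim(1) unfolding x_def L_def[symmetric] left_diff_distrib by linarith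
      then show "of_bool (c * (real n / ln (real n)) < real (num_shapes t)) \<le> (of_bool (?F t < - x - d * L) :: real)"
        by (auto simp: L_def)
    qed
    also have "\<dots> \<le> rexp n (\<lambda>t. (?F t - (- x))\<^sup>2) / (- x - (- x - d * L))\<^sup>2"
      using d \<open>L > 0\<close> by (intro rexp_of_bool_Chebyshev) simp
    also have "rexp n (\<lambda>t. (?F t - (- x))\<^sup>2) = rexp n (\<lambda>t. (large_count (k n) t - x)\<^sup>2)"
      by (intro rexp_cong) (simp add: power2_commute)
    also have "\<dots> / (- x - (- x - d * L))\<^sup>2 \<le> 4 * real (n + 1) / (- x - (- x - d * L))\<^sup>2"
      unfolding x_def by (intro divide_right_mono rexp_large_count_variance) auto
    finally show ?case by (simp add: L_def)
  qed
  moreover have "(\<lambda>n. 4 * real (n + 1) / (d * (real n / ln (real n)))\<^sup>2) \<longlonglongrightarrow> 0"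
    using d by real_asymp
  moreover have nn: "eventually (\<lambda>n. 0 \<le> f n) sequentially"
    unfolding f_def by (intro always_eventually allI integral_nonneg_AE AE_pmfI) simp
  ultimately show "f \<longlonglongrightarrow> 0" by (intro tendsto_sandwich[OF nn _ tendsto_const])
qed

subsection \<open>Numerical value of the entropy rate\<close>

text \<open>The sum of \<open>p ^ m\<close> over the probabilities \<open>p\<close> of all shapes of
  size \<open>n\<close>; one factor \<open>p\<close> is supplied by the expectation. For
  \<open>m = 2\<close> it is the probability that two independent trees have the same shape.\<close>

definition shape_moment :: "nat \<Rightarrow> nat \<Rightarrow> real" where
  "shape_moment m n = rexp n (\<lambda>t. shape_prob t ^ (m - 1))"

lemma shape_moment_0 [simp]: "shape_moment m 0 = 1"
  by (simp add: shape_moment_def)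

text \<open>On the event that the shapes agree, the powers combine to \<open>p ^ (2 * m)\<close>,
  and the event itself contributes one more factor \<open>p\<close>.\<close>

lemma rexp_moment_canon_eq:
  "rexp i (\<lambda>l. rexp j (\<lambda>r. of_bool (canon l = canon r) * (shape_prob l ^ m * shape_prob r ^ m))) =
   (if i = j then shape_moment (2 * Suc m) i else 0)"
proof -
  have "rexp j (\<lambda>r. of_bool (canon l = canon r) * (shape_prob l ^ m * shape_prob r ^ m)) =
     (if i = j then shape_prob l ^ (2 * m + 1) else 0)" if l: "size l = i" for l :: "unit tree"
  proof -
    have "rexp j (\<lambda>r. of_bool (canon l = canon r) * (shape_prob l ^ m * shape_prob r ^ m)) =
        rexp j (\<lambda>r. shape_prob l ^ (2 * m) * of_bool (canon r = canon l))"
    proof (rule rexp_cong)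
      fix r :: "unit tree"
      show "of_bool (canon l = canon r) * (shape_prob l ^ m * shape_prob r ^ m) =
          shape_prob l ^ (2 * m) * (of_bool (canon r = canon l) :: real)"
      proof (cases "canon l = canon r")
        case True
        then show ?thesis using canon_eq_imp_shape_prob_eq[OF True]
          by (simp add: mult_2 power_add)
      qed auto
    qed
    also have "\<dots> = shape_prob l ^ (2 * m) * rexp j (\<lambda>r. of_bool (canon r = canon l))" by simp
    also have "\<dots> = (if i = j then shape_prob l ^ (2 * m + 1) else 0)"
    proof (cases "i = j")
      case True
      then show ?thesis using rexp_canon_eq[of l] l by (simp add: power_add mult.commute)
    next
      case False
      have "rexp j (\<lambda>r. of_bool (canon r = canon l)) = 0"
        by (subst rexp_canon_eq_size) (use False l in simp)
      then show ?thesis using False by simp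
    qed
    finally show ?thesis .
  qed
  then have "rexp i (\<lambda>l. rexp j (\<lambda>r. of_bool (canon l = canon r) * (shape_prob l ^ m * shape_prob r ^ m))) =
     rexp i (\<lambda>l. if i = j then shape_prob l ^ (2 * m + 1) else 0)"
    by (rule rexp_cong)
  then show ?thesis by (simp add: shape_moment_def)
qed

lemma sum_half:
  fixes g :: "nat \<Rightarrow> real"
  shows "(\<Sum>i\<le>n. if i = n - i then g i else 0) = (if even n then g (n div 2) else 0)"
proof -
  have "(\<Sum>i\<le>n. if i = n - i then g i else 0) = (\<Sum>i\<le>n. if i = n div 2 then (if even n then g (n div 2) else 0) else 0)"
    by (intro sum.cong) (auto elim!: evenE oddE)
  then show ?thesis by simp
qed

text \<open>The factor 1 or 2 in \<open>shape_prob\<close>, raised to the power \<open>m\<close>, is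
  \<open>2 ^ m\<close> minus \<open>2 ^ m - 1\<close> in the symmetric case. The correction needs
  equal sizes, so it survives only for even \<open>n\<close>.\<close>

lemma shape_moment_Suc:
  "shape_moment (Suc m) (Suc n) = (2 ^ m * (\<Sum>i\<le>n. shape_moment (Suc m) i * shape_moment (Suc m) (n - i))
     - (2 ^ m - 1) * (if even n then shape_moment (2 * Suc m) (n div 2) else 0)) / real (Suc n) ^ Suc m"
proof -
  define a where "a = 1 / real (Suc n) ^ m"
  have "rexp i (\<lambda>l. rexp (n - i) (\<lambda>r. shape_prob \<langle>l, (), r\<rangle> ^ m)) =
      a * (2 ^ m * (shape_moment (Suc m) i * shape_moment (Suc m) (n - i)) -
        (2 ^ m - 1) * (if i = n - i then shape_moment (2 * Suc m) i else 0))" if "i \<le> n" for i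
  proof -
    have "rexp i (\<lambda>l. rexp (n - i) (\<lambda>r. shape_prob \<langle>l, (), r\<rangle> ^ m)) =
      rexp i (\<lambda>l. rexp (n - i) (\<lambda>r. a * (2 ^ m * (shape_prob l ^ m * shape_prob r ^ m) -
         (2 ^ m - 1) * (of_bool (canon l = canon r) * (shape_prob l ^ m * shape_prob r ^ m)))))"
    proof (intro rexp_cong)
      fix l r :: "unit tree" assume "size l = i" "size r = n - i"
      then have "shape_prob \<langle>l, (), r\<rangle> ^ m = a * (if canon l = canon r then 1 else 2) ^ m * (shape_prob l ^ m * shape_prob r ^ m)"
        using that by (simp add: a_def power_mult_distrib power_divide)
      then show "shape_prob \<langle>l, (), r\<rangle> ^ m = a * (2 ^ m * (shape_prob l ^ m * shape_prob r ^ m) -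
         (2 ^ m - 1) * (of_bool (canon l = canon r) * (shape_prob l ^ m * shape_prob r ^ m)))"
        by (auto simp: algebra_simps)
    qed
    also have "\<dots> = a * (2 ^ m * (shape_moment (Suc m) i * shape_moment (Suc m) (n - i)) -
        (2 ^ m - 1) * rexp i (\<lambda>l. rexp (n - i) (\<lambda>r. of_bool (canon l = canon r) * (shape_prob l ^ m * shape_prob r ^ m))))"
      by (simp add: shape_moment_def)
    finally show ?thesis unfolding rexp_moment_canon_eq .
  qed
  then have "shape_moment (Suc m) (Suc n) = (\<Sum>i\<le>n. a * (2 ^ m * (shape_moment (Suc m) i * shape_moment (Suc m) (n - i)) -
        (2 ^ m - 1) * (if i = n - i then shape_moment (2 * Suc m) i else 0))) / real (Suc n)"
    unfolding shape_moment_def rexp_Suc by simp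
  also have "\<dots> = a * (2 ^ m * (\<Sum>i\<le>n. shape_moment (Suc m) i * shape_moment (Suc m) (n - i)) -
        (2 ^ m - 1) * (\<Sum>i\<le>n. if i = n - i then shape_moment (2 * Suc m) i else 0)) / real (Suc n)"
    by (simp only: sum_subtractf sum_distrib_left[symmetric])
  finally show ?thesis unfolding sum_half by (simp add: a_def)
qed

text \<open>The same recurrence at \<open>n\<close> instead of \<open>Suc n\<close>, a form in which
  the simplifier can evaluate it at numerals.\<close>

lemma shape_moment_rec:
  assumes "m > 0" "n > 0"
  shows "shape_moment m n = (2 ^ (m - 1) * (\<Sum>i<n. shape_moment m i * shape_moment m (n - 1 - i))
     - (2 ^ (m - 1) - 1) * (if odd n then shape_moment (2 * m) (n div 2) else 0)) / real n ^ m"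
proof -
  obtain m' n' where mn: "m = Suc m'" "n = Suc n'" using assms by (metis gr0_implies_Suc)
  have "even n' \<Longrightarrow> Suc n' div 2 = n' div 2" by (auto elim: evenE)
  then show ?thesis unfolding mn by (simp add: shape_moment_Suc lessThan_Suc_atMost del: mult_Suc_right)
qed

lemma sym_prob_odd: "sym_prob (Suc (2 * j)) = shape_moment 2 j / real (Suc (2 * j))"
proof -
  have "sym_prob (Suc (2 * j)) = (\<Sum>i\<le>2 * j. rexp i (\<lambda>l. rexp (2 * j - i) (\<lambda>r. of_bool (canon l = canon r) * (shape_prob l ^ 0 * shape_prob r ^ 0)))) / real (Suc (2 * j))"
    unfolding sym_prob_def rexp_Suc by simp
  also have "\<dots> = shape_moment 2 j / real (Suc (2 * j))"
  proof -
    have "2 * Suc 0 = (2 :: nat)" by simp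
    then show ?thesis unfolding rexp_moment_canon_eq sum_half by simp
  qed
  finally show ?thesis .
qed

lemma sym_prob_nonneg: "sym_prob n \<ge> 0"
  unfolding sym_prob_def by (rule rexp_nonneg) simp

text \<open>Only the odd sizes \<open>2 * j + 1\<close> with \<open>j < J\<close> are kept; all
  other terms are nonnegative.\<close>

lemma sum_sym_prob_ge:
  assumes "2 * J \<le> K"
  shows "(\<Sum>k=1..K. 2 * sym_prob k / (real (k + 1) * real (k + 2))) \<ge>
    (\<Sum>j<J. 2 * shape_moment 2 j / (real (2 * j + 1) * real (2 * j + 2) * real (2 * j + 3)))"
proof -
  have "(\<Sum>j<J. 2 * shape_moment 2 j / (real (2 * j + 1) * real (2 * j + 2) * real (2 * j + 3))) =
     (\<Sum>j<J. 2 * sym_prob (Suc (2 * j)) / (real (Suc (2 * j) + 1) * real (Suc (2 * j) + 2)))"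
    by (intro sum.cong refl) (simp add: sym_prob_odd add_ac mult.assoc)
  also have "\<dots> = (\<Sum>k\<in>(\<lambda>j. Suc (2 * j)) ` {..<J}. 2 * sym_prob k / (real (k + 1) * real (k + 2)))"
    by (subst sum.reindex) (auto simp: inj_on_def)
  also have "\<dots> \<le> (\<Sum>k=1..K. 2 * sym_prob k / (real (k + 1) * real (k + 2)))"
    using assms sym_prob_nonneg by (intro sum_mono2) auto
  finally show ?thesis .
qed

text \<open>The value for \<open>m\<close> at an odd size \<open>n\<close> uses the value for
  \<open>2 * m\<close> at \<open>n div 2\<close>. Reaching size 26 for \<open>m = 2\<close> thus
  takes sizes up to 12, 5 and 2 for \<open>m = 4\<close>, 8 and 16; for \<open>m = 32\<close> only
  size 0 occurs.\<close>

lemma shape_moment_16: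
  "shape_moment 16 (Suc 0) = 1"
  "shape_moment 16 2 = 1"
proof -
  show [simp]: "shape_moment 16 (Suc 0) = 1"
    by (simp add: shape_moment_rec[of 16 "Suc 0"] lessThan_nat_numeral)
  show [simp]: "shape_moment 16 2 = 1"
    by (simp add: shape_moment_rec[of 16 2] lessThan_nat_numeral)
qed

lemma shape_moment_8:
  "shape_moment 8 (Suc 0) = 1"
  "shape_moment 8 2 = 1"
  "shape_moment 8 3 = 257 / 6561"
  "shape_moment 8 4 = 3409 / 839808"
  "shape_moment 8 5 = 79171 / 2562890625"
proof -
  show [simp]: "shape_moment 8 (Suc 0) = 1"
    by (simp add: shape_moment_rec[of 8 "Suc 0"] lessThan_nat_numeral shape_moment_16)
  show [simp]: "shape_moment 8 2 = 1"
    by (simp add: shape_moment_rec[of 8 2] lessThan_nat_numeral shape_moment_16)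
  show [simp]: "shape_moment 8 3 = 257 / 6561"
    by (simp add: shape_moment_rec[of 8 3] lessThan_nat_numeral shape_moment_16)
  show [simp]: "shape_moment 8 4 = 3409 / 839808"
    by (simp add: shape_moment_rec[of 8 4] lessThan_nat_numeral shape_moment_16)
  show [simp]: "shape_moment 8 5 = 79171 / 2562890625"
    by (simp add: shape_moment_rec[of 8 5] lessThan_nat_numeral shape_moment_16)
qed

lemma shape_moment_4:
  "shape_moment 4 (Suc 0) = 1"
  "shape_moment 4 2 = 1"
  "shape_moment 4 3 = 17 / 81"
  "shape_moment 4 4 = 49 / 648"
  "shape_moment 4 5 = 451 / 50625"
  "shape_moment 4 6 = 119233 / 32805000"
  "shape_moment 4 7 = 6104837 / 9845600625"
  "shape_moment 4 8 = 1143412601 / 10081895040000"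
  "shape_moment 4 9 = 147615946267 / 8268414169680000"
  "shape_moment 4 10 = 28943247288061 / 8268414169680000000"
  "shape_moment 4 11 = 1671125889268391 / 2702184193265287500000"
  "shape_moment 4 12 = 37842954819014056009 / 392227440020843011200000000"
proof -
  show [simp]: "shape_moment 4 (Suc 0) = 1"
    by (simp add: shape_moment_rec[of 4 "Suc 0"] lessThan_nat_numeral shape_moment_8)
  show [simp]: "shape_moment 4 2 = 1"
    by (simp add: shape_moment_rec[of 4 2] lessThan_nat_numeral shape_moment_8)
  show [simp]: "shape_moment 4 3 = 17 / 81"
    by (simp add: shape_moment_rec[of 4 3] lessThan_nat_numeral shape_moment_8)
  show [simp]: "shape_moment 4 4 = 49 / 648"
    by (simp add: shape_moment_rec[of 4 4] lessThan_nat_numeral shape_moment_8)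
  show [simp]: "shape_moment 4 5 = 451 / 50625"
    by (simp add: shape_moment_rec[of 4 5] lessThan_nat_numeral shape_moment_8)
  show [simp]: "shape_moment 4 6 = 119233 / 32805000"
    by (simp add: shape_moment_rec[of 4 6] lessThan_nat_numeral shape_moment_8)
  show [simp]: "shape_moment 4 7 = 6104837 / 9845600625"
    by (simp add: shape_moment_rec[of 4 7] lessThan_nat_numeral shape_moment_8)
  show [simp]: "shape_moment 4 8 = 1143412601 / 10081895040000"
    by (simp add: shape_moment_rec[of 4 8] lessThan_nat_numeral shape_moment_8)
  show [simp]: "shape_moment 4 9 = 147615946267 / 8268414169680000"
    by (simp add: shape_moment_rec[of 4 9] lessThan_nat_numeral shape_moment_8)
  show [simp]: "shape_moment 4 10 = 28943247288061 / 8268414169680000000"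
    by (simp add: shape_moment_rec[of 4 10] lessThan_nat_numeral shape_moment_8)
  show [simp]: "shape_moment 4 11 = 1671125889268391 / 2702184193265287500000"
    by (simp add: shape_moment_rec[of 4 11] lessThan_nat_numeral shape_moment_8)
  show [simp]: "shape_moment 4 12 = 37842954819014056009 / 392227440020843011200000000"
    by (simp add: shape_moment_rec[of 4 12] lessThan_nat_numeral shape_moment_8)
qed

lemma shape_moment_2:
  "shape_moment 2 (Suc 0) = 1"
  "shape_moment 2 2 = 1"
  "shape_moment 2 3 = 5 / 9"
  "shape_moment 2 4 = 7 / 18"
  "shape_moment 2 5 = 43 / 225"
  "shape_moment 2 6 = 511 / 4050"
  "shape_moment 2 7 = 187 / 2835"
  "shape_moment 2 8 = 1699 / 45360"
  "shape_moment 2 9 = 178027 / 9185400"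
  "shape_moment 2 10 = 981793 / 91854000"
  "shape_moment 2 11 = 5552999 / 992351250"
  "shape_moment 2 12 = 421707169 / 142898580000"
  "shape_moment 2 13 = 21414969001 / 14087418345000"
  "shape_moment 2 14 = 6596829857777 / 8283401986860000"
  "shape_moment 2 15 = 333167267256547 / 815397383081531250"
  "shape_moment 2 16 = 88059975556083961 / 417483460137744000000"
  "shape_moment 2 17 = 4329399721292974457 / 40217573326602672000000"
  "shape_moment 2 18 = 19225990225807239773 / 349031082798730332000000"
  "shape_moment 2 19 = 12343380507012841718767 / 441000773116195774482000000"
  "shape_moment 2 20 = 96492354572612351037731 / 6784627278710704222800000000"
  "shape_moment 2 21 = 4305304151430624896445613 / 598404125982284112450960000000"
  "shape_moment 2 22 = 34245400365698823964794457883 / 9412896901701329088853600800000000"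
  "shape_moment 2 23 = 47555070954613115683844524157 / 25934491984375016083351848037500000"
  "shape_moment 2 24 = 331074002946976689273492037599473 / 358518417192000222336255947270400000000"
  "shape_moment 2 25 = 675056875029117876782081979124583 / 1455026043798702201039999786000000000000"
  "shape_moment 2 26 = 8075123246864397349298403774280021 / 34678120710535735791453328233000000000000"
proof -
  show [simp]: "shape_moment 2 (Suc 0) = 1"
    by (simp add: shape_moment_rec[of 2 "Suc 0"] lessThan_nat_numeral shape_moment_4)
  show [simp]: "shape_moment 2 2 = 1"
    by (simp add: shape_moment_rec[of 2 2] lessThan_nat_numeral shape_moment_4)
  show [simp]: "shape_moment 2 3 = 5 / 9"
    by (simp add: shape_moment_rec[of 2 3] lessThan_nat_numeral shape_moment_4)
  show [simp]: "shape_moment 2 4 = 7 / 18"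
    by (simp add: shape_moment_rec[of 2 4] lessThan_nat_numeral shape_moment_4)
  show [simp]: "shape_moment 2 5 = 43 / 225"
    by (simp add: shape_moment_rec[of 2 5] lessThan_nat_numeral shape_moment_4)
  show [simp]: "shape_moment 2 6 = 511 / 4050"
    by (simp add: shape_moment_rec[of 2 6] lessThan_nat_numeral shape_moment_4)
  show [simp]: "shape_moment 2 7 = 187 / 2835"
    by (simp add: shape_moment_rec[of 2 7] lessThan_nat_numeral shape_moment_4)
  show [simp]: "shape_moment 2 8 = 1699 / 45360"
    by (simp add: shape_moment_rec[of 2 8] lessThan_nat_numeral shape_moment_4)
  show [simp]: "shape_moment 2 9 = 178027 / 9185400"
    by (simp add: shape_moment_rec[of 2 9] lessThan_nat_numeral shape_moment_4)
  show [simp]: "shape_moment 2 10 = 981793 / 91854000"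
    by (simp add: shape_moment_rec[of 2 10] lessThan_nat_numeral shape_moment_4)
  show [simp]: "shape_moment 2 11 = 5552999 / 992351250"
    by (simp add: shape_moment_rec[of 2 11] lessThan_nat_numeral shape_moment_4)
  show [simp]: "shape_moment 2 12 = 421707169 / 142898580000"
    by (simp add: shape_moment_rec[of 2 12] lessThan_nat_numeral shape_moment_4)
  show [simp]: "shape_moment 2 13 = 21414969001 / 14087418345000"
    by (simp add: shape_moment_rec[of 2 13] lessThan_nat_numeral shape_moment_4)
  show [simp]: "shape_moment 2 14 = 6596829857777 / 8283401986860000"
    by (simp add: shape_moment_rec[of 2 14] lessThan_nat_numeral shape_moment_4)
  show [simp]: "shape_moment 2 15 = 333167267256547 / 815397383081531250"
    by (simp add: shape_moment_rec[of 2 15] lessThan_nat_numeral shape_moment_4)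
  show [simp]: "shape_moment 2 16 = 88059975556083961 / 417483460137744000000"
    by (simp add: shape_moment_rec[of 2 16] lessThan_nat_numeral shape_moment_4)
  show [simp]: "shape_moment 2 17 = 4329399721292974457 / 40217573326602672000000"
    by (simp add: shape_moment_rec[of 2 17] lessThan_nat_numeral shape_moment_4)
  show [simp]: "shape_moment 2 18 = 19225990225807239773 / 349031082798730332000000"
    by (simp add: shape_moment_rec[of 2 18] lessThan_nat_numeral shape_moment_4)
  show [simp]: "shape_moment 2 19 = 12343380507012841718767 / 441000773116195774482000000"
    by (simp add: shape_moment_rec[of 2 19] lessThan_nat_numeral shape_moment_4)
  show [simp]: "shape_moment 2 20 = 96492354572612351037731 / 6784627278710704222800000000"
    by (simp add: shape_moment_rec[of 2 20] lessThan_nat_numeral shape_moment_4)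
  show [simp]: "shape_moment 2 21 = 4305304151430624896445613 / 598404125982284112450960000000"
    by (simp add: shape_moment_rec[of 2 21] lessThan_nat_numeral shape_moment_4)
  show [simp]: "shape_moment 2 22 = 34245400365698823964794457883 / 9412896901701329088853600800000000"
    by (simp add: shape_moment_rec[of 2 22] lessThan_nat_numeral shape_moment_4)
  show [simp]: "shape_moment 2 23 = 47555070954613115683844524157 / 25934491984375016083351848037500000"
    by (simp add: shape_moment_rec[of 2 23] lessThan_nat_numeral shape_moment_4)
  show [simp]: "shape_moment 2 24 = 331074002946976689273492037599473 / 358518417192000222336255947270400000000"
    by (simp add: shape_moment_rec[of 2 24] lessThan_nat_numeral shape_moment_4)
  show [simp]: "shape_moment 2 25 = 675056875029117876782081979124583 / 1455026043798702201039999786000000000000"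
    by (simp add: shape_moment_rec[of 2 25] lessThan_nat_numeral shape_moment_4)
  show [simp]: "shape_moment 2 26 = 8075123246864397349298403774280021 / 34678120710535735791453328233000000000000"
    by (simp add: shape_moment_rec[of 2 26] lessThan_nat_numeral shape_moment_4)
qed
lemma sum_shape_moment_ge:
  "(\<Sum>j<27. 2 * shape_moment 2 j / (real (2 * j + 1) * real (2 * j + 2) * real (2 * j + 3))) \<ge> 37954934726403 / 10 ^ 14"
  by (simp add: lessThan_nat_numeral shape_moment_2)

text \<open>Scaled by \<open>10 ^ 15\<close>, truncated division turns every summand into an integer lower bound.\<close>

definition ln_term :: "nat \<Rightarrow> nat" where
  "ln_term m = (\<Sum>k<5 + 8 div m. 2 * 10 ^ 15 div ((2 * k + 1) * (2 * m + 1) ^ (2 * k + 1))) div (m + 2)"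

lemma sum_ln_term: "(\<Sum>m<20. ln_term (m + 1)) = 555792478292476"
proof -
  have [simp]: "{..<1 :: nat} = {0}" by auto
  show ?thesis
    by (simp add: ln_term_def lessThan_nat_numeral del: One_nat_def flip: numeral_3_eq_3)
qed

text \<open>The logarithm is \<open>2 * artanh (1 / (2 * m + 1))\<close>; partial sums of its power
  series are lower bounds because all terms are positive.\<close>

lemma ln_Suc_ratio_ge:
  assumes "m \<ge> 1"
  shows "(\<Sum>k<n. 2 * (1 / real (2 * m + 1)) ^ (2 * k + 1) / real (2 * k + 1)) \<le> ln (1 + 1 / real m)"
proof -
  have "((1 + 1 / real m) - 1) / ((1 + 1 / real m) + 1) = 1 / real (2 * m + 1)"
    using assms by (simp add: field_simps)
  then show ?thesis using ln_approx_bounds[of "1 + 1 / real m" n] assms by simp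
qed

lemma ln_term_le:
  assumes "m \<ge> 1"
  shows "real (ln_term m) / 10 ^ 15 \<le> ln (1 + 1 / real m) / real (m + 2)"
proof -
  \<comment> \<open>The series runs in powers of \<open>1 / (2 * m + 1)^2\<close>, so larger
    \<open>m\<close> need fewer terms.\<close>
  define n where "n = 5 + 8 div m"
  define y where "y = 1 / real (2 * m + 1)"
  define S where "S = (\<Sum>k<n. 2 * 10 ^ 15 div ((2 * k + 1) * (2 * m + 1) ^ (2 * k + 1)))"
  have "real S \<le> (\<Sum>k<n. 10 ^ 15 * (2 * y ^ (2 * k + 1) / real (2 * k + 1)))"
    unfolding S_def of_nat_sum
  proof (rule sum_mono)
    fix k
    have "real (2 * 10 ^ 15 div ((2 * k + 1) * (2 * m + 1) ^ (2 * k + 1))) \<le>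
        real (2 * 10 ^ 15) / real ((2 * k + 1) * (2 * m + 1) ^ (2 * k + 1))"
      by (rule of_nat_div_le_of_nat)
    also have "\<dots> = 10 ^ 15 * (2 * y ^ (2 * k + 1) / real (2 * k + 1))"
      unfolding y_def power_one_over of_nat_mult of_nat_power by (simp add: mult.commute)
    finally show "real (2 * 10 ^ 15 div ((2 * k + 1) * (2 * m + 1) ^ (2 * k + 1))) \<le> 10 ^ 15 * (2 * y ^ (2 * k + 1) / real (2 * k + 1))" .
  qed
  also have "\<dots> \<le> 10 ^ 15 * ln (1 + 1 / real m)"
    unfolding sum_distrib_left[symmetric] y_def by (intro mult_left_mono ln_Suc_ratio_ge assms) auto
  finally have le: "real S \<le> 10 ^ 15 * ln (1 + 1 / real m)" .
  have "real (ln_term m) \<le> real S / real (m + 2)"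
    unfolding ln_term_def S_def n_def by (rule of_nat_div_le_of_nat)
  also have "\<dots> \<le> 10 ^ 15 * ln (1 + 1 / real m) / real (m + 2)"
    by (rule divide_right_mono[OF le]) simp
  finally show ?thesis by (simp add: field_simps)
qed

text \<open>The first terms of the Euler-Maclaurin expansion of the tail of the series, in powers of
  \<open>s = m + 3 / 4\<close>; this shift removes the term of order \<open>1 / s ^ 2\<close>.\<close>

definition tail_approx :: "real \<Rightarrow> real" where
  "tail_approx s = 1 / s + 19 / (144 * s ^ 3) + 1 / (32 * s ^ 4) + 1429 / (57600 * s ^ 5) + 59 / (3840 * s ^ 6)"

text \<open>Denominators are cleared with independent variables, before linear forms in
  \<open>m\<close> are substituted for them; this keeps the algebra small.\<close>

lemma tail_approx_diff_eq:
  fixes A B C s :: real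
  assumes nz: "A > 0" "B > 0" "C > 0" "s > 0"
  shows "(4 / A + 16 / (3 * A ^ 3) + 64 / (5 * A ^ 5)) * (4 / B) - (tail_approx s - tail_approx C) =
   (s ^ 6 * C ^ 6 * (921600 * A ^ 4 + 1228800 * A ^ 2 + 2949120) -
    (57600 * (C ^ 6 * s ^ 5 - s ^ 6 * C ^ 5) + 7600 * (C ^ 6 * s ^ 3 - s ^ 6 * C ^ 3) +
     1800 * (C ^ 6 * s ^ 2 - s ^ 6 * C ^ 2) + 1429 * (C ^ 6 * s - s ^ 6 * C) + 885 * (C ^ 6 - s ^ 6)) *
    (A ^ 5 * B)) / (57600 * s ^ 6 * C ^ 6 * A ^ 5 * B)"
proof -
  define N where "N = 57600 * (C ^ 6 * s ^ 5 - s ^ 6 * C ^ 5) + 7600 * (C ^ 6 * s ^ 3 - s ^ 6 * C ^ 3) +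
    1800 * (C ^ 6 * s ^ 2 - s ^ 6 * C ^ 2) + 1429 * (C ^ 6 * s - s ^ 6 * C) + 885 * (C ^ 6 - s ^ 6)"
  have "(4 / A + 16 / (3 * A ^ 3) + 64 / (5 * A ^ 5)) * (4 / B) =
      (921600 * A ^ 4 + 1228800 * A ^ 2 + 2949120) / (57600 * A ^ 5 * B)"
    using nz by (simp add: divide_simps) algebra
  also have "\<dots> = s ^ 6 * C ^ 6 * (921600 * A ^ 4 + 1228800 * A ^ 2 + 2949120) / (57600 * s ^ 6 * C ^ 6 * A ^ 5 * B)"
    using nz by simp
  finally have 1: "(4 / A + 16 / (3 * A ^ 3) + 64 / (5 * A ^ 5)) * (4 / B) = \<dots>" .
  have "tail_approx s = (57600 * s ^ 5 + 7600 * s ^ 3 + 1800 * s ^ 2 + 1429 * s + 885) / (57600 * s ^ 6)"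
    if "s > 0" for s :: real
    unfolding tail_approx_def using that by (simp add: divide_simps) algebra
  note 3 = this[OF nz(4)] this[OF nz(3)]
  have "tail_approx s - tail_approx C = N / (57600 * s ^ 6 * C ^ 6)"
    unfolding N_def 3 using nz by (simp add: divide_simps) algebra
  also have "\<dots> = N * (A ^ 5 * B) / (57600 * s ^ 6 * C ^ 6 * A ^ 5 * B)"
    using nz by simp
  finally show ?thesis unfolding 1 N_def by (simp only: diff_divide_distrib)
qed

text \<open>The telescoping estimate for the tail of the series. The logarithm is replaced by three
  terms of its series, which leaves a rational inequality in one variable.\<close>

lemma tail_approx_diff_le:
  assumes "m \<ge> 1"
  shows "tail_approx (real m + 3 / 4) - tail_approx (real m + 7 / 4) \<le> ln (1 + 1 / real m) / real (m + 2)"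
proof -
  \<comment> \<open>In terms of \<open>t\<close>, the arguments are \<open>t + 1\<close> and
    \<open>t + 2\<close>, \<open>2 * m + 1\<close> is \<open>(4 * t + 3) / 2\<close>, and
    \<open>m + 2\<close> is \<open>(4 * t + 9) / 4\<close>.\<close>
  define t where "t = real m - 1 / 4"
  have t: "t \<ge> 0" using assms by (simp add: t_def)
  let ?A = "4 * t + 3" and ?B = "4 * t + 9"
  have "1 / real (2 * m + 1) = 2 / ?A" by (simp add: t_def field_simps)
  then have "2 * (2 / ?A) + 2 * (2 / ?A) ^ 3 / 3 + 2 * (2 / ?A) ^ 5 / 5 \<le> ln (1 + 1 / real m)"
  proof -
    have "(\<Sum>k<3. 2 * y ^ (2 * k + 1) / real (2 * k + 1)) = 2 * y + 2 * y ^ 3 / 3 + 2 * y ^ 5 / 5" for y :: real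
      by (simp add: lessThan_Suc eval_nat_numeral)
    then show ?thesis using ln_Suc_ratio_ge[OF assms, of 3] \<open>1 / real (2 * m + 1) = 2 / ?A\<close> by metis
  qed
  then have "4 / ?A + 16 / (3 * ?A ^ 3) + 64 / (5 * ?A ^ 5) \<le> ln (1 + 1 / real m)"
    by (simp add: power_divide)
  then have "(4 / ?A + 16 / (3 * ?A ^ 3) + 64 / (5 * ?A ^ 5)) * (4 / ?B) \<le> ln (1 + 1 / real m) * (4 / ?B)"
    using t by (intro mult_right_mono) auto
  also have "\<dots> = ln (1 + 1 / real m) / real (m + 2)"
  proof -
    have "4 / ?B = 1 / real (m + 2)" by (simp add: t_def field_simps)
    then show ?thesis by simp
  qed
  finally have le: "(4 / ?A + 16 / (3 * ?A ^ 3) + 64 / (5 * ?A ^ 5)) * (4 / ?B) \<le> ln (1 + 1 / real m) / real (m + 2)" .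
  \<comment> \<open>The numerator of the difference; all its coefficients are positive, so it is
    nonnegative for \<open>t \<ge> 0\<close>.\<close>
  let ?P = "160345269 + 1338548805 * t + 4985914413 * t ^ 2 + 10920886317 * t ^ 3 + 15594693975 * t ^ 4 +
    15190921947 * t ^ 5 + 10237965965 * t ^ 6 + 4719885264 * t ^ 7 + 1425745056 * t ^ 8 + 254883840 * t ^ 9 +
    20465920 * t ^ 10"
  have "(t + 1) ^ 6 * (t + 2) ^ 6 * (921600 * ?A ^ 4 + 1228800 * ?A ^ 2 + 2949120) -
    (57600 * ((t + 2) ^ 6 * (t + 1) ^ 5 - (t + 1) ^ 6 * (t + 2) ^ 5) + 7600 * ((t + 2) ^ 6 * (t + 1) ^ 3 - (t + 1) ^ 6 * (t + 2) ^ 3) +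
     1800 * ((t + 2) ^ 6 * (t + 1) ^ 2 - (t + 1) ^ 6 * (t + 2) ^ 2) + 1429 * ((t + 2) ^ 6 * (t + 1) - (t + 1) ^ 6 * (t + 2)) +
     885 * ((t + 2) ^ 6 - (t + 1) ^ 6)) * (?A ^ 5 * ?B) = ?P"
    by algebra
  then have "(4 / ?A + 16 / (3 * ?A ^ 3) + 64 / (5 * ?A ^ 5)) * (4 / ?B) - (tail_approx (t + 1) - tail_approx (t + 2)) =
      ?P / (57600 * (t + 1) ^ 6 * (t + 2) ^ 6 * ?A ^ 5 * ?B)"
    using t by (subst tail_approx_diff_eq) simp_all
  moreover have "\<dots> \<ge> 0" using t by (intro divide_nonneg_nonneg add_nonneg_nonneg mult_nonneg_nonneg) auto
  ultimately have "tail_approx (t + 1) - tail_approx (t + 2) \<le> ln (1 + 1 / real m) / real (m + 2)"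
    using le by linarith
  moreover have "t + 1 = real m + 3 / 4" "t + 2 = real m + 7 / 4" by (simp_all add: t_def)
  ultimately show ?thesis by (simp only:)
qed

text \<open>The first 20 terms are evaluated numerically and the others telescope;
  \<open>87 / 4\<close> is \<open>20 + 7 / 4\<close>.\<close>

lemma sum_ln_ratio_ge:
  assumes "K \<ge> 20"
  shows "(\<Sum>m=1..K. ln (1 + 1 / real m) / real (m + 2)) \<ge>
    555792478292476 / 10 ^ 15 + tail_approx (87 / 4) - tail_approx (real K + 7 / 4)"
  using assms
proof (induction K rule: dec_induct)
  case base
  have "(\<Sum>m=1..20. ln (1 + 1 / real m) / real (m + 2)) = (\<Sum>m<20. ln (1 + 1 / real (m + 1)) / real (m + 1 + 2))"
    by (rule sum.reindex_bij_witness[of _ "\<lambda>m. m + 1" "\<lambda>m. m - 1"]) auto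
  also have "\<dots> \<ge> (\<Sum>m<20. real (ln_term (m + 1)) / 10 ^ 15)"
    by (intro sum_mono ln_term_le) simp
  also have "(\<Sum>m<20. real (ln_term (m + 1)) / 10 ^ 15) = real (\<Sum>m<20. ln_term (m + 1)) / 10 ^ 15"
    by (simp only: sum_divide_distrib of_nat_sum)
  finally show ?case unfolding sum_ln_term by simp
next
  case (step K)
  have "tail_approx (real K + 7 / 4) - tail_approx (real K + 11 / 4) \<le> ln (1 + 1 / real (Suc K)) / real (Suc K + 2)"
    using tail_approx_diff_le[of "Suc K"] by (simp add: add_ac)
  moreover have "(\<Sum>m=1..Suc K. ln (1 + 1 / real m) / real (m + 2)) =
      (\<Sum>m=1..K. ln (1 + 1 / real m) / real (m + 2)) + ln (1 + 1 / real (Suc K)) / real (Suc K + 2)"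
    by simp
  moreover have "tail_approx (real (Suc K) + 7 / 4) = tail_approx (real K + 11 / 4)" by (simp add: add_ac)
  ultimately show ?case using step.IH by linarith
qed

lemma ln_2_upper: "ln (2 :: real) \<le> 69314718056 / 10 ^ 11"
  using ln_approx_bounds[of 2 13] by (simp add: lessThan_nat_numeral lessThan_Suc power_one_over)

lemma entropy_rate_large: "\<exists>K. 154700259221 / 10 ^ 11 / 2 < entropy_rate K"
proof -
  \<comment> \<open>The limit of the lower bounds as \<open>K\<close> grows. It exceeds the target
    strictly, so some finite \<open>K\<close> works.\<close>
  define C where "C = 2 * (555792478292476 / 10 ^ 15 + tail_approx (87 / 4)) - 69314718056 / 10 ^ 11 * (1 - 37954934726403 / 10 ^ 14)"
  \<comment> \<open>The threshold 54 is \<open>2 * 27\<close>, so that all 27 evaluated symmetry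
    terms are included.\<close>
  have "entropy_rate K \<ge> C - 2 * tail_approx (real K + 7 / 4)" if K: "K \<ge> 54" for K
  proof -
    define s where "s = (\<Sum>k=1..K. 2 * sym_prob k / (real (k + 1) * real (k + 2)))"
    have "s \<ge> 37954934726403 / 10 ^ 14"
      using sum_sym_prob_ge[of 27 K] sum_shape_moment_ge K unfolding s_def by linarith
    then have "ln 2 * (1 - s) \<le> ln 2 * (1 - 37954934726403 / 10 ^ 14)"
      by (intro mult_left_mono) auto
    also have "\<dots> \<le> 69314718056 / 10 ^ 11 * (1 - 37954934726403 / 10 ^ 14)"
      by (intro mult_right_mono ln_2_upper) simp
    finally show ?thesis
      unfolding entropy_rate_def C_def s_def[symmetric] using sum_ln_ratio_ge[of K] K by simp
  qed
  moreover have "(\<lambda>K. C - 2 * tail_approx (real K + 7 / 4)) \<longlonglongrightarrow> C"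
    unfolding tail_approx_def by real_asymp
  moreover have "154700259221 / 10 ^ 11 / 2 < C"
    unfolding C_def tail_approx_def by (simp add: power_divide)
  ultimately have "eventually (\<lambda>K. 154700259221 / 10 ^ 11 / 2 < C - 2 * tail_approx (real K + 7 / 4)) sequentially"
    by (intro order_tendstoD(1))
  then obtain K0 where "\<And>K. K \<ge> K0 \<Longrightarrow> 154700259221 / 10 ^ 11 / 2 < C - 2 * tail_approx (real K + 7 / 4)"
    unfolding eventually_sequentially by blast
  with \<open>\<And>K. K \<ge> 54 \<Longrightarrow> _\<close> have "154700259221 / 10 ^ 11 / 2 < entropy_rate (max K0 54)"
    by (meson less_le_trans max.cobounded1 max.cobounded2)
  then show ?thesis by blast
qed

subsection \<open>Numerical value of the growth rate\<close>

text \<open>Monotonicity allows the square of the argument to be rounded up, which keeps the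
  rational numbers short.\<close>

lemma shape_gf_bound_step:
  assumes "0 \<le> x" "x\<^sup>2 \<le> z" "\<And>h. shape_gf h z \<le> u" "1 + x / 2 * (y\<^sup>2 + u) \<le> y"
  shows "shape_gf h x \<le> y"
proof (rule shape_gf_bound[OF assms(1) _ assms(4)])
  fix h
  show "shape_gf h (x\<^sup>2) \<le> u" using shape_gf_mono[of "x\<^sup>2" z h] assms(2) assms(3)[of h] by simp
qed

text \<open>The radius of convergence of the generating function is \<open>0.40269750367...\<close>. The values at
  \<open>x\<close>, \<open>x ^ 2\<close>, \<open>x ^ 4\<close> and \<open>x ^ 8\<close> are bounded by the rounded smaller root of the quadratic equation that
  the functional equation becomes once the value at the square of the argument is known.\<close>

lemma shape_gf_le: "shape_gf h (40269750366 / 10 ^ 11) \<le> 10 ^ 11 / 40269750366"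
proof -
  \<comment> \<open>The argument is \<open>x ^ 16\<close> rounded up, small enough for the linear
    bound; the following steps take square roots back to \<open>x\<close>.\<close>
  have 4: "shape_gf h (9565176631 / 20000000000000000) \<le> 10000009565176631/10000000000000000" for h
    using shape_gf_bound_base[of "9565176631 / 20000000000000000" h] by simp
  have 3: "shape_gf h (43222662582713/62500000000000000) \<le> 500346020843911/500000000000000" for h
    by (rule shape_gf_bound_step[OF _ _ 4]) (simp_all add: power2_eq_square)
  have 2: "shape_gf h (1051903114415701/40000000000000000) \<le> 1027027027394849/1000000000000000" for h
    by (rule shape_gf_bound_step[OF _ _ 3]) (simp_all add: power2_eq_square)
  have 1: "shape_gf h (81082639726997857/500000000000000000) \<le> 600020526277213/500000000000000" for h
    by (rule shape_gf_bound_step[OF _ _ 2]) (simp_all add: power2_eq_square)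
  \<comment> \<open>At \<open>y = 1 / x\<close> the gap \<open>y - 1 - x / 2 * (y^2 + u)\<close> is
    largest as a function of \<open>y\<close>, so this is the most favourable choice so close to the
    radius of convergence.\<close>
  show ?thesis
    by (rule shape_gf_bound_step[OF _ _ 1]) (simp_all add: power2_eq_square)
qed

lemma exp_ge_Taylor_sum:
  fixes z :: real
  assumes "z \<ge> 0"
  shows "(\<Sum>k<n. z ^ k / fact k) \<le> exp z"
proof -
  have s: "(\<lambda>k. z ^ k / fact k) sums exp z"
    using exp_converges[of z] by (simp add: divide_inverse mult.commute)
  have "(\<Sum>k<n. z ^ k / fact k) \<le> (\<Sum>k. z ^ k / fact k)"
    using assms by (intro sum_le_suminf sums_summable[OF s]) auto
  then show ?thesis using sums_unique[OF s] by simp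
qed

text \<open>The logarithm is compared with a rational number by exponentiating: a Taylor polynomial
  of \<open>exp\<close> already exceeds \<open>1 / x\<close>.\<close>

lemma growth_rate_less: "2 * ln (1 / (40269750366 / 10 ^ 11 :: real)) < 476056 / 261693"
proof -
  let ?z = "238028 / 261693 :: real"
  have "1 / (40269750366 / 10 ^ 11 :: real) < (\<Sum>k<14. ?z ^ k / fact k)"
    by (simp add: lessThan_nat_numeral lessThan_Suc fact_numeral power_divide)
  also have "\<dots> \<le> exp ?z" by (rule exp_ge_Taylor_sum) simp
  finally have "exp (ln (1 / (40269750366 / 10 ^ 11 :: real))) < exp ?z"
    by (subst exp_ln) simp_all
  then have "ln (1 / (40269750366 / 10 ^ 11 :: real)) < ?z" by (simp only: exp_less_cancel_iff)
  moreover have "2 * ?z = 476056 / 261693" by simp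
  ultimately show ?thesis by linarith
qed


theorem theorem4:
  shows "\<exists>c3 c4 :: real.
    \<bar>c3 - 1.5470025923\<bar> < 1 / 10 ^ 10 \<and> \<bar>c4 - 1.8191392203\<bar> < 1 / 10 ^ 10 \<and>
    (\<exists>\<epsilon> \<delta> :: nat \<Rightarrow> real. \<epsilon> \<in> o(\<lambda>_. 1) \<and> \<delta> \<in> o(\<lambda>_. 1) \<and>
      (\<forall>\<^sub>F n in sequentially.
        c3 * (real n / ln (real n)) * (1 + \<epsilon> n)
          \<le> measure_pmf.expectation (random_bst n) (\<lambda>t. real (num_distinct_fringe t)) \<and>
        measure_pmf.expectation (random_bst n) (\<lambda>t. real (num_distinct_fringe t))
          \<le> c4 * (real n / ln (real n)) * (1 + \<delta> n))) \<and>
    (\<exists>\<epsilon> \<delta> :: nat \<Rightarrow> real. \<epsilon> \<in> o(\<lambda>_. 1) \<and> \<delta> \<in> o(\<lambda>_. 1) \<and>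
      (\<lambda>n. measure_pmf.prob (random_bst n)
         {t. c3 * (real n / ln (real n)) * (1 + \<epsilon> n) \<le> real (num_distinct_fringe t) \<and>
             real (num_distinct_fringe t) \<le> c4 * (real n / ln (real n)) * (1 + \<delta> n)})
        \<longlonglongrightarrow> 1)"
proof -
  \<comment> \<open>\<open>c3\<close> is below twice \<open>entropy_rate K\<close> for some
    \<open>K\<close>, and \<open>c4\<close> is above \<open>2 * ln (1 / x)\<close> for an admissible
    \<open>x\<close>; both are still within the permitted distance of the stated decimals.\<close>
  define c3 c4 :: real where "c3 = 154700259221 / 10 ^ 11" and "c4 = 476056 / 261693"
  define L where "L = (\<lambda>n. real n / ln (real n))"
  obtain K where K: "c3 / 2 < entropy_rate K" using entropy_rate_large unfolding c3_def by blast
  have x: "0 < (40269750366 / 10 ^ 11 :: real)" "(40269750366 / 10 ^ 11 :: real) < 1" by simp_all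
  have c4: "2 * ln (1 / (40269750366 / 10 ^ 11)) < c4"
    unfolding c4_def by (rule growth_rate_less)
  note upper = num_shapes_upper_bounds[OF x shape_gf_le c4]
  have "c3 > 0" by (simp add: c3_def)
  have "eventually (\<lambda>n. c3 * L n \<le> rexp n (\<lambda>t. real (num_shapes t)) \<and>
      rexp n (\<lambda>t. real (num_shapes t)) \<le> c4 * L n) sequentially"
    using expectation_num_shapes_ge[OF \<open>c3 > 0\<close> K] upper(1) unfolding L_def
    by eventually_elim simp
  then have 1: "eventually (\<lambda>n. c3 * L n * (1 + 0)
        \<le> measure_pmf.expectation (random_bst n) (\<lambda>t. real (num_distinct_fringe t)) \<and>
      measure_pmf.expectation (random_bst n) (\<lambda>t. real (num_distinct_fringe t))
        \<le> c4 * L n * (1 + 0)) sequentially"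
    unfolding expectation_random_bst by simp
  have 2: "(\<lambda>n. measure_pmf.prob (random_bst n)
         {t. c3 * L n * (1 + 0) \<le> real (num_distinct_fringe t) \<and>
             real (num_distinct_fringe t) \<le> c4 * L n * (1 + 0)}) \<longlonglongrightarrow> 1"
  proof -
    define p where "p = (\<lambda>n. measure_pmf.prob (rbst n) {t. c3 * L n \<le> real (num_shapes t) \<and> real (num_shapes t) \<le> c4 * L n})"
    define q where "q = (\<lambda>n. rexp n (\<lambda>t. of_bool (real (num_shapes t) < c3 * L n)) + rexp n (\<lambda>t. of_bool (real (num_shapes t) > c4 * L n)))"
    \<comment> \<open>The union bound over the two ways of leaving the interval.\<close>
    have "1 - q n \<le> p n" for n
    proof -
      have "1 - q n = rexp n (\<lambda>t. 1 - (of_bool (real (num_shapes t) < c3 * L n) + of_bool (real (num_shapes t) > c4 * L n)))"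
        by (simp add: q_def)
      also have "\<dots> \<le> rexp n (indicator {t. c3 * L n \<le> real (num_shapes t) \<and> real (num_shapes t) \<le> c4 * L n})"
        by (intro rexp_mono) (auto simp: indicator_def)
      finally show ?thesis by (simp add: p_def)
    qed
    moreover have "p n \<le> 1" for n by (simp add: p_def)
    moreover have "q \<longlonglongrightarrow> 0 + 0"
      unfolding q_def using prob_num_shapes_less_tendsto[OF \<open>c3 > 0\<close> K] upper(2)
      by (intro tendsto_add) (simp_all only: L_def)
    then have "(\<lambda>n. 1 - q n) \<longlonglongrightarrow> 1 - (0 + 0)" by (intro tendsto_diff tendsto_const)
    ultimately have "p \<longlonglongrightarrow> 1"
      by (intro tendsto_sandwich[of "\<lambda>n. 1 - q n" p sequentially "\<lambda>_. 1" 1]) auto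
    then show ?thesis
      by (simp add: p_def prob_random_bst[of _ "\<lambda>k. c3 * L _ \<le> real k \<and> real k \<le> c4 * L _"])
  qed
  \<comment> \<open>The zero function is the witness for all four error terms.\<close>
  have "(\<lambda>_. 0) \<in> o(\<lambda>_ :: nat. 1 :: real)" by simp
  moreover have "\<bar>c3 - 1.5470025923\<bar> < 1 / 10 ^ 10" "\<bar>c4 - 1.8191392203\<bar> < 1 / 10 ^ 10"
    by (simp_all add: c3_def c4_def)
  ultimately show ?thesis using 1 2 unfolding L_def by blast
qed

end
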